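(* Assume that $\kappa\neq\kappa_0$ or $\frac{\rho_1}{\rho_2}\neq\frac{\kappa}{b}$. Then the locally damped Bresse system with the boundary conditions $\varphi=\psi_x=\omega_x=0$ at $x=0,L$ is not uniformly (exponentially) stable; that is, there do not exist constants $M\ge1$ and $\delta>0$ such that $E(t)\le Me^{-\delta t}E(0)$ for all $t>0$ and all initial data in $\mathcal{H}_1$.
   Context: Let $\rho_1,\rho_2,\kappa,\kappa_0,b,l,L$ be positive constants (arising physically as $\rho_1=\rho A$, $\rho_2=\rho I$, $\kappa_0=EA$, $\kappa=\kappa' GA$, $b=EI$, $l=R^{-1}$), with $L\neq \frac{n\pi}{l}$ for every integer $n$. Let $a\in L^\infty([0,L];\mathbb{R}^+)$ be such that, for some $0\le\alpha<\beta\le L$ and some $a_0>0$, $a\ge a_0$ on $]\alpha,\beta[$. The locally damped Bresse system is, in $(0,L)\times(0,\infty)$, $$\rho_1\varphi_{tt}-\kappa(\varphi_x+\psi+l\omega)_x-\kappa_0 l(\omega_x-l\varphi)=0,$$ $$\rho_2\psi_{tt}-b\psi_{xx}+\kappa(\varphi_x+\psi+l\omega)+a(x)\psi_t=0,$$ $$\rho_1\omega_{tt}-\kappa_0(\omega_x-l\varphi)_x+\kappa l(\varphi_x+\psi+l\omega)=0,$$ with, here, the boundary conditions $\varphi=\psi_x=\omega_x=0$ at $x=0$ and $x=L$. Its energy is $$E(t)=\frac12\int_0^L\{\kappa|\varphi_x+\psi+l\omega|^2+b|\psi_x|^2+\kappa_0|\omega_x-l\varphi|^2+\rho_1|\varphi_t|^2+\rho_2|\psi_t|^2+\rho_1|\omega_t|^2\}\,dx.$$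 All function spaces are on $(0,L)$. Put $L^2_*=\{f\in L^2:\int_0^L f\,dx=0\}$, $H^1_*=H^1\cap L^2_*$, and $\mathcal{H}_1=H^1_0\times(H^1_* )^2\times L^2\times(L^2_* )^2$ with the norm, for $U=(\varphi,\psi,\omega,u,v,z)$, $$\|U\|_{\mathcal{H}_1}^2=\kappa\|\varphi_x+\psi+l\omega\|^2+b\|\psi_x\|^2+\kappa_0\|\omega_x-l\varphi\|^2+\rho_1\|u\|^2+\rho_2\|v\|^2+\rho_1\|z\|^2,$$ $\|\cdot\|$ being the $L^2(0,L)$ norm. The operator $\mathcal{A}_1$ has domain $$D(\mathcal{A}_1)=\{U\in\mathcal{H}_1:\varphi\in H^1_0\cap H^2,\ \psi,\omega\in H^1_*\cap H^2,\ u,\psi_x,\omega_x\in H^1_0,\ v,z\in H^1_*\},$$ and $\mathcal{A}_1U$ has components $u$, $v$, $z$, $\frac{\kappa}{\rho_1}(\varphi_x+\psi+l\omega)_x+\frac{\kappa_0 l}{\rho_1}(\omega_x-l\varphi)$, $\frac{b}{\rho_2}\psi_{xx}-\frac{\kappa}{\rho_2}(\varphi_x+\psi+l\omega)-\frac1{\rho_2}a(x)v$, $\frac{\kappa_0}{\rho_1}(\omega_x-l\varphi)_x-\frac{\kappa l}{\rho_1}(\varphi_x+\psi+l\omega)$. The paper's framework is that $\mathcal{A}_1$ is m-dissipative and generates a $C^0$-semigroup of contractions $e^{t\mathcal{A}_1}$ on $\mathcal{H}_1$; the solution with initial datum $U_0\in\mathcal{H}_1$ is $U(t)=(\varphi,\psi,\omega,\varphi_t,\psi_t,\omega_t)(t)=e^{t\mathcal{A}_1}U_0$,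 and $E(t)=\frac12\|U(t)\|_{\mathcal{H}_1}^2$.
   Formalization: For nonconstant a, A_1 does not map D(A_1) into H_1 (the integral of a·v need not vanish), so no semigroup exists there; the result is stated for the semigroup on H_1 when it exists, or for that of the same system without mean-zero constraints, with initial data still in H_1. *)

theory Defs
  imports "HOL-Analysis.Analysis" "HOL-Library.Function_Algebras"
begin

text \<open>
  Elements of Lebesgue and Sobolev spaces on \<open>]0,L[\<close> are represented by functions
  \<open>real \<Rightarrow> real\<close> of which only the values on \<open>]0,L[\<close>, up to null sets, matter. Pointwise
  operations make the six-component states below a real vector space.
\<close>

instantiation "fun" :: (type, scaleR) scaleR
begin
definition scaleR_fun :: "real \<Rightarrow> ('a \<Rightarrow> 'b) \<Rightarrow> 'a \<Rightarrow> 'b"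
  where "scaleR_fun c f = (\<lambda>x. c *\<^sub>R f x)"
instance ..
end

instance "fun" :: (type, real_vector) real_vector
  by standard (simp_all add: scaleR_fun_def fun_eq_iff algebra_simps)

section \<open>Function spaces on a bounded interval\<close>

abbreviation interval_measure :: "real \<Rightarrow> real measure"
  where "interval_measure L \<equiv> lebesgue_on {0<..<L}"

definition L2 :: "real \<Rightarrow> (real \<Rightarrow> real) set"
  where "L2 L = {f \<in> borel_measurable (interval_measure L).
                   integrable (interval_measure L) (\<lambda>x. (f x)\<^sup>2)}"

definition L2_norm_on :: "real \<Rightarrow> (real \<Rightarrow> real) \<Rightarrow> real"
  where "L2_norm_on L f = sqrt (\<integral>x. (f x)\<^sup>2 \<partial>interval_measure L)"

text \<open>Test functions are the compactly supported \<open>C\<^sup>1\<close> functions on \<open>]0,L[\<close>; they yield the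
  same Sobolev spaces as the compactly supported smooth functions.\<close>

definition test_functions :: "real \<Rightarrow> (real \<Rightarrow> real) set"
  where "test_functions L = {\<eta>. \<eta> C1_differentiable_on UNIV \<and>
           (\<exists>K. compact K \<and> K \<subseteq> {0<..<L} \<and> (\<forall>x. x \<notin> K \<longrightarrow> \<eta> x = 0))}"

definition has_weak_deriv :: "real \<Rightarrow> (real \<Rightarrow> real) \<Rightarrow> (real \<Rightarrow> real) \<Rightarrow> bool"
  where "has_weak_deriv L f g \<longleftrightarrow>
           (\<forall>\<eta>\<in>test_functions L.
              (\<integral>x. f x * deriv \<eta> x \<partial>interval_measure L) = - (\<integral>x. g x * \<eta> x \<partial>interval_measure L))"

definition H1 :: "real \<Rightarrow> (real \<Rightarrow> real) set"
  where "H1 L = {f \<in> L2 L. \<exists>g\<in>L2 L. has_weak_deriv L f g}"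

text \<open>A representative of the weak derivative, unique up to null sets; meaningful for
  \<open>f \<in> H1 L\<close> only.\<close>

definition wderiv :: "real \<Rightarrow> (real \<Rightarrow> real) \<Rightarrow> real \<Rightarrow> real"
  where "wderiv L f = (SOME g. g \<in> L2 L \<and> has_weak_deriv L f g)"

definition H1_norm_on :: "real \<Rightarrow> (real \<Rightarrow> real) \<Rightarrow> real"
  where "H1_norm_on L f = sqrt ((L2_norm_on L f)\<^sup>2 + (L2_norm_on L (wderiv L f))\<^sup>2)"

definition H2 :: "real \<Rightarrow> (real \<Rightarrow> real) set"
  where "H2 L = {f \<in> H1 L. wderiv L f \<in> H1 L}"

text \<open>\<open>H\<^sup>1\<^sub>0\<close>: the closure of the test functions in \<open>H\<^sup>1\<close>.\<close>

definition H1_0 :: "real \<Rightarrow> (real \<Rightarrow> real) set"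
  where "H1_0 L = {f \<in> H1 L. \<forall>\<epsilon>>0. \<exists>\<eta>\<in>test_functions L. H1_norm_on L (f - \<eta>) < \<epsilon>}"

definition L2_star :: "real \<Rightarrow> (real \<Rightarrow> real) set"
  where "L2_star L = {f \<in> L2 L. (\<integral>x. f x \<partial>interval_measure L) = 0}"

definition H1_star :: "real \<Rightarrow> (real \<Rightarrow> real) set"
  where "H1_star L = H1 L \<inter> L2_star L"

section \<open>Strongly continuous semigroups\<close>

text \<open>
  The spaces consist of functions rather than of equivalence classes, so a norm on classes
  becomes a seminorm \<open>N\<close> on a set \<open>X\<close>, and \<open>N (U - V) = 0\<close> plays the role of \<open>U = V\<close>.
  The values \<open>T t\<close> for \<open>t < 0\<close> are irrelevant.
\<close>

definition C0_semigroup ::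
  "'v::real_vector set \<Rightarrow> ('v \<Rightarrow> real) \<Rightarrow> (real \<Rightarrow> 'v \<Rightarrow> 'v) \<Rightarrow> bool"
  where "C0_semigroup X N T \<longleftrightarrow>
     (\<forall>t\<ge>0. \<forall>U\<in>X. T t U \<in> X) \<and>
     (\<forall>t\<ge>0. \<forall>c d. \<forall>U\<in>X. \<forall>V\<in>X.
        N (T t (c *\<^sub>R U + d *\<^sub>R V) - (c *\<^sub>R T t U + d *\<^sub>R T t V)) = 0) \<and>
     (\<forall>t\<ge>0. \<exists>C. \<forall>U\<in>X. N (T t U) \<le> C * N U) \<and>
     (\<forall>U\<in>X. N (T 0 U - U) = 0) \<and>
     (\<forall>s\<ge>0. \<forall>t\<ge>0. \<forall>U\<in>X. N (T (s + t) U - T s (T t U)) = 0) \<and>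
     (\<forall>U\<in>X. \<forall>s\<ge>0. ((\<lambda>t. N (T t U - T s U)) \<longlongrightarrow> 0) (at s within {0..}))"

text \<open>
  \<open>generates X N D A T\<close>: the operator \<open>A\<close> with domain \<open>D\<close>, as an operator in \<open>X\<close>, is the
  infinitesimal generator of \<open>T\<close>. Elements \<open>U \<in> D\<close> with \<open>A U \<notin> X\<close> do not belong to the
  domain of \<open>A\<close> as an operator in \<open>X\<close>.
\<close>

definition generates ::
  "'v::real_vector set \<Rightarrow> ('v \<Rightarrow> real) \<Rightarrow> 'v set \<Rightarrow> ('v \<Rightarrow> 'v) \<Rightarrow> (real \<Rightarrow> 'v \<Rightarrow> 'v) \<Rightarrow> bool"
  where "generates X N D A T \<longleftrightarrow> C0_semigroup X N T \<and>
     (\<forall>U\<in>X. \<forall>F\<in>X.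
        ((\<lambda>h. N ((1 / h) *\<^sub>R (T h U - U) - F)) \<longlongrightarrow> 0) (at_right 0) \<longleftrightarrow>
        U \<in> D \<and> N (A U - F) = 0)"

section \<open>The locally damped Bresse system\<close>

text \<open>A state \<open>(\<phi>, \<psi>, \<omega>, u, v, z)\<close>; along solutions \<open>u\<close>, \<open>v\<close>, \<open>z\<close> are the time derivatives
  of \<open>\<phi>\<close>, \<open>\<psi>\<close>, \<open>\<omega>\<close>.\<close>

type_synonym state =
  "(real \<Rightarrow> real) \<times> (real \<Rightarrow> real) \<times> (real \<Rightarrow> real) \<times> (real \<Rightarrow> real) \<times> (real \<Rightarrow> real) \<times> (real \<Rightarrow> real)"

definition shear :: "real \<Rightarrow> real \<Rightarrow> (real \<Rightarrow> real) \<Rightarrow> (real \<Rightarrow> real) \<Rightarrow> (real \<Rightarrow> real) \<Rightarrow> real \<Rightarrow> real"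
  where "shear l L \<phi> \<psi> \<omega> = (\<lambda>x. wderiv L \<phi> x + \<psi> x + l * \<omega> x)"

definition axial :: "real \<Rightarrow> real \<Rightarrow> (real \<Rightarrow> real) \<Rightarrow> (real \<Rightarrow> real) \<Rightarrow> real \<Rightarrow> real"
  where "axial l L \<phi> \<omega> = (\<lambda>x. wderiv L \<omega> x - l * \<phi> x)"

fun bresse_energy ::
  "real \<Rightarrow> real \<Rightarrow> real \<Rightarrow> real \<Rightarrow> real \<Rightarrow> real \<Rightarrow> real \<Rightarrow> state \<Rightarrow> real"
  where "bresse_energy \<rho>1 \<rho>2 \<kappa> \<kappa>0 b l L (\<phi>, \<psi>, \<omega>, u, v, z) =
     1/2 * (\<integral>x. \<kappa> * (shear l L \<phi> \<psi> \<omega> x)\<^sup>2 + b * (wderiv L \<psi> x)\<^sup>2 + \<kappa>0 * (axial l L \<phi> \<omega> x)\<^sup>2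
                 + \<rho>1 * (u x)\<^sup>2 + \<rho>2 * (v x)\<^sup>2 + \<rho>1 * (z x)\<^sup>2 \<partial>interval_measure L)"

definition bresse_space :: "real \<Rightarrow> state set"
  where "bresse_space L = H1_0 L \<times> H1_star L \<times> H1_star L \<times> L2 L \<times> L2_star L \<times> L2_star L"

fun bresse_norm ::
  "real \<Rightarrow> real \<Rightarrow> real \<Rightarrow> real \<Rightarrow> real \<Rightarrow> real \<Rightarrow> real \<Rightarrow> state \<Rightarrow> real"
  where "bresse_norm \<rho>1 \<rho>2 \<kappa> \<kappa>0 b l L (\<phi>, \<psi>, \<omega>, u, v, z) =
     sqrt (\<kappa> * (L2_norm_on L (shear l L \<phi> \<psi> \<omega>))\<^sup>2 + b * (L2_norm_on L (wderiv L \<psi>))\<^sup>2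
           + \<kappa>0 * (L2_norm_on L (axial l L \<phi> \<omega>))\<^sup>2
           + \<rho>1 * (L2_norm_on L u)\<^sup>2 + \<rho>2 * (L2_norm_on L v)\<^sup>2 + \<rho>1 * (L2_norm_on L z)\<^sup>2)"

fun bresse_op ::
  "real \<Rightarrow> real \<Rightarrow> real \<Rightarrow> real \<Rightarrow> real \<Rightarrow> real \<Rightarrow> real \<Rightarrow> (real \<Rightarrow> real) \<Rightarrow> state \<Rightarrow> state"
  where "bresse_op \<rho>1 \<rho>2 \<kappa> \<kappa>0 b l L a (\<phi>, \<psi>, \<omega>, u, v, z) =
     (u, v, z,
      \<lambda>x. \<kappa> / \<rho>1 * wderiv L (shear l L \<phi> \<psi> \<omega>) x + \<kappa>0 * l / \<rho>1 * axial l L \<phi> \<omega> x,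
      \<lambda>x. b / \<rho>2 * wderiv L (wderiv L \<psi>) x - \<kappa> / \<rho>2 * shear l L \<phi> \<psi> \<omega> x - 1 / \<rho>2 * a x * v x,
      \<lambda>x. \<kappa>0 / \<rho>1 * wderiv L (axial l L \<phi> \<omega>) x - \<kappa> * l / \<rho>1 * shear l L \<phi> \<psi> \<omega> x)"

definition bresse_dom :: "real \<Rightarrow> state set"
  where "bresse_dom L = {(\<phi>, \<psi>, \<omega>, u, v, z).
     \<phi> \<in> H1_0 L \<inter> H2 L \<and> \<psi> \<in> H1_star L \<inter> H2 L \<and> \<omega> \<in> H1_star L \<inter> H2 L \<and>
     u \<in> H1_0 L \<and> wderiv L \<psi> \<in> H1_0 L \<and> wderiv L \<omega> \<in> H1_0 L \<and>
     v \<in> H1_star L \<and> z \<in> H1_star L}"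

text \<open>
  The same operator without the zero-mean conditions. For \<open>U \<in> bresse_dom L\<close> the fifth
  component of \<open>bresse_op \<dots> a U\<close> has integral \<open>- (1 / \<rho>2) * (\<integral>x. a x * v x)\<close>. Unless \<open>a\<close> is constant
  almost everywhere this need not vanish, so that \<open>bresse_space L\<close> is not invariant under the
  evolution; the damped system is then well-posed in the space \<open>bresse_full_space L\<close>, on
  which the energy is only a seminorm and which carries its usual Sobolev norm.
\<close>

definition bresse_full_space :: "real \<Rightarrow> state set"
  where "bresse_full_space L = H1_0 L \<times> H1 L \<times> H1 L \<times> L2 L \<times> L2 L \<times> L2 L"

fun bresse_full_norm :: "real \<Rightarrow> state \<Rightarrow> real"
  where "bresse_full_norm L (\<phi>, \<psi>, \<omega>, u, v, z) =
     sqrt ((H1_norm_on L \<phi>)\<^sup>2 + (H1_norm_on L \<psi>)\<^sup>2 + (H1_norm_on L \<omega>)\<^sup>2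
           + (L2_norm_on L u)\<^sup>2 + (L2_norm_on L v)\<^sup>2 + (L2_norm_on L z)\<^sup>2)"

definition bresse_full_dom :: "real \<Rightarrow> state set"
  where "bresse_full_dom L = {(\<phi>, \<psi>, \<omega>, u, v, z).
     \<phi> \<in> H1_0 L \<inter> H2 L \<and> \<psi> \<in> H2 L \<and> \<omega> \<in> H2 L \<and>
     u \<in> H1_0 L \<and> wderiv L \<psi> \<in> H1_0 L \<and> wderiv L \<omega> \<in> H1_0 L \<and>
     v \<in> H1 L \<and> z \<in> H1 L}"

end

theory Submission
  imports Defs
begin

text \<open>
  The damping acts on the equation of \<open>\<psi>\<close> only, and the three waves are coupled through terms of
  lower order than the principal parts. Under either hypothesis the pair \<open>(\<phi>, \<omega>)\<close> carries waves of
  high frequency that hardly excite \<open>\<psi>\<close>, and hence are hardly damped. This contradicts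
  exponential decay with a rate common to all initial data.

  Concretely, let \<open>k = n \<pi> / L\<close> and consider the standing waves with
  \<open>\<phi> = A sin (k x)\<close>, \<open>\<psi> \<approx> D cos (k x)\<close>, \<open>\<omega> = B cos (k x)\<close> and time frequency \<open>\<mu>\<close>; these
  profiles satisfy the boundary conditions and have mean zero where required. Inserting them into the
  system without damping leaves the three coefficients \<open>residual_\<phi>\<close>, \<open>residual_\<psi>\<close>,
  \<open>residual_\<omega>\<close>, and the damping leaves a term of size \<open>\<mu> D\<close>. The parameters are chosen
  such that all of these tend to zero as \<open>n \<rightarrow> \<infinity>\<close> while \<open>\<mu> B\<close>, hence the energy, has a nonzero
  limit:

  \<^item> If \<open>\<kappa> \<noteq> \<kappa>0\<close>, the wave \<open>\<omega>\<close> travels at its own speed, \<open>\<mu>\<^sup>2 = \<kappa>0 k\<^sup>2 / \<rho>1\<close>, with \<open>B = 1 / k\<close>;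
    the component \<open>\<phi>\<close> is driven off resonance, so \<open>A\<close> is of order \<open>1 / k\<^sup>2\<close>, and \<open>D = 0\<close> suffices
    (lemma \<open>no_decay_distinct_wave_speeds\<close>).

  \<^item> If \<open>\<kappa> = \<kappa>0\<close>, the waves \<open>\<phi>\<close> and \<open>\<omega>\<close> resonate and their coupling splits the frequency; with
    \<open>B = - A = 1 / k\<close> one gets \<open>\<mu>\<^sup>2 = \<kappa> (k - l)\<^sup>2 / \<rho>1\<close>. Now \<open>\<psi>\<close> is forced by a term of order one,
    but off resonance, because \<open>\<kappa> / \<rho>1 \<noteq> b / \<rho>2\<close>; so \<open>D\<close> is of order \<open>1 / k\<^sup>2\<close>
    (lemma \<open>no_decay_equal_wave_speeds\<close>).

  The profile of \<open>\<psi>\<close> needs one more correction. A state belongs to the domain of the generator on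
  \<open>bresse_space L\<close> only if its image has mean zero, that is if \<open>a v\<close> has integral zero. A multiple
  \<open>\<gamma>\<close> of a fixed second cosine is added to enforce this, and \<open>\<gamma> \<rightarrow> 0\<close> by the Riemann-Lebesgue lemma
  (\<open>orthogonal_correction\<close>). The same profiles then serve for both settings of the semigroup.

  To compare a standing wave with the true solution, the solution is tested against a fixed
  functional, the cosine coefficient of \<open>\<omega>\<^sub>t\<close>. Along the semigroup this gives real functions with
  explicit right derivatives, and an elementary mean value inequality bounds the difference by the
  elapsed time multiplied by the size of the residuals (\<open>quasimode_estimate\<close>). The assumed decay is
  itself what bounds the effect of the semigroup on the residuals. Choosing first a time
  beyond which the decay has made the solution small, and then a frequency for which the residuals are
  negligible over that time, gives a contradiction (\<open>modes_prevent_decay\<close>).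

  To verify that the profiles lie in the spaces of the statement, one needs that weak derivatives are
  unique almost everywhere (\<open>weak_null_AE\<close>), that \<open>C\<^sup>1\<close> functions are weakly differentiable, and
  that \<open>sin (k x)\<close> is a limit of test functions (\<open>H1_0_C1\<close>).
\<close>

section \<open>Square-integrable functions on an interval\<close>

lemma finite_interval_measure: "finite_measure (interval_measure L)"
  by (intro finite_measure_lebesgue_on) auto

lemma measurable_cont:
  fixes f :: "real \<Rightarrow> real"
  assumes "continuous_on UNIV f"
  shows "f \<in> borel_measurable (interval_measure L)"
  using assms by (intro continuous_imp_measurable_on_sets_lebesgue continuous_on_subset[OF assms]) auto

lemma measurable_indicator:
  "A \<in> sets borel \<Longrightarrow> indicator A \<in> borel_measurable (interval_measure L)"
  by (intro measurable_restrict_space1 borel_measurable_indicator) auto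

lemma L2_bounded:
  assumes "f \<in> borel_measurable (interval_measure L)" "AE x in interval_measure L. \<bar>f x\<bar> \<le> C"
  shows "f \<in> L2 L"
proof -
  have "integrable (interval_measure L) (\<lambda>x. (f x)\<^sup>2)"
  proof (rule finite_measure.integrable_const_bound[OF finite_interval_measure])
    show "AE x in interval_measure L. norm ((f x)\<^sup>2) \<le> C\<^sup>2"
      using assms(2) by eventually_elim (simp add: abs_le_square_iff[symmetric])
    show "(\<lambda>x. (f x)\<^sup>2) \<in> borel_measurable (interval_measure L)"
      using assms(1) by measurable
  qed
  then show ?thesis using assms by (simp add: L2_def)
qed

lemma L2_cont:
  assumes "continuous_on UNIV f"
  shows "f \<in> L2 L"
proof -
  have "compact (f ` {0..L})"
    by (intro compact_continuous_image continuous_on_subset[OF assms]) auto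
  then obtain C where C: "\<forall>y\<in>f ` {0..L}. norm y \<le> C"
    using compact_imp_bounded bounded_iff by blast
  show ?thesis
  proof (rule L2_bounded[OF measurable_cont[OF assms]])
    show "AE x in interval_measure L. \<bar>f x\<bar> \<le> C"
      using C by (intro AE_I2) auto
  qed
qed

lemma L2_measurable: "f \<in> L2 L \<Longrightarrow> f \<in> borel_measurable (interval_measure L)"
  and L2_square: "f \<in> L2 L \<Longrightarrow> integrable (interval_measure L) (\<lambda>x. (f x)\<^sup>2)"
  by (auto simp: L2_def)

lemma L2_mult_integrable:
  assumes "f \<in> L2 L" "g \<in> L2 L"
  shows "integrable (interval_measure L) (\<lambda>x. f x * g x)"
proof (rule Bochner_Integration.integrable_bound)
  show "integrable (interval_measure L) (\<lambda>x. (f x)\<^sup>2 + (g x)\<^sup>2)"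
    using assms L2_square by auto
  show "(\<lambda>x. f x * g x) \<in> borel_measurable (interval_measure L)"
    using assms[THEN L2_measurable] by measurable
  have "\<bar>u * v\<bar> \<le> u\<^sup>2 + v\<^sup>2" for u v :: real
  proof -
    have "2 * \<bar>u\<bar> * \<bar>v\<bar> \<le> u\<^sup>2 + v\<^sup>2" using sum_squares_bound[of "\<bar>u\<bar>" "\<bar>v\<bar>"] by simp
    moreover have "0 \<le> \<bar>u\<bar> * \<bar>v\<bar>" by simp
    ultimately show ?thesis unfolding abs_mult by linarith
  qed
  then show "AE x in interval_measure L. norm (f x * g x) \<le> norm ((f x)\<^sup>2 + (g x)\<^sup>2)"
    by (intro AE_I2) auto
qed

lemma L2_const: "(\<lambda>x. c) \<in> L2 L"
  by (intro L2_cont) auto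

lemma L2_integrable: "f \<in> L2 L \<Longrightarrow> integrable (interval_measure L) f"
  using L2_mult_integrable[OF _ L2_const[of 1]] by simp

lemma L2_lincomb:
  assumes "f \<in> L2 L" "g \<in> L2 L"
  shows "(\<lambda>x. c * f x + d * g x) \<in> L2 L"
proof -
  have "integrable (interval_measure L) (\<lambda>x. c\<^sup>2 * (f x)\<^sup>2 + 2 * c * d * (f x * g x) + d\<^sup>2 * (g x)\<^sup>2)"
    using assms L2_square L2_mult_integrable by auto
  also have "(\<lambda>x. c\<^sup>2 * (f x)\<^sup>2 + 2 * c * d * (f x * g x) + d\<^sup>2 * (g x)\<^sup>2) = (\<lambda>x. (c * f x + d * g x)\<^sup>2)"
    by (auto simp: power2_eq_square algebra_simps)
  finally show ?thesis
    using assms[THEN L2_measurable] by (auto simp: L2_def)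
qed

lemma L2_add: "f \<in> L2 L \<Longrightarrow> g \<in> L2 L \<Longrightarrow> (\<lambda>x. f x + g x) \<in> L2 L"
  using L2_lincomb[of f L g 1 1] by simp

lemma L2_diff: "f \<in> L2 L \<Longrightarrow> g \<in> L2 L \<Longrightarrow> (\<lambda>x. f x - g x) \<in> L2 L"
  using L2_lincomb[of f L g 1 "-1"] by simp

lemma L2_cmult: "f \<in> L2 L \<Longrightarrow> (\<lambda>x. c * f x) \<in> L2 L"
  using L2_lincomb[of f L f c 0] by simp

lemma L2_norm_power2: "(L2_norm_on L f)\<^sup>2 = (\<integral>x. (f x)\<^sup>2 \<partial>interval_measure L)"
  by (simp add: L2_norm_on_def)

lemma L2_norm_cong_AE:
  assumes "f \<in> L2 L" "g \<in> L2 L" "AE x in interval_measure L. f x = g x"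
  shows "L2_norm_on L f = L2_norm_on L g"
proof -
  have "(\<integral>x. (f x)\<^sup>2 \<partial>interval_measure L) = (\<integral>x. (g x)\<^sup>2 \<partial>interval_measure L)"
    using assms by (intro integral_cong_AE) (auto simp: L2_def)
  then show ?thesis by (simp add: L2_norm_on_def)
qed

lemma L2_norm_lincomb:
  assumes "f \<in> L2 L" "g \<in> L2 L"
  shows "(L2_norm_on L (\<lambda>x. c * f x + d * g x))\<^sup>2
    \<le> 2 * c\<^sup>2 * (L2_norm_on L f)\<^sup>2 + 2 * d\<^sup>2 * (L2_norm_on L g)\<^sup>2"
proof -
  have "(\<integral>x. (c * f x + d * g x)\<^sup>2 \<partial>interval_measure L)
      \<le> (\<integral>x. 2 * c\<^sup>2 * (f x)\<^sup>2 + 2 * d\<^sup>2 * (g x)\<^sup>2 \<partial>interval_measure L)"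
  proof (rule integral_mono)
    show "integrable (interval_measure L) (\<lambda>x. (c * f x + d * g x)\<^sup>2)"
      using L2_lincomb[OF assms] L2_square by blast
    show "integrable (interval_measure L) (\<lambda>x. 2 * c\<^sup>2 * (f x)\<^sup>2 + 2 * d\<^sup>2 * (g x)\<^sup>2)"
      using assms[THEN L2_square] by auto
    show "(c * f x + d * g x)\<^sup>2 \<le> 2 * c\<^sup>2 * (f x)\<^sup>2 + 2 * d\<^sup>2 * (g x)\<^sup>2" for x
      using sum_squares_bound[of "c * f x" "d * g x"]
      by (simp add: power2_eq_square algebra_simps)
  qed
  also have "\<dots> = 2 * c\<^sup>2 * (L2_norm_on L f)\<^sup>2 + 2 * d\<^sup>2 * (L2_norm_on L g)\<^sup>2"
    using assms[THEN L2_square] by (simp add: L2_norm_power2)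
  finally show ?thesis by (simp add: L2_norm_power2)
qed

text \<open>The defect \<open>f - h\<close>, with \<open>h\<close> the projection of \<open>f\<close> onto the span of the \<open>e i\<close>, has a
  nonnegative square integral. Taking a single function \<open>e i\<close> gives the Cauchy-Schwarz inequality.\<close>

lemma Bessel:
  fixes e :: "nat \<Rightarrow> real \<Rightarrow> real"
  assumes f: "f \<in> L2 L" and e: "\<And>i. i \<in> I \<Longrightarrow> e i \<in> L2 L" and "finite I" and "s > 0"
    and ortho: "\<And>i j. i \<in> I \<Longrightarrow> j \<in> I \<Longrightarrow>
      (\<integral>x. e i x * e j x \<partial>interval_measure L) = (if i = j then s else 0)"
  shows "(\<Sum>i\<in>I. (\<integral>x. f x * e i x \<partial>interval_measure L)\<^sup>2) \<le> s * (\<integral>x. (f x)\<^sup>2 \<partial>interval_measure L)"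
proof -
  let ?M = "interval_measure L"
  define c where "c i = (\<integral>x. f x * e i x \<partial>?M) / s" for i
  define h where "h x = (\<Sum>i\<in>I. c i * e i x)" for x
  have hh: "(h x)\<^sup>2 = (\<Sum>i\<in>I. \<Sum>j\<in>I. c i * c j * (e i x * e j x))" for x
    by (simp add: h_def power2_eq_square sum_product mult_ac)
  have fh: "f x * h x = (\<Sum>i\<in>I. c i * (f x * e i x))" for x
    by (simp add: h_def sum_distrib_left mult_ac)
  have inte: "integrable ?M (\<lambda>x. e i x * e j x)" if "i \<in> I" "j \<in> I" for i j
    using that e L2_mult_integrable by blast
  have intf: "integrable ?M (\<lambda>x. f x * e i x)" if "i \<in> I" for i
    using that e f L2_mult_integrable by blast
  have i1: "integrable ?M (\<lambda>x. (h x)\<^sup>2)" "integrable ?M (\<lambda>x. f x * h x)"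
    unfolding hh fh by (auto intro!: Bochner_Integration.integrable_sum inte intf)
  have "(\<integral>x. (h x)\<^sup>2 \<partial>?M) = (\<Sum>i\<in>I. \<Sum>j\<in>I. c i * c j * (if i = j then s else 0))"
    unfolding hh by (simp add: Bochner_Integration.integral_sum inte ortho)
  also have "\<dots> = s * (\<Sum>i\<in>I. (c i)\<^sup>2)"
    using \<open>finite I\<close> by (simp add: if_distrib sum.delta power2_eq_square sum_distrib_left mult_ac cong: if_cong)
  finally have v1: "(\<integral>x. (h x)\<^sup>2 \<partial>?M) = s * (\<Sum>i\<in>I. (c i)\<^sup>2)" .
  have v2: "(\<integral>x. f x * h x \<partial>?M) = s * (\<Sum>i\<in>I. (c i)\<^sup>2)"
    unfolding fh using \<open>s > 0\<close>
    by (simp add: Bochner_Integration.integral_sum intf c_def sum_distrib_left power2_eq_square)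
  have "0 \<le> (\<integral>x. (f x - h x)\<^sup>2 \<partial>?M)" by simp
  also have "\<dots> = (\<integral>x. (f x)\<^sup>2 - 2 * (f x * h x) + (h x)\<^sup>2 \<partial>?M)"
    by (simp add: power2_diff algebra_simps)
  also have "\<dots> = (\<integral>x. (f x)\<^sup>2 \<partial>?M) - s * (\<Sum>i\<in>I. (c i)\<^sup>2)"
    using i1 L2_square[OF f] by (simp add: v1 v2)
  finally have "s * (\<Sum>i\<in>I. (c i)\<^sup>2) \<le> (\<integral>x. (f x)\<^sup>2 \<partial>?M)" by simp
  then have "s * (s * (\<Sum>i\<in>I. (c i)\<^sup>2)) \<le> s * (\<integral>x. (f x)\<^sup>2 \<partial>?M)"
    using \<open>s > 0\<close> by simp
  moreover have "s * (s * (\<Sum>i\<in>I. (c i)\<^sup>2)) = (\<Sum>i\<in>I. (\<integral>x. f x * e i x \<partial>?M)\<^sup>2)"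
    using \<open>s > 0\<close> by (simp add: c_def sum_distrib_left power2_eq_square)
  ultimately show ?thesis by simp
qed

lemma integral_FTC:
  assumes "L > 0" "\<And>x. (F has_real_derivative f x) (at x)" "continuous_on UNIV f"
  shows "(\<integral>x. f x \<partial>interval_measure L) = F L - F 0"
proof -
  have "(f has_integral (F L - F 0)) {0..L}"
    using assms by (intro fundamental_theorem_of_calculus)
      (auto simp: has_real_derivative_iff_has_vector_derivative[symmetric] intro: has_field_derivative_at_within)
  then have "(f has_integral (F L - F 0)) {0<..<L}"
    by (simp add: has_integral_Icc_iff_Ioo)
  moreover have "(f has_integral (\<integral>x. f x \<partial>interval_measure L)) {0<..<L}"
    by (intro has_integral_integral_lebesgue_on L2_integrable L2_cont assms) auto
  ultimately show ?thesis using has_integral_unique by blast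
qed

section \<open>Weak derivatives\<close>

lemma test_function_deriv:
  assumes "\<eta> \<in> test_functions L"
  shows "\<And>x. (\<eta> has_real_derivative deriv \<eta> x) (at x)" "continuous_on UNIV (deriv \<eta>)"
    "continuous_on UNIV \<eta>" "\<And>x. x \<notin> {0<..<L} \<Longrightarrow> \<eta> x = 0"
    "\<eta> \<in> L2 L" "deriv \<eta> \<in> L2 L"
proof -
  obtain D where D: "\<And>x. (\<eta> has_real_derivative D x) (at x)" "continuous_on UNIV D"
    using assms by (auto simp: test_functions_def C1_differentiable_on_def has_real_derivative_iff_has_vector_derivative)
  have [simp]: "deriv \<eta> = D" using D DERIV_imp_deriv by blast
  show 1: "\<And>x. (\<eta> has_real_derivative deriv \<eta> x) (at x)" and 2: "continuous_on UNIV (deriv \<eta>)"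
    using D by auto
  show 3: "continuous_on UNIV \<eta>" using D DERIV_continuous_on[of UNIV \<eta> D] by auto
  show "\<And>x. x \<notin> {0<..<L} \<Longrightarrow> \<eta> x = 0" using assms by (auto simp: test_functions_def)
  show "\<eta> \<in> L2 L" "deriv \<eta> \<in> L2 L" using 2 3 by (auto intro: L2_cont)
qed

text \<open>Integration by parts; test functions vanish at both ends of the interval.\<close>

lemma weak_deriv_C1:
  assumes "L > 0" "\<And>x. (f has_real_derivative f' x) (at x)" "continuous_on UNIV f'"
  shows "has_weak_deriv L f f'"
  unfolding has_weak_deriv_def
proof
  fix \<eta> assume \<eta>: "\<eta> \<in> test_functions L"
  note t = test_function_deriv[OF \<eta>]
  have cf: "continuous_on UNIV f" using assms(2) DERIV_continuous_on[of UNIV f f'] by auto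
  have "(\<integral>x. f x * deriv \<eta> x + f' x * \<eta> x \<partial>interval_measure L) = f L * \<eta> L - f 0 * \<eta> 0"
    using assms(1,2) t(1)
    by (intro integral_FTC[where F="\<lambda>x. f x * \<eta> x"])
       (auto intro!: derivative_eq_intros continuous_intros cf assms t)
  also have "\<dots> = 0" using t(4) by simp
  finally have "(\<integral>x. f x * deriv \<eta> x \<partial>interval_measure L) + (\<integral>x. f' x * \<eta> x \<partial>interval_measure L) = 0"
    using L2_mult_integrable L2_cont[OF cf] L2_cont[OF assms(3)] t(5,6)
    by (subst (asm) Bochner_Integration.integral_add) auto
  then show "(\<integral>x. f x * deriv \<eta> x \<partial>interval_measure L) = - (\<integral>x. f' x * \<eta> x \<partial>interval_measure L)"
    by simp
qed

lemma weak_deriv_lincomb: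
  assumes "f \<in> L2 L" "f' \<in> L2 L" "g \<in> L2 L" "g' \<in> L2 L" "has_weak_deriv L f f'" "has_weak_deriv L g g'"
  shows "has_weak_deriv L (\<lambda>x. c * f x + d * g x) (\<lambda>x. c * f' x + d * g' x)"
  unfolding has_weak_deriv_def
proof
  fix \<eta> assume \<eta>: "\<eta> \<in> test_functions L"
  note t = test_function_deriv(5,6)[OF \<eta>]
  have e: "(\<integral>x. (c * u x + d * v x) * w x \<partial>interval_measure L)
     = c * (\<integral>x. u x * w x \<partial>interval_measure L) + d * (\<integral>x. v x * w x \<partial>interval_measure L)"
    if "u \<in> L2 L" "v \<in> L2 L" "w \<in> L2 L" for u v w
  proof -
    have "(\<integral>x. (c * u x + d * v x) * w x \<partial>interval_measure L)
        = (\<integral>x. c * (u x * w x) + d * (v x * w x) \<partial>interval_measure L)"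
      by (simp add: algebra_simps)
    then show ?thesis using that L2_mult_integrable by simp
  qed
  show "(\<integral>x. (c * f x + d * g x) * deriv \<eta> x \<partial>interval_measure L)
      = - (\<integral>x. (c * f' x + d * g' x) * \<eta> x \<partial>interval_measure L)"
    using assms \<eta> by (simp add: e t has_weak_deriv_def)
qed

section \<open>Uniqueness of weak derivatives\<close>

lemma DERIV_max_0_square: "((\<lambda>y. (max 0 y)\<^sup>2) has_real_derivative 2 * max 0 y) (at y)" for y :: real
proof (cases "y = 0")
  case False
  then consider "y > 0" | "y < 0" by linarith
  then show ?thesis
  proof cases
    case 1
    have "((\<lambda>y. y\<^sup>2) has_real_derivative 2 * max 0 y) (at y)"
      using 1 by (auto intro!: derivative_eq_intros)
    moreover have "\<forall>\<^sub>F z in nhds y. z\<^sup>2 = (max 0 z)\<^sup>2"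
      by (rule eventually_mono[OF eventually_nhds_in_open[of "{0<..}" y]]) (use 1 in auto)
    ultimately show ?thesis by (rule DERIV_cong_ev[OF refl _ refl, THEN iffD1, rotated])
  next
    case 2
    have "((\<lambda>y. 0) has_real_derivative 2 * max 0 y) (at y)"
      using 2 by (auto intro!: derivative_eq_intros)
    moreover have "\<forall>\<^sub>F z in nhds y. 0 = (max 0 z)\<^sup>2"
      by (rule eventually_mono[OF eventually_nhds_in_open[of "{..<0}" y]]) (use 2 in auto)
    ultimately show ?thesis by (rule DERIV_cong_ev[OF refl _ refl, THEN iffD1, rotated])
  qed
next
  case True
  have "((\<lambda>h. ((max 0 (0 + h))\<^sup>2 - (max 0 0)\<^sup>2) / h) \<longlongrightarrow> 0) (at (0::real))"
  proof (rule Lim_null_comparison)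
    show "\<forall>\<^sub>F h in at (0::real). norm (((max 0 (0 + h))\<^sup>2 - (max 0 0)\<^sup>2) / h) \<le> \<bar>h\<bar>"
      by (intro always_eventually) (auto simp: max_def power2_eq_square)
    show "((\<lambda>h. \<bar>h\<bar>) \<longlongrightarrow> 0) (at (0::real))"
      by (auto intro!: tendsto_eq_intros)
  qed
  then show ?thesis using True by (simp add: DERIV_def)
qed

text \<open>For \<open>n \<rightarrow> \<infinity>\<close> these functions stay between \<open>0\<close> and \<open>1\<close> and converge pointwise to the indicator of
  \<open>]c,d[\<close>, so they detect the integrals over intervals of a function by its pairing with test functions.\<close>

lemma bump_test_function:
  assumes "0 < c" "c \<le> d" "d < L"
  shows "(\<lambda>x. 1 - exp (- real n * (max 0 ((x - c) * (d - x)))\<^sup>2)) \<in> test_functions L"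
proof -
  define p where "p x = (x - c) * (d - x)" for x
  have dp: "(p has_real_derivative (d - x) - (x - c)) (at x)" for x
    unfolding p_def[abs_def] by (auto intro!: derivative_eq_intros)
  have d: "((\<lambda>x. 1 - exp (- real n * (max 0 (p x))\<^sup>2)) has_real_derivative
      real n * (2 * max 0 (p x) * ((d - x) - (x - c))) * exp (- real n * (max 0 (p x))\<^sup>2)) (at x)" for x
    by (rule derivative_eq_intros DERIV_chain2[OF DERIV_max_0_square dp] refl | simp)+
  have cont: "continuous_on UNIV (\<lambda>x. real n * (2 * max 0 (p x) * ((d - x) - (x - c))) * exp (- real n * (max 0 (p x))\<^sup>2))"
    unfolding p_def[abs_def] by (intro continuous_intros)
  have "compact {c..d} \<and> {c..d} \<subseteq> {0<..<L} \<and> (\<forall>x. x \<notin> {c..d} \<longrightarrow> 1 - exp (- real n * (max 0 (p x))\<^sup>2) = 0)"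
  proof (intro conjI allI impI)
    fix x assume "x \<notin> {c..d}"
    then have "p x \<le> 0" unfolding p_def using \<open>c \<le> d\<close>
      by (auto simp: mult_le_0_iff)
    then show "1 - exp (- real n * (max 0 (p x))\<^sup>2) = 0" by simp
  qed (use assms in auto)
  moreover have "(\<lambda>x. 1 - exp (- real n * (max 0 (p x))\<^sup>2)) C1_differentiable_on UNIV"
    unfolding C1_differentiable_on_def has_real_derivative_iff_has_vector_derivative[symmetric]
    using d cont by (intro exI conjI ballI)
  ultimately show ?thesis
    unfolding test_functions_def p_def by (intro CollectI conjI exI[of _ "{c..d}"]) auto
qed

lemma weak_null_interval:
  assumes g: "g \<in> L2 L" and null: "has_weak_deriv L (\<lambda>x. 0) g" and cd: "0 < c" "d < L"
  shows "(\<integral>x. indicator {c<..<d} x * g x \<partial>interval_measure L) = 0"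
proof (cases "c \<le> d")
  case False
  then have "{c<..<d} = {}" by simp
  then show ?thesis by simp
next
  case True
  note cd = \<open>0 < c\<close> True \<open>d < L\<close>
  let ?\<eta> = "\<lambda>n x. 1 - exp (- real n * (max 0 ((x - c) * (d - x)))\<^sup>2)"
  have "(\<lambda>n. \<integral>x. g x * ?\<eta> n x \<partial>interval_measure L) \<longlonglongrightarrow> (\<integral>x. indicator {c<..<d} x * g x \<partial>interval_measure L)"
  proof (rule integral_dominated_convergence)
    show "integrable (interval_measure L) (\<lambda>x. \<bar>g x\<bar>)" using L2_integrable[OF g] by simp
    show "(\<lambda>x. g x * ?\<eta> n x) \<in> borel_measurable (interval_measure L)" for n
      using test_function_deriv(5)[OF bump_test_function[OF cd]] g L2_measurable by auto
    show "(\<lambda>x. indicator {c<..<d} x * g x) \<in> borel_measurable (interval_measure L)"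
      using L2_measurable[OF g] by (intro borel_measurable_times measurable_indicator) auto
    show "AE x in interval_measure L. norm (g x * ?\<eta> n x) \<le> \<bar>g x\<bar>" for n
    proof (rule AE_I2)
      fix x
      have "0 \<le> ?\<eta> n x" "?\<eta> n x \<le> 1" by auto
      then have "\<bar>?\<eta> n x\<bar> \<le> 1" by linarith
      then show "norm (g x * ?\<eta> n x) \<le> \<bar>g x\<bar>"
        unfolding real_norm_def abs_mult by (intro mult_left_le) auto
    qed
    show "AE x in interval_measure L. (\<lambda>n. g x * ?\<eta> n x) \<longlonglongrightarrow> indicator {c<..<d} x * g x"
    proof (rule AE_I2)
      fix x
      have "(\<lambda>n. ?\<eta> n x) \<longlonglongrightarrow> indicator {c<..<d} x"
      proof (cases "x \<in> {c<..<d}")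
        case True
        define r where "r = (max 0 ((x - c) * (d - x)))\<^sup>2"
        have "(x - c) * (d - x) > 0" using True by simp
        then have r: "r > 0" using True by (simp add: r_def max_def)
        have "(\<lambda>n. exp (- r) ^ n) \<longlonglongrightarrow> 0" using r by (intro LIMSEQ_realpow_zero) auto
        then have "(\<lambda>n. exp (- real n * r)) \<longlonglongrightarrow> 0" by (simp add: exp_of_nat_mult[symmetric])
        then have "(\<lambda>n. 1 - exp (- real n * r)) \<longlonglongrightarrow> 1 - 0" by (intro tendsto_intros)
        then show ?thesis using True by (simp add: r_def)
      next
        case False
        then have "(x - c) * (d - x) \<le> 0"
          using \<open>c \<le> d\<close> by (auto simp: mult_le_0_iff not_less)
        then show ?thesis using False by simp
      qed
      then show "(\<lambda>n. g x * ?\<eta> n x) \<longlonglongrightarrow> indicator {c<..<d} x * g x"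
        unfolding mult.commute[of _ "g x"] by (intro tendsto_mult tendsto_const)
    qed
  qed
  moreover have "(\<integral>x. g x * ?\<eta> n x \<partial>interval_measure L) = 0" for n
    using null bump_test_function[OF cd, of n] unfolding has_weak_deriv_def by simp
  ultimately have "(\<lambda>n::nat. 0) \<longlonglongrightarrow> (\<integral>x. indicator {c<..<d} x * g x \<partial>interval_measure L)"
    by (simp only:)
  then show ?thesis using LIMSEQ_unique tendsto_const by blast
qed

text \<open>On \<open>]0,L[\<close> the ray \<open>]c,\<infinity>[\<close> is an increasing limit of intervals with closure inside \<open>]0,L[\<close>.\<close>

lemma weak_null_ray:
  assumes g: "g \<in> L2 L" and null: "has_weak_deriv L (\<lambda>x. 0) g"
  shows "(\<integral>x. indicator {c<..} x * g x \<partial>interval_measure L) = 0"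
proof -
  define c' where "c' = max 0 c"
  let ?I = "\<lambda>n x. indicator {c' + 1 / real (Suc n)<..<L - 1 / real (Suc n)} x :: real"
  have "(\<lambda>n. \<integral>x. ?I n x * g x \<partial>interval_measure L) \<longlonglongrightarrow> (\<integral>x. indicator {c<..} x * g x \<partial>interval_measure L)"
  proof (rule integral_dominated_convergence)
    show "integrable (interval_measure L) (\<lambda>x. \<bar>g x\<bar>)" using L2_integrable[OF g] by simp
    show "(\<lambda>x. ?I n x * g x) \<in> borel_measurable (interval_measure L)" for n
      using L2_measurable[OF g] by (intro borel_measurable_times measurable_indicator) auto
    show "(\<lambda>x. indicator {c<..} x * g x) \<in> borel_measurable (interval_measure L)"
      using L2_measurable[OF g] by (intro borel_measurable_times measurable_indicator) auto
    show "AE x in interval_measure L. norm (?I n x * g x) \<le> \<bar>g x\<bar>" for n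
      by (intro AE_I2) (simp add: abs_mult mult_left_le_one_le)
    show "AE x in interval_measure L. (\<lambda>n. ?I n x * g x) \<longlonglongrightarrow> indicator {c<..} x * g x"
    proof (rule AE_I2)
      fix x assume "x \<in> space (interval_measure L)"
      then have x: "0 < x" "x < L" by auto
      have "(\<lambda>n. ?I n x) \<longlonglongrightarrow> indicator {c<..} x"
      proof (cases "c < x")
        case True
        have "(\<lambda>n. 1 / real (Suc n)) \<longlonglongrightarrow> 0" by (rule LIMSEQ_Suc[OF lim_1_over_n])
        moreover have "0 < min (x - c') (L - x)" using x True by (auto simp: c'_def)
        ultimately have "\<forall>\<^sub>F n in sequentially. 1 / real (Suc n) < min (x - c') (L - x)"
          by (rule order_tendstoD)
        then have "\<forall>\<^sub>F n in sequentially. ?I n x = 1" by eventually_elim (auto simp: indicator_def)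
        then show ?thesis using True by (simp add: tendsto_eventually)
      next
        case False
        have "?I n x = 0" for n
        proof -
          have "0 < 1 / real (Suc n)" by simp
          moreover have "x \<le> c'" using False by (simp add: c'_def)
          ultimately have "\<not> c' + 1 / real (Suc n) < x" by linarith
          then show ?thesis by simp
        qed
        then show ?thesis using False by simp
      qed
      then show "(\<lambda>n. ?I n x * g x) \<longlonglongrightarrow> indicator {c<..} x * g x" by (intro tendsto_intros)
    qed
  qed
  moreover have "(\<integral>x. ?I n x * g x \<partial>interval_measure L) = 0" for n
    by (intro weak_null_interval[OF g null]) (auto simp: c'_def add_nonneg_pos)
  ultimately have "(\<lambda>n::nat. 0) \<longlonglongrightarrow> (\<integral>x. indicator {c<..} x * g x \<partial>interval_measure L)"
    by (simp only:)
  then show ?thesis using LIMSEQ_unique tendsto_const by blast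
qed

text \<open>The fundamental lemma of the calculus of variations. The rays form an intersection-stable generator of
  the Borel sets, so the integral of \<open>g\<close> vanishes over every Borel set, and hence over every Lebesgue
  set, which differs from a Borel set by a null set.\<close>

lemma weak_null_AE:
  assumes g: "g \<in> L2 L" and null: "has_weak_deriv L (\<lambda>x. 0) g"
  shows "AE x in interval_measure L. g x = 0"
proof (rule sigma_finite_measure.density_zero[OF finite_measure.axioms(1)[OF finite_interval_measure] L2_integrable[OF g]])
  let ?M = "interval_measure L"
  note int = L2_integrable[OF g]
  have sets_M: "A \<inter> {0<..<L} \<in> sets ?M" if "A \<in> sets borel" for A
    using that by (auto simp: sets_restrict_space_iff)
  define J where "J A = (\<integral>x. indicator (A \<inter> {0<..<L}) x *\<^sub>R g x \<partial>?M)" for A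
  have J_eq: "J A = (\<integral>x. indicator A x * g x \<partial>?M)" for A
    unfolding J_def by (intro Bochner_Integration.integral_cong) (auto simp: indicator_def)
  have tot: "(\<integral>x. g x \<partial>?M) = 0"
  proof -
    have "(\<integral>x. g x \<partial>?M) = (\<integral>x. indicator {-1<..} x * g x \<partial>?M)"
      by (intro Bochner_Integration.integral_cong) (auto simp: indicator_def)
    then show ?thesis using weak_null_ray[OF g null] by simp
  qed
  have borel: "J A = 0" if "A \<in> sets borel" for A
  proof -
    have "Int_stable (range (\<lambda>a::real. {a<..}))"
      by (auto simp: Int_stable_def lessThan_Int_lessThan)
    moreover have "range (\<lambda>a::real. {a<..}) \<subseteq> Pow UNIV" by simp
    moreover have "A \<in> sigma_sets UNIV (range (\<lambda>a::real. {a<..}))"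
      using that unfolding borel_Ioi by simp
    ultimately show ?thesis
    proof (induction rule: sigma_sets_induct_disjoint)
      case (basic A)
      then show ?case using weak_null_ray[OF g null] J_eq by auto
    next
      case empty
      then show ?case by (simp add: J_def)
    next
      case (compl A)
      have A: "A \<in> sets borel"
        using compl(1) unfolding borel_Ioi by simp
      have "J (UNIV - A) = (\<integral>x. g x - indicator (A \<inter> {0<..<L}) x *\<^sub>R g x \<partial>?M)"
        unfolding J_def by (intro Bochner_Integration.integral_cong) (auto simp: indicator_def)
      also have "\<dots> = (\<integral>x. g x \<partial>?M) - J A"
        unfolding J_def by (intro Bochner_Integration.integral_diff int integrable_mult_indicator sets_M A)
      finally show ?case using compl tot by simp
    next
      case (union A)
      have A: "A i \<in> sets borel" for i
        using union(2) unfolding borel_Ioi by auto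
      have "J (\<Union>i. A i) = set_lebesgue_integral ?M (\<Union>i. A i \<inter> {0<..<L}) g"
        unfolding J_def set_lebesgue_integral_def by (simp add: Int_UN_distrib2 flip: UN_simps)
      also have "\<dots> = (\<Sum>i. set_lebesgue_integral ?M (A i \<inter> {0<..<L}) g)"
      proof (rule lebesgue_integral_countable_add)
        show "set_integrable ?M (\<Union>i. A i \<inter> {0<..<L}) g"
          unfolding set_integrable_def using A by (intro integrable_mult_indicator int sets.countable_UN) (auto intro: sets_M)
      qed (use union A sets_M in \<open>auto simp: disjoint_family_on_def\<close>)
      also have "\<dots> = 0" using union by (simp add: J_def set_lebesgue_integral_def)
      finally show ?case .
    qed
  qed
  fix A assume "A \<in> sets ?M"
  then have "A \<in> sets lebesgue" and A: "A \<in> sets ?M" by (auto simp: sets_restrict_space_iff)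
  then obtain S N N' where SN: "A = S \<union> N" "N \<subseteq> N'" "N' \<in> null_sets lborel" "S \<in> sets lborel"
    by (auto elim: sets_completionE)
  have "AE x in lebesgue. x \<notin> N'"
    by (intro AE_completion AE_not_in SN(3))
  then have "AE x in lebesgue. x \<in> {0<..<L} \<longrightarrow> x \<notin> N'" by eventually_elim auto
  then have ae: "AE x in ?M. x \<notin> N'"
    by (subst AE_restrict_space_iff) auto
  have "set_lebesgue_integral ?M A g = J S"
    unfolding J_def set_lebesgue_integral_def
  proof (rule integral_cong_AE)
    show "AE x in ?M. indicat_real A x *\<^sub>R g x = indicat_real (S \<inter> {0<..<L}) x *\<^sub>R g x"
      using ae AE_space by eventually_elim (use SN in \<open>auto simp: indicator_def\<close>)
  qed (use A L2_measurable[OF g] sets_M[of S] SN in \<open>auto intro!: borel_measurable_times borel_measurable_indicator\<close>)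
  also have "\<dots> = 0" using borel SN by simp
  finally show "set_lebesgue_integral ?M A g = 0" .
qed

section \<open>The spaces \<open>H\<^sup>1\<close> and \<open>H\<^sup>1\<^sub>0\<close>\<close>

lemma H1I: "f \<in> L2 L \<Longrightarrow> g \<in> L2 L \<Longrightarrow> has_weak_deriv L f g \<Longrightarrow> f \<in> H1 L"
  by (auto simp: H1_def)

lemma wderiv_spec:
  assumes "f \<in> H1 L"
  shows "wderiv L f \<in> L2 L" "has_weak_deriv L f (wderiv L f)"
proof -
  have "\<exists>g. g \<in> L2 L \<and> has_weak_deriv L f g" using assms by (auto simp: H1_def)
  from someI_ex[OF this] show "wderiv L f \<in> L2 L" "has_weak_deriv L f (wderiv L f)"
    by (auto simp: wderiv_def)
qed

lemma H1_L2: "f \<in> H1 L \<Longrightarrow> f \<in> L2 L"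
  by (simp add: H1_def)

lemma weak_deriv_unique:
  assumes "f \<in> L2 L" "g \<in> L2 L" "h \<in> L2 L" "has_weak_deriv L f g" "has_weak_deriv L f h"
  shows "AE x in interval_measure L. g x = h x"
proof -
  have "has_weak_deriv L (\<lambda>x. 0) (\<lambda>x. g x - h x)"
    using weak_deriv_lincomb[OF assms(1,2,1,3,4,5), of 1 "-1"] by simp
  then have "AE x in interval_measure L. g x - h x = 0"
    by (intro weak_null_AE L2_diff assms)
  then show ?thesis by eventually_elim simp
qed

lemma wderiv_AE:
  assumes "f \<in> L2 L" "g \<in> L2 L" "has_weak_deriv L f g"
  shows "AE x in interval_measure L. wderiv L f x = g x"
proof -
  have "f \<in> H1 L" using assms by (rule H1I)
  then show ?thesis using assms wderiv_spec by (intro weak_deriv_unique[of f]) auto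
qed

lemma H1_lincomb:
  assumes "f \<in> H1 L" "g \<in> H1 L"
  shows "(\<lambda>x. c * f x + d * g x) \<in> H1 L"
    and "AE x in interval_measure L. wderiv L (\<lambda>x. c * f x + d * g x) x = c * wderiv L f x + d * wderiv L g x"
proof -
  have w: "has_weak_deriv L (\<lambda>x. c * f x + d * g x) (\<lambda>x. c * wderiv L f x + d * wderiv L g x)"
    using assms wderiv_spec H1_L2 by (intro weak_deriv_lincomb) auto
  have m: "(\<lambda>x. c * f x + d * g x) \<in> L2 L" "(\<lambda>x. c * wderiv L f x + d * wderiv L g x) \<in> L2 L"
    using assms wderiv_spec H1_L2 by (auto intro!: L2_lincomb)
  show "(\<lambda>x. c * f x + d * g x) \<in> H1 L" by (rule H1I[OF m w])
  show "AE x in interval_measure L. wderiv L (\<lambda>x. c * f x + d * g x) x = c * wderiv L f x + d * wderiv L g x"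
    by (rule wderiv_AE[OF m w])
qed

lemma L2_cong_AE:
  assumes "f \<in> L2 L" "h \<in> borel_measurable (interval_measure L)" "AE x in interval_measure L. f x = h x"
  shows "h \<in> L2 L"
proof -
  have "integrable (interval_measure L) (\<lambda>x. (h x)\<^sup>2)"
  proof (rule integrable_cong_AE_imp[OF L2_square[OF assms(1)]])
    show "(\<lambda>x. (h x)\<^sup>2) \<in> borel_measurable (interval_measure L)" using assms(2) by measurable
    show "AE x in interval_measure L. (f x)\<^sup>2 = (h x)\<^sup>2" using assms(3) by eventually_elim simp
  qed
  then show ?thesis using assms(2) by (simp add: L2_def)
qed

lemma weak_deriv_cong_AE:
  assumes "f \<in> borel_measurable (interval_measure L)" "h \<in> borel_measurable (interval_measure L)"
    "AE x in interval_measure L. f x = h x"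
  shows "has_weak_deriv L f = has_weak_deriv L h"
proof -
  have "(\<integral>x. f x * deriv \<eta> x \<partial>interval_measure L) = (\<integral>x. h x * deriv \<eta> x \<partial>interval_measure L)"
    if "\<eta> \<in> test_functions L" for \<eta>
  proof (rule integral_cong_AE)
    have "deriv \<eta> \<in> borel_measurable (interval_measure L)"
      using test_function_deriv(6)[OF that] by (rule L2_measurable)
    then show "(\<lambda>x. f x * deriv \<eta> x) \<in> borel_measurable (interval_measure L)"
      "(\<lambda>x. h x * deriv \<eta> x) \<in> borel_measurable (interval_measure L)"
      using assms by (auto intro: borel_measurable_times)
    show "AE x in interval_measure L. f x * deriv \<eta> x = h x * deriv \<eta> x"
      using assms(3) by eventually_elim simp
  qed
  then show ?thesis by (intro ext) (simp add: has_weak_deriv_def)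
qed

text \<open>Weak derivatives depend on the class of a function only; as \<open>wderiv\<close> picks a representative
  by the same predicate for both functions, the two choices are even equal.\<close>

lemma H1_cong_AE:
  assumes "f \<in> H1 L" "h \<in> borel_measurable (interval_measure L)" "AE x in interval_measure L. f x = h x"
  shows "h \<in> H1 L" "wderiv L h = wderiv L f"
proof -
  have w: "has_weak_deriv L f = has_weak_deriv L h"
    by (rule weak_deriv_cong_AE[OF L2_measurable[OF H1_L2[OF assms(1)]] assms(2,3)])
  show "wderiv L h = wderiv L f" by (simp add: wderiv_def w)
  show "h \<in> H1 L"
    using assms L2_cong_AE[OF H1_L2[OF assms(1)] assms(2,3)] by (auto simp: H1_def w)
qed

lemma H1_C1:
  assumes "L > 0" "\<And>x. (f has_real_derivative f' x) (at x)" "continuous_on UNIV f'"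
  shows "f \<in> H1 L" "AE x in interval_measure L. wderiv L f x = f' x"
proof -
  have f: "f \<in> L2 L" using assms(2) DERIV_continuous_on[of UNIV f f'] by (auto intro: L2_cont)
  have f': "f' \<in> L2 L" by (rule L2_cont[OF assms(3)])
  note w = weak_deriv_C1[OF assms]
  show "f \<in> H1 L" by (rule H1I[OF f f' w])
  show "AE x in interval_measure L. wderiv L f x = f' x" by (rule wderiv_AE[OF f f' w])
qed

lemma test_functions_H1: "L > 0 \<Longrightarrow> \<eta> \<in> test_functions L \<Longrightarrow> \<eta> \<in> H1 L"
  by (rule H1_C1(1)[OF _ test_function_deriv(1,2)])

lemma test_functions_lincomb:
  assumes "\<eta> \<in> test_functions L" "\<theta> \<in> test_functions L"
  shows "(\<lambda>x. c * \<eta> x + d * \<theta> x) \<in> test_functions L"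
proof -
  obtain K J where K: "compact K" "K \<subseteq> {0<..<L}" "\<And>x. x \<notin> K \<Longrightarrow> \<eta> x = 0"
    and J: "compact J" "J \<subseteq> {0<..<L}" "\<And>x. x \<notin> J \<Longrightarrow> \<theta> x = 0"
    using assms by (auto simp: test_functions_def)
  have "(\<lambda>x. c * \<eta> x + d * \<theta> x) C1_differentiable_on UNIV"
    using assms by (intro C1_differentiable_on_add C1_differentiable_on_mult C1_differentiable_on_const)
      (auto simp: test_functions_def)
  moreover have "compact (K \<union> J)" "K \<union> J \<subseteq> {0<..<L}" using K J by auto
  moreover have "\<forall>x. x \<notin> K \<union> J \<longrightarrow> c * \<eta> x + d * \<theta> x = 0" using K J by auto
  ultimately show ?thesis
    unfolding test_functions_def by (intro CollectI conjI exI[of _ "K \<union> J"])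
qed

lemma H1_norm_power2: "(H1_norm_on L f)\<^sup>2 = (L2_norm_on L f)\<^sup>2 + (L2_norm_on L (wderiv L f))\<^sup>2"
  by (simp add: H1_norm_on_def)

lemma H1_norm_nonneg [simp]: "0 \<le> H1_norm_on L f"
  by (simp add: H1_norm_on_def)

lemma H1_norm_lincomb:
  assumes "f \<in> H1 L" "g \<in> H1 L"
  shows "(H1_norm_on L (\<lambda>x. c * f x + d * g x))\<^sup>2 \<le> 2 * c\<^sup>2 * (H1_norm_on L f)\<^sup>2 + 2 * d\<^sup>2 * (H1_norm_on L g)\<^sup>2"
proof -
  have "L2_norm_on L (wderiv L (\<lambda>x. c * f x + d * g x)) = L2_norm_on L (\<lambda>x. c * wderiv L f x + d * wderiv L g x)"
    using assms by (intro L2_norm_cong_AE H1_lincomb wderiv_spec L2_lincomb)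
  moreover have "(L2_norm_on L (\<lambda>x. c * wderiv L f x + d * wderiv L g x))\<^sup>2
      \<le> 2 * c\<^sup>2 * (L2_norm_on L (wderiv L f))\<^sup>2 + 2 * d\<^sup>2 * (L2_norm_on L (wderiv L g))\<^sup>2"
    using assms by (intro L2_norm_lincomb wderiv_spec)
  moreover have "(L2_norm_on L (\<lambda>x. c * f x + d * g x))\<^sup>2 \<le> 2 * c\<^sup>2 * (L2_norm_on L f)\<^sup>2 + 2 * d\<^sup>2 * (L2_norm_on L g)\<^sup>2"
    using assms by (intro L2_norm_lincomb H1_L2)
  ultimately show ?thesis unfolding H1_norm_power2 by (simp add: algebra_simps)
qed

lemma H1_0_iff_sequence:
  "f \<in> H1_0 L \<longleftrightarrow> f \<in> H1 L \<and>
     (\<exists>\<eta>. (\<forall>n::nat. \<eta> n \<in> test_functions L) \<and> (\<lambda>n. (H1_norm_on L (f - \<eta> n))\<^sup>2) \<longlonglongrightarrow> 0)"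
  (is "_ \<longleftrightarrow> _ \<and> ?R")
proof (intro iffI conjI)
  assume f: "f \<in> H1_0 L"
  then show "f \<in> H1 L" by (simp add: H1_0_def)
  have "\<forall>n::nat. \<exists>\<eta>. \<eta> \<in> test_functions L \<and> H1_norm_on L (f - \<eta>) < 1 / real (Suc n)"
  proof
    fix n :: nat
    have "0 < 1 / real (Suc n)" by simp
    then show "\<exists>\<eta>. \<eta> \<in> test_functions L \<and> H1_norm_on L (f - \<eta>) < 1 / real (Suc n)"
      using f unfolding H1_0_def by fast
  qed
  then obtain \<eta> where \<eta>: "\<And>n. \<eta> n \<in> test_functions L" "\<And>n. H1_norm_on L (f - \<eta> n) < 1 / real (Suc n)"
    by metis
  have "(\<lambda>n. H1_norm_on L (f - \<eta> n)) \<longlonglongrightarrow> 0"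
  proof (rule Lim_null_comparison)
    show "(\<lambda>n. 1 / real (Suc n)) \<longlonglongrightarrow> 0" by (rule LIMSEQ_Suc[OF lim_1_over_n])
    show "\<forall>\<^sub>F n in sequentially. norm (H1_norm_on L (f - \<eta> n)) \<le> 1 / real (Suc n)"
      using \<eta>(2) by (intro always_eventually) (auto intro: less_imp_le)
  qed
  then have "(\<lambda>n. (H1_norm_on L (f - \<eta> n))\<^sup>2) \<longlonglongrightarrow> 0\<^sup>2" by (rule tendsto_power)
  then show ?R using \<eta>(1) by auto
next
  assume "f \<in> H1 L \<and> ?R"
  then obtain \<eta> where \<eta>: "f \<in> H1 L" "\<And>n::nat. \<eta> n \<in> test_functions L"
    and l: "(\<lambda>n. (H1_norm_on L (f - \<eta> n))\<^sup>2) \<longlonglongrightarrow> 0" by auto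
  have "\<exists>\<theta>\<in>test_functions L. H1_norm_on L (f - \<theta>) < \<epsilon>" if "\<epsilon> > 0" for \<epsilon>
  proof -
    have "\<forall>\<^sub>F n in sequentially. (H1_norm_on L (f - \<eta> n))\<^sup>2 < \<epsilon>\<^sup>2"
      using that by (intro order_tendstoD(2)[OF l]) auto
    then obtain n where "(H1_norm_on L (f - \<eta> n))\<^sup>2 < \<epsilon>\<^sup>2"
      using eventually_happens'[OF sequentially_bot] by blast
    then have "H1_norm_on L (f - \<eta> n) < \<epsilon>" using that by (auto intro: power2_less_imp_less)
    then show ?thesis using \<eta>(2)[of n] by (intro bexI[of _ "\<eta> n"])
  qed
  then show "f \<in> H1_0 L" using \<eta>(1) unfolding H1_0_def by simp
qed

lemma H1_0_H1: "f \<in> H1_0 L \<Longrightarrow> f \<in> H1 L"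
  by (simp add: H1_0_def)

lemma H1_0_lincomb:
  assumes "L > 0" "f \<in> H1_0 L" "g \<in> H1_0 L"
  shows "(\<lambda>x. c * f x + d * g x) \<in> H1_0 L"
proof -
  obtain \<eta> \<theta> where \<eta>: "\<And>n::nat. \<eta> n \<in> test_functions L" "(\<lambda>n. (H1_norm_on L (f - \<eta> n))\<^sup>2) \<longlonglongrightarrow> 0"
    and \<theta>: "\<And>n::nat. \<theta> n \<in> test_functions L" "(\<lambda>n. (H1_norm_on L (g - \<theta> n))\<^sup>2) \<longlonglongrightarrow> 0"
    using assms(2,3) unfolding H1_0_iff_sequence by fast
  note f = H1_0_H1[OF assms(2)] and g = H1_0_H1[OF assms(3)]
  define \<xi> where "\<xi> n = (\<lambda>x. c * \<eta> n x + d * \<theta> n x)" for n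
  have d: "u - \<eta>' \<in> H1 L" if "u \<in> H1 L" "\<eta>' \<in> test_functions L" for u \<eta>'
    using H1_lincomb(1)[OF that(1) test_functions_H1[OF assms(1) that(2)], of 1 "-1"]
    by (simp add: fun_diff_def)
  have "(\<lambda>n. (H1_norm_on L ((\<lambda>x. c * f x + d * g x) - \<xi> n))\<^sup>2) \<longlonglongrightarrow> 0"
  proof (rule Lim_null_comparison)
    show "(\<lambda>n. 2 * c\<^sup>2 * (H1_norm_on L (f - \<eta> n))\<^sup>2 + 2 * d\<^sup>2 * (H1_norm_on L (g - \<theta> n))\<^sup>2) \<longlonglongrightarrow> 0"
      using tendsto_add[OF tendsto_mult_left[OF \<eta>(2), of "2 * c\<^sup>2"] tendsto_mult_left[OF \<theta>(2), of "2 * d\<^sup>2"]] by simp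
    have e: "(\<lambda>x. c * f x + d * g x) - \<xi> n = (\<lambda>x. c * (f - \<eta> n) x + d * (g - \<theta> n) x)" for n
      by (simp add: \<xi>_def fun_eq_iff algebra_simps)
    show "\<forall>\<^sub>F n in sequentially. norm ((H1_norm_on L ((\<lambda>x. c * f x + d * g x) - \<xi> n))\<^sup>2)
        \<le> 2 * c\<^sup>2 * (H1_norm_on L (f - \<eta> n))\<^sup>2 + 2 * d\<^sup>2 * (H1_norm_on L (g - \<theta> n))\<^sup>2"
      unfolding e real_norm_def abs_power2
      by (intro always_eventually allI H1_norm_lincomb d f g \<eta> \<theta>)
  qed
  moreover have "\<xi> n \<in> test_functions L" for n
    unfolding \<xi>_def by (intro test_functions_lincomb \<eta> \<theta>)
  ultimately show ?thesis
    unfolding H1_0_iff_sequence by (intro conjI H1_lincomb(1)[OF f g] exI[of _ \<xi>] allI)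
qed

lemma H1_0_cong_AE:
  assumes "f \<in> H1_0 L" "h \<in> borel_measurable (interval_measure L)" "AE x in interval_measure L. f x = h x"
    "L > 0"
  shows "h \<in> H1_0 L"
proof -
  have f: "f \<in> H1 L" by (rule H1_0_H1[OF assms(1)])
  have h: "h \<in> H1 L" by (rule H1_cong_AE(1)[OF f assms(2,3)])
  have "H1_norm_on L (h - \<eta>) = H1_norm_on L (f - \<eta>)" if \<eta>: "\<eta> \<in> test_functions L" for \<eta>
  proof -
    have fe: "f - \<eta> \<in> H1 L" and he: "h - \<eta> \<in> H1 L"
      using H1_lincomb(1)[OF f test_functions_H1[OF \<open>L > 0\<close> \<eta>], of 1 "-1"]
        H1_lincomb(1)[OF h test_functions_H1[OF \<open>L > 0\<close> \<eta>], of 1 "-1"]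
      by (simp_all add: fun_diff_def)
    have ae: "AE x in interval_measure L. (f - \<eta>) x = (h - \<eta>) x"
      using assms(3) by eventually_elim simp
    have "wderiv L (h - \<eta>) = wderiv L (f - \<eta>)"
      by (rule H1_cong_AE(2)[OF fe L2_measurable[OF H1_L2[OF he]] ae])
    moreover have "L2_norm_on L (f - \<eta>) = L2_norm_on L (h - \<eta>)"
      by (rule L2_norm_cong_AE[OF H1_L2[OF fe] H1_L2[OF he] ae])
    ultimately show ?thesis by (simp add: H1_norm_on_def)
  qed
  then show ?thesis using assms(1) h unfolding H1_0_def by auto
qed

text \<open>Setting \<open>p\<close> to zero outside \<open>]0,L[\<close> keeps it \<open>C\<^sup>1\<close>, since \<open>p\<close> vanishes near both ends.\<close>

lemma truncation_test_function:
  assumes "\<And>x. (p has_real_derivative p' x) (at x)" "continuous_on UNIV p'" "r > 0"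
    and z: "\<And>x. \<bar>x\<bar> < r \<or> \<bar>x - L\<bar> < r \<Longrightarrow> p x = 0"
  shows "(\<lambda>x. if x \<in> {0<..<L} then p x else 0) \<in> test_functions L"
    "\<And>x. ((\<lambda>x. if x \<in> {0<..<L} then p x else 0) has_real_derivative (if x \<in> {0<..<L} then p' x else 0)) (at x)"
proof -
  let ?q = "\<lambda>x. if x \<in> {0<..<L} then p x else 0"
  let ?q' = "\<lambda>x. if x \<in> {0<..<L} then p' x else 0"
  define O1 where "O1 = {..<r} \<union> {L - r<..}"
  have op: "open O1" by (simp add: O1_def open_Un)
  have z': "p' x = 0" if "\<bar>x\<bar> < r \<or> \<bar>x - L\<bar> < r" for x
  proof -
    let ?S = "{x. \<bar>x\<bar> < r \<or> \<bar>x - L\<bar> < r}"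
    have "open ?S" by (intro open_Collect_disj open_Collect_less continuous_intros)
    then have "\<forall>\<^sub>F y in nhds x. p y = 0"
      by (rule eventually_mono[OF eventually_nhds_in_open]) (use that z in auto)
    then have "(p has_real_derivative p' x) (at x) \<longleftrightarrow> ((\<lambda>y. 0) has_real_derivative p' x) (at x)"
      by (intro DERIV_cong_ev) auto
    then show ?thesis using assms(1)[of x] DERIV_unique[OF _ DERIV_const] by blast
  qed
  have q0: "?q x = 0" and q0': "?q' x = 0" if "x \<in> O1" for x
    using that z[of x] z'[of x] by (auto simp: O1_def)
  have cover: "x \<in> O1 \<or> x \<in> {0<..<L}" for x
    using \<open>r > 0\<close> by (auto simp: O1_def)
  show der: "(?q has_real_derivative ?q' x) (at x)" for x
  proof (cases "x \<in> O1")
    case True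
    have "\<forall>\<^sub>F y in nhds x. ?q y = 0"
      by (rule eventually_mono[OF eventually_nhds_in_open[OF op True]]) (rule q0)
    then have "(?q has_real_derivative 0) (at x) \<longleftrightarrow> ((\<lambda>y. 0) has_real_derivative 0) (at x)"
      by (intro DERIV_cong_ev) auto
    then show ?thesis using q0'[OF True] by simp
  next
    case False
    then have x: "x \<in> {0<..<L}" using cover by blast
    have "\<forall>\<^sub>F y in nhds x. ?q y = p y"
      by (rule eventually_mono[OF eventually_nhds_in_open[OF open_greaterThanLessThan x]]) auto
    then have "(?q has_real_derivative p' x) (at x) \<longleftrightarrow> (p has_real_derivative p' x) (at x)"
      by (intro DERIV_cong_ev) auto
    then show ?thesis using x assms(1) by simp
  qed
  have cont: "continuous_on UNIV ?q'"
    unfolding continuous_on_eq_continuous_at[OF open_UNIV]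
  proof
    fix x
    show "isCont ?q' x"
    proof (cases "x \<in> O1")
      case True
      have "\<forall>\<^sub>F y in nhds x. ?q' y = 0"
        by (rule eventually_mono[OF eventually_nhds_in_open[OF op True]]) (rule q0')
      then have "isCont ?q' x \<longleftrightarrow> isCont (\<lambda>y. 0::real) x" by (rule isCont_cong)
      then show ?thesis by simp
    next
      case False
      then have x: "x \<in> {0<..<L}" using cover by blast
      have "\<forall>\<^sub>F y in nhds x. ?q' y = p' y"
        by (rule eventually_mono[OF eventually_nhds_in_open[OF open_greaterThanLessThan x]]) auto
      then have "isCont ?q' x \<longleftrightarrow> isCont p' x" by (rule isCont_cong)
      then show ?thesis using assms(2) by (simp add: continuous_on_eq_continuous_at)
    qed
  qed
  have "?q C1_differentiable_on UNIV"
    unfolding C1_differentiable_on_def has_real_derivative_iff_has_vector_derivative[symmetric]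
    using der cont by (intro exI[of _ ?q'] conjI ballI)
  moreover have "\<forall>x. x \<notin> {r..L - r} \<longrightarrow> ?q x = 0"
    using q0 by (auto simp: O1_def not_le)
  ultimately show "?q \<in> test_functions L"
    unfolding test_functions_def using \<open>r > 0\<close>
    by (intro CollectI conjI exI[of _ "{r..L - r}"]) auto
qed

text \<open>A \<open>C\<^sup>1\<close> approximation of the identity that vanishes for \<open>y\<^sup>2 \<le> \<delta>\<close>. Composed with a function that
  vanishes at \<open>0\<close> and \<open>L\<close> it gives compact support. The same \<open>\<delta>\<close> occurs squared in the denominator in
  order that the derivative is bounded uniformly in \<open>\<delta>\<close> and \<open>y\<close>.\<close>

definition soft_cut :: "real \<Rightarrow> real \<Rightarrow> real"
  where "soft_cut \<delta> y = y * (max 0 (y\<^sup>2 - \<delta>))\<^sup>2 / ((max 0 (y\<^sup>2 - \<delta>))\<^sup>2 + \<delta>\<^sup>2)"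

definition soft_cut_deriv :: "real \<Rightarrow> real \<Rightarrow> real"
  where "soft_cut_deriv \<delta> y = (let m = max 0 (y\<^sup>2 - \<delta>) in
     m\<^sup>2 / (m\<^sup>2 + \<delta>\<^sup>2) + 4 * y\<^sup>2 * m * \<delta>\<^sup>2 / (m\<^sup>2 + \<delta>\<^sup>2)\<^sup>2)"

lemma soft_cut_has_deriv:
  assumes "\<delta> > 0"
  shows "(soft_cut \<delta> has_real_derivative soft_cut_deriv \<delta> y) (at y)"
proof -
  let ?m = "\<lambda>y::real. max 0 (y\<^sup>2 - \<delta>)"
  have pos: "(?m y)\<^sup>2 + \<delta>\<^sup>2 \<noteq> 0" for y
    using assms by (smt (verit) zero_less_power2 zero_le_power2)
  have dp: "((\<lambda>y. y\<^sup>2 - \<delta>) has_real_derivative 2 * y) (at y)" for y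
    by (auto intro!: derivative_eq_intros)
  have dw: "((\<lambda>y. (?m y)\<^sup>2) has_real_derivative 2 * ?m y * (2 * y)) (at y)" for y
    by (rule DERIV_chain2[OF DERIV_max_0_square dp])
  have "((\<lambda>y. y * (?m y)\<^sup>2 / ((?m y)\<^sup>2 + \<delta>\<^sup>2)) has_real_derivative
     ((1 * (?m y)\<^sup>2 + 2 * ?m y * (2 * y) * y) * ((?m y)\<^sup>2 + \<delta>\<^sup>2) - y * (?m y)\<^sup>2 * (2 * ?m y * (2 * y) + 0))
       / (((?m y)\<^sup>2 + \<delta>\<^sup>2) * ((?m y)\<^sup>2 + \<delta>\<^sup>2))) (at y)"
    by (intro DERIV_divide DERIV_mult DERIV_ident dw DERIV_add DERIV_const pos)
  moreover have "((1 * (?m y)\<^sup>2 + 2 * ?m y * (2 * y) * y) * ((?m y)\<^sup>2 + \<delta>\<^sup>2) - y * (?m y)\<^sup>2 * (2 * ?m y * (2 * y) + 0))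
       / (((?m y)\<^sup>2 + \<delta>\<^sup>2) * ((?m y)\<^sup>2 + \<delta>\<^sup>2)) = soft_cut_deriv \<delta> y"
  proof -
    define m where "m = ?m y"
    have p: "m\<^sup>2 + \<delta>\<^sup>2 \<noteq> 0" using pos unfolding m_def .
    show ?thesis unfolding soft_cut_deriv_def Let_def m_def[symmetric]
      using p by (simp add: divide_simps) (simp add: power2_eq_square algebra_simps)
  qed
  ultimately show ?thesis unfolding soft_cut_def[abs_def] by simp
qed

lemma continuous_soft_cut_deriv:
  assumes "\<delta> > 0"
  shows "continuous_on UNIV (soft_cut_deriv \<delta>)"
proof -
  have pos: "(max 0 (y\<^sup>2 - \<delta>))\<^sup>2 + \<delta>\<^sup>2 \<noteq> 0" for y
    using assms by (intro less_imp_neq[THEN not_sym] add_nonneg_pos) auto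
  show ?thesis
    unfolding soft_cut_deriv_def[abs_def] Let_def
    by (intro continuous_intros ballI power_not_zero pos)
qed

lemma soft_cut_bound: "\<bar>soft_cut \<delta> y\<bar> \<le> \<bar>y\<bar>"
proof -
  let ?w = "(max 0 (y\<^sup>2 - \<delta>))\<^sup>2"
  have "\<bar>w / (w + d)\<bar> \<le> 1" if "0 \<le> w" "0 \<le> d" for w d :: real
    using that by (simp add: divide_le_eq_1) linarith
  from this[OF zero_le_power2 zero_le_power2] have "\<bar>?w / (?w + \<delta>\<^sup>2)\<bar> \<le> 1" .
  then have "\<bar>y\<bar> * \<bar>?w / (?w + \<delta>\<^sup>2)\<bar> \<le> \<bar>y\<bar>" by (intro mult_left_le) auto
  then show ?thesis unfolding soft_cut_def times_divide_eq_right[symmetric] abs_mult .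
qed

lemma soft_cut_deriv_bound:
  assumes "\<delta> > 0"
  shows "\<bar>soft_cut_deriv \<delta> y\<bar> \<le> 9"
proof -
  define m where "m = max 0 (y\<^sup>2 - \<delta>)"
  define s where "s = m\<^sup>2 + \<delta>\<^sup>2"
  have m: "m \<ge> 0" by (simp add: m_def)
  have s: "s > 0" unfolding s_def using assms by (simp add: add_nonneg_pos)
  have a: "m\<^sup>2 / s \<le> 1" "0 \<le> m\<^sup>2 / s" using s by (auto simp: s_def)
  have "4 * y\<^sup>2 * m * \<delta>\<^sup>2 \<le> 8 * s\<^sup>2"
  proof (cases "m = 0")
    case False
    then have y: "y\<^sup>2 = m + \<delta>" by (auto simp: m_def max_def split: if_splits)
    have "0 \<le> (m - \<delta>)\<^sup>2 + m\<^sup>2 + 3 * \<delta>\<^sup>2" by simp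
    then have "(m + \<delta>) * m \<le> 2 * s"
      by (simp add: s_def power2_eq_square algebra_simps)
    moreover have "\<delta>\<^sup>2 \<le> s" by (simp add: s_def)
    ultimately have "((m + \<delta>) * m) * \<delta>\<^sup>2 \<le> (2 * s) * s"
      using s by (intro mult_mono[of _ "2 * s"]) auto
    then show ?thesis unfolding y by (simp add: power2_eq_square algebra_simps)
  qed simp
  then have b: "4 * y\<^sup>2 * m * \<delta>\<^sup>2 / s\<^sup>2 \<le> 8" using s by (simp add: divide_le_eq)
  have c: "0 \<le> 4 * y\<^sup>2 * m * \<delta>\<^sup>2 / s\<^sup>2" using m by simp
  have "soft_cut_deriv \<delta> y = m\<^sup>2 / s + 4 * y\<^sup>2 * m * \<delta>\<^sup>2 / s\<^sup>2"
    by (simp add: soft_cut_deriv_def Let_def m_def s_def)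
  then show ?thesis using a b c by simp
qed

lemma soft_cut_tendsto:
  assumes "y \<noteq> 0" "\<delta> \<longlonglongrightarrow> 0"
  shows "(\<lambda>n. soft_cut (\<delta> n) y) \<longlonglongrightarrow> y" "(\<lambda>n. soft_cut_deriv (\<delta> n) y) \<longlonglongrightarrow> 1"
proof -
  have m: "(\<lambda>n. max 0 (y\<^sup>2 - \<delta> n)) \<longlonglongrightarrow> y\<^sup>2"
    using tendsto_max[OF tendsto_const tendsto_diff[OF tendsto_const assms(2)], of 0 "y\<^sup>2"] by simp
  have "(\<lambda>n. y * (max 0 (y\<^sup>2 - \<delta> n))\<^sup>2 / ((max 0 (y\<^sup>2 - \<delta> n))\<^sup>2 + (\<delta> n)\<^sup>2)) \<longlonglongrightarrow> y * (y\<^sup>2)\<^sup>2 / ((y\<^sup>2)\<^sup>2 + 0\<^sup>2)"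
    using assms by (intro tendsto_intros m) auto
  then show "(\<lambda>n. soft_cut (\<delta> n) y) \<longlonglongrightarrow> y" using assms by (simp add: soft_cut_def)
  have "(\<lambda>n. (max 0 (y\<^sup>2 - \<delta> n))\<^sup>2 / ((max 0 (y\<^sup>2 - \<delta> n))\<^sup>2 + (\<delta> n)\<^sup>2)
       + 4 * y\<^sup>2 * max 0 (y\<^sup>2 - \<delta> n) * (\<delta> n)\<^sup>2 / ((max 0 (y\<^sup>2 - \<delta> n))\<^sup>2 + (\<delta> n)\<^sup>2)\<^sup>2)
     \<longlonglongrightarrow> (y\<^sup>2)\<^sup>2 / ((y\<^sup>2)\<^sup>2 + 0\<^sup>2) + 4 * y\<^sup>2 * y\<^sup>2 * 0\<^sup>2 / ((y\<^sup>2)\<^sup>2 + 0\<^sup>2)\<^sup>2"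
    using assms by (intro tendsto_intros m) auto
  then show "(\<lambda>n. soft_cut_deriv (\<delta> n) y) \<longlonglongrightarrow> 1" using assms by (simp add: soft_cut_deriv_def Let_def)
qed

lemma L2_norm_dominated:
  assumes "\<And>n. h n \<in> borel_measurable (interval_measure L)"
    and "\<And>x n. x \<in> {0<..<L} \<Longrightarrow> \<bar>h n x\<bar> \<le> C"
    and "AE x in interval_measure L. (\<lambda>n. h n x) \<longlonglongrightarrow> 0"
  shows "(\<lambda>n. (L2_norm_on L (h n))\<^sup>2) \<longlonglongrightarrow> 0"
proof -
  have "(\<lambda>n. \<integral>x. (h n x)\<^sup>2 \<partial>interval_measure L) \<longlonglongrightarrow> (\<integral>x. 0 \<partial>interval_measure L)"
  proof (rule integral_dominated_convergence)
    show "integrable (interval_measure L) (\<lambda>x. C\<^sup>2)" by (rule L2_integrable[OF L2_const])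
    show "(\<lambda>x. (h n x)\<^sup>2) \<in> borel_measurable (interval_measure L)" for n
      using assms(1)[of n] by (rule borel_measurable_power)
    show "AE x in interval_measure L. norm ((h n x)\<^sup>2) \<le> C\<^sup>2" for n
      using assms(2)[of _ n] by (intro AE_I2) (simp add: abs_le_square_iff[symmetric] order.trans[OF _ abs_ge_self])
    show "AE x in interval_measure L. (\<lambda>n. (h n x)\<^sup>2) \<longlonglongrightarrow> 0"
      using assms(3) by eventually_elim (use tendsto_power[of _ 0 sequentially 2] in auto)
  qed auto
  then show ?thesis by (simp add: L2_norm_power2)
qed

text \<open>The functions \<open>soft_cut \<delta> (f x)\<close>, cut off outside \<open>]0,L[\<close>, are test functions, and they converge to
  \<open>f\<close> together with their derivatives, boundedly and at every point where \<open>f x \<noteq> 0\<close>. The zeros of \<open>f\<close> are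
  excluded because there the cut suppresses the derivative.\<close>

lemma H1_0_C1:
  assumes "L > 0" and der: "\<And>x. (f has_real_derivative f' x) (at x)" and cont: "continuous_on UNIV f'"
    and ends: "f 0 = 0" "f L = 0" and nz: "AE x in interval_measure L. f x \<noteq> 0"
  shows "f \<in> H1_0 L"
proof -
  have cf: "continuous_on UNIV f" using der DERIV_continuous_on[of UNIV f f'] by auto
  define \<delta> where "\<delta> n = 1 / real (Suc n)" for n
  have \<delta>: "\<delta> n > 0" for n by (simp add: \<delta>_def)
  have \<delta>0: "\<delta> \<longlonglongrightarrow> 0" unfolding \<delta>_def[abs_def] by (rule LIMSEQ_Suc[OF lim_1_over_n])
  define \<eta> where "\<eta> n = (\<lambda>x. if x \<in> {0<..<L} then soft_cut (\<delta> n) (f x) else 0)" for n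
  define \<eta>' where "\<eta>' n = (\<lambda>x. if x \<in> {0<..<L} then soft_cut_deriv (\<delta> n) (f x) * f' x else 0)" for n
  have test: "\<eta> n \<in> test_functions L" and test': "(\<eta> n has_real_derivative \<eta>' n x) (at x)" for n x
  proof -
    have small: "\<exists>r>0. \<forall>x. \<bar>x - c\<bar> < r \<longrightarrow> (f x)\<^sup>2 < \<delta> n" if "f c = 0" for c
    proof -
      have "isCont (\<lambda>x. (f x)\<^sup>2) c"
        using cf by (auto intro!: continuous_intros simp: continuous_on_eq_continuous_at)
      then have "\<exists>r>0. \<forall>x. \<bar>x - c\<bar> < r \<longrightarrow> \<bar>(f x)\<^sup>2 - (f c)\<^sup>2\<bar> < \<delta> n"
        using \<delta>[of n] unfolding continuous_at_eps_delta dist_real_def by blast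
      then show ?thesis using that by auto
    qed
    obtain r1 where r1: "r1 > 0" "\<And>x. \<bar>x - 0\<bar> < r1 \<Longrightarrow> (f x)\<^sup>2 < \<delta> n" using small[OF ends(1)] by auto
    obtain r2 where r2: "r2 > 0" "\<And>x. \<bar>x - L\<bar> < r2 \<Longrightarrow> (f x)\<^sup>2 < \<delta> n" using small[OF ends(2)] by auto
    have zero: "soft_cut (\<delta> n) (f x) = 0" if "\<bar>x\<bar> < min r1 r2 \<or> \<bar>x - L\<bar> < min r1 r2" for x
    proof -
      have "(f x)\<^sup>2 < \<delta> n" using that r1(2)[of x] r2(2)[of x] by auto
      then show ?thesis by (simp add: soft_cut_def)
    qed
    have d: "((\<lambda>x. soft_cut (\<delta> n) (f x)) has_real_derivative soft_cut_deriv (\<delta> n) (f x) * f' x) (at x)" for x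
      by (rule DERIV_chain2[OF soft_cut_has_deriv[OF \<delta>] der])
    have c: "continuous_on UNIV (\<lambda>x. soft_cut_deriv (\<delta> n) (f x) * f' x)"
      by (intro continuous_intros cont continuous_on_compose2[OF continuous_soft_cut_deriv[OF \<delta>] cf]) auto
    have r: "min r1 r2 > 0" using r1 r2 by simp
    show "\<eta> n \<in> test_functions L" "(\<eta> n has_real_derivative \<eta>' n x) (at x)"
      unfolding \<eta>_def \<eta>'_def using truncation_test_function[OF d c r zero] by auto
  qed
  have \<eta>'_deriv: "\<eta>' n = deriv (\<eta> n)" for n by (intro ext DERIV_imp_deriv[symmetric] test')
  have L2': "\<eta>' n \<in> L2 L" for n unfolding \<eta>'_deriv by (rule test_function_deriv(6)[OF test])
  have L2: "\<eta> n \<in> L2 L" for n by (rule test_function_deriv(5)[OF test])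
  have f2: "f \<in> L2 L" "f' \<in> L2 L" using L2_cont cf cont by auto
  have wf: "has_weak_deriv L f f'" by (rule weak_deriv_C1[OF \<open>L > 0\<close> der cont])
  have w\<eta>: "has_weak_deriv L (\<eta> n) (\<eta>' n)" for n
    unfolding \<eta>'_deriv by (rule weak_deriv_C1[OF \<open>L > 0\<close> test_function_deriv(1,2)[OF test]])
  have w: "AE x in interval_measure L. wderiv L (f - \<eta> n) x = f' x - \<eta>' n x" for n
    using weak_deriv_lincomb[OF f2 L2[of n] L2'[of n] wf w\<eta>[of n], of 1 "-1"]
    by (intro wderiv_AE) (auto simp: fun_diff_def intro: L2_diff f2 L2 L2')
  have m1: "f - \<eta> n \<in> L2 L" for n unfolding fun_diff_def by (intro L2_diff f2 L2)
  have m2: "wderiv L (f - \<eta> n) \<in> L2 L" for n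
    using H1_lincomb(1)[OF H1I[OF f2 wf] H1I[OF L2[of n] L2' w\<eta>], of 1 "-1"] wderiv_spec by (simp add: fun_diff_def)
  have bdd: "\<exists>B\<ge>0. \<forall>x\<in>{0<..<L}. \<bar>g x\<bar> \<le> B" if "continuous_on UNIV g" for g :: "real \<Rightarrow> real"
  proof -
    have "bounded (g ` {0..L})"
      by (intro compact_imp_bounded compact_continuous_image continuous_on_subset[OF that]) auto
    then obtain B where "\<forall>x\<in>{0..L}. \<bar>g x\<bar> \<le> B" unfolding bounded_iff by auto
    moreover from this have "B \<ge> 0" using \<open>L > 0\<close> by (force intro: order.trans[OF abs_ge_zero])
    ultimately show ?thesis by (intro exI[of _ B]) auto
  qed
  obtain B where B: "B \<ge> 0" "\<And>x. x \<in> {0<..<L} \<Longrightarrow> \<bar>f x\<bar> \<le> B" using bdd[OF cf] by auto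
  obtain B' where B': "B' \<ge> 0" "\<And>x. x \<in> {0<..<L} \<Longrightarrow> \<bar>f' x\<bar> \<le> B'" using bdd[OF cont] by auto
  have lim1: "(\<lambda>n. (L2_norm_on L (f - \<eta> n))\<^sup>2) \<longlonglongrightarrow> 0"
  proof (rule L2_norm_dominated)
    show "f - \<eta> n \<in> borel_measurable (interval_measure L)" for n by (rule L2_measurable[OF m1])
    show "\<bar>(f - \<eta> n) x\<bar> \<le> 2 * B" if "x \<in> {0<..<L}" for x n
      using that B(2)[OF that] soft_cut_bound[of "\<delta> n" "f x"] by (simp add: \<eta>_def)
    show "AE x in interval_measure L. (\<lambda>n. (f - \<eta> n) x) \<longlonglongrightarrow> 0"
      using nz AE_space
    proof eventually_elim
      case (elim x)
      then show ?case using tendsto_diff[OF tendsto_const soft_cut_tendsto(1)[OF _ \<delta>0], of "f x" "f x"]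
        by (simp add: \<eta>_def)
    qed
  qed
  have lim2: "(\<lambda>n. (L2_norm_on L (\<lambda>x. f' x - \<eta>' n x))\<^sup>2) \<longlonglongrightarrow> 0"
  proof (rule L2_norm_dominated)
    show "(\<lambda>x. f' x - \<eta>' n x) \<in> borel_measurable (interval_measure L)" for n
      by (intro L2_measurable L2_diff f2 L2')
    show "\<bar>f' x - \<eta>' n x\<bar> \<le> 10 * B'" if "x \<in> {0<..<L}" for x n
    proof -
      have "\<bar>soft_cut_deriv (\<delta> n) (f x) * f' x\<bar> \<le> 9 * B'"
        unfolding abs_mult using B' that soft_cut_deriv_bound[OF \<delta>] by (intro mult_mono) auto
      then show ?thesis using B'(2)[OF that] that by (simp add: \<eta>'_def)
    qed
    show "AE x in interval_measure L. (\<lambda>n. f' x - \<eta>' n x) \<longlonglongrightarrow> 0"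
      using nz AE_space
    proof eventually_elim
      case (elim x)
      then have "(\<lambda>n. f' x - soft_cut_deriv (\<delta> n) (f x) * f' x) \<longlonglongrightarrow> f' x - 1 * f' x"
        by (intro tendsto_intros soft_cut_tendsto(2) \<delta>0)
      then show ?case using elim by (simp add: \<eta>'_def)
    qed
  qed
  have "L2_norm_on L (wderiv L (f - \<eta> n)) = L2_norm_on L (\<lambda>x. f' x - \<eta>' n x)" for n
    by (intro L2_norm_cong_AE m2 w L2_diff f2 L2')
  then have "(\<lambda>n. (H1_norm_on L (f - \<eta> n))\<^sup>2) \<longlonglongrightarrow> 0"
    unfolding H1_norm_power2 using tendsto_add[OF lim1 lim2] by simp
  then show ?thesis
    unfolding H1_0_iff_sequence using test H1I[OF f2 wf] by (intro conjI exI[of _ \<eta>] allI)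
qed

section \<open>Trigonometric modes\<close>

text \<open>Indexed from \<open>Suc n\<close>, so that the constant mode is excluded.\<close>

definition freq :: "real \<Rightarrow> nat \<Rightarrow> real"
  where "freq L n = real (Suc n) * pi / L"

lemma freq_pos: "L > 0 \<Longrightarrow> freq L n > 0"
  by (simp add: freq_def)

lemma sin_freq_L: "L > 0 \<Longrightarrow> sin (freq L n * L) = 0"
  unfolding freq_def using sin_npi[of "Suc n"] by simp

lemma sin_H1_0:
  assumes "L > 0"
  shows "(\<lambda>x. c * sin (freq L n * x)) \<in> H1_0 L"
proof -
  let ?k = "freq L n"
  have k: "?k > 0" using freq_pos[OF assms] .
  have "{x. sin (?k * x) = 0} \<subseteq> (\<lambda>i::int. of_int i * pi / ?k) ` UNIV"
    using k by (auto simp: sin_zero_iff_int2 image_def field_simps)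
  then have "countable {x. sin (?k * x) = 0}" by (rule countable_subset) auto
  then have "{x. sin (?k * x) = 0} \<in> null_sets lebesgue"
    using countable_imp_null_set_lborel null_sets_completionI by blast
  then have "AE x in lebesgue. x \<in> {0<..<L} \<longrightarrow> sin (?k * x) \<noteq> 0"
    using AE_not_in by fastforce
  then have "AE x in interval_measure L. sin (?k * x) \<noteq> 0"
    by (subst AE_restrict_space_iff) auto
  then have "(\<lambda>x. sin (?k * x)) \<in> H1_0 L"
    by (intro H1_0_C1[where f'="\<lambda>x. cos (?k * x) * ?k"] assms)
       (auto intro!: derivative_eq_intros continuous_intros simp: sin_freq_L[OF assms])
  from H1_0_lincomb[OF assms this this, of c 0] show ?thesis by simp
qed

lemma integral_cos_npi:
  assumes "L > 0" "m \<noteq> (0::int)"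
  shows "(\<integral>x. cos (of_int m * pi / L * x) \<partial>interval_measure L) = 0"
proof -
  let ?k = "of_int m * pi / L"
  have k: "?k \<noteq> 0" using assms by simp
  have "(\<integral>x. cos (?k * x) \<partial>interval_measure L) = sin (?k * L) / ?k - sin (?k * 0) / ?k"
    using k by (intro integral_FTC assms) (auto intro!: derivative_eq_intros continuous_intros)
  also have "sin (?k * L) = 0" using assms sin_npi_int[of m] by (simp add: mult.commute)
  finally show ?thesis by simp
qed

lemma integral_cos_freq:
  assumes "L > 0"
  shows "(\<integral>x. cos (freq L n * x) \<partial>interval_measure L) = 0"
  using integral_cos_npi[OF assms, of "int (Suc n)"] unfolding freq_def by simp

lemma cos_freq_orthogonal:
  assumes "L > 0"
  shows "(\<integral>x. cos (freq L n * x) * cos (freq L m * x) \<partial>interval_measure L) = (if n = m then L / 2 else 0)"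
proof -
  let ?i = "int n - int m" let ?j = "int n + int m + 2"
  have e: "cos (freq L n * x) * cos (freq L m * x) = 1 / 2 * cos (of_int ?i * pi / L * x) + 1 / 2 * cos (of_int ?j * pi / L * x)" for x
  proof -
    have "freq L n * x - freq L m * x = of_int ?i * pi / L * x"
      "freq L n * x + freq L m * x = of_int ?j * pi / L * x"
      by (simp_all add: freq_def diff_divide_distrib add_divide_distrib algebra_simps)
    then show ?thesis unfolding cos_times_cos by simp
  qed
  have ic: "integrable (interval_measure L) (\<lambda>x. cos (c * x))" for c
    by (intro L2_integrable L2_cont continuous_intros)
  have "(\<integral>x. cos (freq L n * x) * cos (freq L m * x) \<partial>interval_measure L)
      = 1 / 2 * (\<integral>x. cos (of_int ?i * pi / L * x) \<partial>interval_measure L) + 1 / 2 * (\<integral>x. cos (of_int ?j * pi / L * x) \<partial>interval_measure L)"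
    unfolding e Bochner_Integration.integral_add[OF integrable_mult_right[OF ic] integrable_mult_right[OF ic]]
    by simp
  also have "(\<integral>x. cos (of_int ?j * pi / L * x) \<partial>interval_measure L) = 0"
    by (intro integral_cos_npi assms) auto
  also have "(\<integral>x. cos (of_int ?i * pi / L * x) \<partial>interval_measure L) = (if n = m then L else 0)"
  proof (cases "n = m")
    case True
    have "(\<integral>x. 1 \<partial>interval_measure L) = L - 0"
      by (rule integral_FTC[OF assms]) (auto intro!: derivative_eq_intros)
    then show ?thesis using True by simp
  next
    case False
    then show ?thesis using integral_cos_npi[OF assms, of ?i] by simp
  qed
  finally show ?thesis by (cases "n = m") simp_all
qed

lemma L2_cos: "(\<lambda>x. cos (k * x)) \<in> L2 L"
  by (intro L2_cont continuous_intros)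

text \<open>By Bessel the squares of the coefficients are summable.\<close>

lemma Riemann_Lebesgue_cos:
  assumes "L > 0" "f \<in> L2 L"
  shows "(\<lambda>n. \<integral>x. f x * cos (freq L n * x) \<partial>interval_measure L) \<longlonglongrightarrow> 0"
proof -
  let ?c = "\<lambda>n. \<integral>x. f x * cos (freq L n * x) \<partial>interval_measure L"
  have "(\<Sum>n<N. (?c n)\<^sup>2) \<le> L / 2 * (\<integral>x. (f x)\<^sup>2 \<partial>interval_measure L)" for N
    using assms by (intro Bessel[where e="\<lambda>n x. cos (freq L n * x)"] L2_cos) (auto simp: cos_freq_orthogonal)
  then have "summable (\<lambda>n. (?c n)\<^sup>2)" by (rule summableI_nonneg_bounded[OF zero_le_power2])
  then have "(\<lambda>n. (?c n)\<^sup>2) \<longlonglongrightarrow> 0" by (rule summable_LIMSEQ_zero)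
  then have "(\<lambda>n. sqrt ((?c n)\<^sup>2)) \<longlonglongrightarrow> sqrt 0" by (rule tendsto_real_sqrt)
  then show ?thesis by (simp add: tendsto_rabs_zero_iff)
qed

lemma cos_mode_H1_star:
  assumes "L > 0"
  shows "(\<lambda>x. c * cos (freq L n * x) + d * cos (freq L m * x)) \<in> H1_star L"
proof -
  let ?f = "\<lambda>x. c * cos (freq L n * x) + d * cos (freq L m * x)"
  have "?f \<in> H1 L"
    by (rule H1_C1(1)[OF assms, where f'="\<lambda>x. c * (- sin (freq L n * x) * freq L n) + d * (- sin (freq L m * x) * freq L m)"])
       (auto intro!: derivative_eq_intros continuous_intros)
  moreover have "(\<integral>x. ?f x \<partial>interval_measure L) = 0"
    using integral_cos_freq[OF assms] L2_integrable[OF L2_cos] by simp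
  ultimately show ?thesis by (simp add: H1_star_def L2_star_def H1_L2)
qed

section \<open>Approximate standing waves of a semigroup\<close>

text \<open>A mean value inequality for right derivatives. If \<open>\<bar>f s - f 0\<bar> \<le> (K + \<epsilon>) s\<close> failed at \<open>t\<close>, consider the
  last \<open>\<sigma>\<close> where it holds: there the right derivative is less than \<open>K + \<epsilon>\<close>, so the inequality
  persists a little beyond \<open>\<sigma>\<close>.\<close>

lemma right_derivative_bound:
  fixes f :: "real \<Rightarrow> real"
  assumes t: "0 \<le> t" and cont: "continuous_on {0..t} f"
    and der: "\<And>s. 0 \<le> s \<Longrightarrow> s < t \<Longrightarrow> (f has_real_derivative f' s) (at_right s)"
    and bound: "\<And>s. 0 \<le> s \<Longrightarrow> s < t \<Longrightarrow> \<bar>f' s\<bar> \<le> K"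
  shows "\<bar>f t - f 0\<bar> \<le> K * t"
proof -
  have slack: "\<bar>f t - f 0\<bar> \<le> (K + \<epsilon>) * t" if "\<epsilon> > 0" for \<epsilon>
  proof (rule ccontr)
    assume neg: "\<not> \<bar>f t - f 0\<bar> \<le> (K + \<epsilon>) * t"
    let ?S = "{s \<in> {0..t}. \<bar>f s - f 0\<bar> \<le> (K + \<epsilon>) * s}"
    have "closed ?S"
      by (intro continuous_on_closed_Collect_le continuous_intros cont)
    moreover have "bounded ?S" by (rule bounded_subset[of "{0..t}"]) auto
    ultimately have "compact ?S" by (simp add: compact_eq_bounded_closed)
    moreover have "0 \<in> ?S" using t by simp
    then have "?S \<noteq> {}" by blast
    ultimately obtain \<sigma> where \<sigma>: "\<sigma> \<in> ?S" "\<And>s. s \<in> ?S \<Longrightarrow> s \<le> \<sigma>"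
      using compact_attains_sup[of ?S] by auto
    then have "\<sigma> < t" "0 \<le> \<sigma>" using neg by (auto simp: less_le)
    have "((\<lambda>y. (f y - f \<sigma>) / (y - \<sigma>)) \<longlongrightarrow> f' \<sigma>) (at_right \<sigma>)"
      using der[OF \<open>0 \<le> \<sigma>\<close> \<open>\<sigma> < t\<close>] by (simp add: has_field_derivative_iff)
    then have "((\<lambda>y. \<bar>(f y - f \<sigma>) / (y - \<sigma>)\<bar>) \<longlongrightarrow> \<bar>f' \<sigma>\<bar>) (at_right \<sigma>)"
      by (rule tendsto_rabs)
    moreover have "\<bar>f' \<sigma>\<bar> < K + \<epsilon>" using bound[OF \<open>0 \<le> \<sigma>\<close> \<open>\<sigma> < t\<close>] that by linarith
    ultimately have "\<forall>\<^sub>F y in at_right \<sigma>. \<bar>(f y - f \<sigma>) / (y - \<sigma>)\<bar> < K + \<epsilon>"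
      by (rule order_tendstoD)
    with eventually_at_right_real[OF \<open>\<sigma> < t\<close>]
    have "\<forall>\<^sub>F y in at_right \<sigma>. y \<in> {\<sigma><..<t} \<and> \<bar>(f y - f \<sigma>) / (y - \<sigma>)\<bar> < K + \<epsilon>"
      by eventually_elim simp
    from eventually_happens'[OF trivial_limit_at_right_real this]
    obtain y where y: "\<sigma> < y" "y < t" "\<bar>(f y - f \<sigma>) / (y - \<sigma>)\<bar> < K + \<epsilon>"
      by auto
    then have "\<bar>f y - f \<sigma>\<bar> \<le> (K + \<epsilon>) * (y - \<sigma>)"
      by (simp add: abs_divide divide_less_eq split: if_splits)
    moreover have "\<bar>f \<sigma> - f 0\<bar> \<le> (K + \<epsilon>) * \<sigma>" using \<sigma> by simp
    ultimately have "\<bar>f y - f 0\<bar> \<le> (K + \<epsilon>) * (y - \<sigma>) + (K + \<epsilon>) * \<sigma>" by linarith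
    then have "y \<in> ?S" using y \<open>0 \<le> \<sigma>\<close> by (simp add: algebra_simps)
    from \<sigma>(2)[OF this] show False using y by simp
  qed
  show ?thesis
  proof (rule field_le_epsilon)
    fix e :: real assume "e > 0"
    have "\<bar>f t - f 0\<bar> \<le> K * t + e / (t + 1) * t" using t \<open>e > 0\<close> slack[of "e / (t + 1)"] by (simp add: algebra_simps)
    also have "e / (t + 1) * t \<le> e" using t \<open>e > 0\<close> by (simp add: divide_le_eq algebra_simps)
    finally show "\<bar>f t - f 0\<bar> \<le> K * t + e" by simp
  qed
qed

text \<open>A linear functional that is bounded with respect to \<open>N\<close>. It does not distinguish states at
  distance zero, so the identities of \<open>C0_semigroup\<close>, which hold up to distance zero, become
  equations between real numbers.\<close>

locale semigroup_functional =
  fixes X :: "'v::real_vector set" and N :: "'v \<Rightarrow> real" and T :: "real \<Rightarrow> 'v \<Rightarrow> 'v"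
    and f :: "'v \<Rightarrow> real" and C :: real
  assumes semigroup: "C0_semigroup X N T"
    and lin_X: "\<And>U V c d. U \<in> X \<Longrightarrow> V \<in> X \<Longrightarrow> c *\<^sub>R U + d *\<^sub>R V \<in> X"
    and lin_f: "\<And>U V c d. U \<in> X \<Longrightarrow> V \<in> X \<Longrightarrow> f (c *\<^sub>R U + d *\<^sub>R V) = c * f U + d * f V"
    and C: "C \<ge> 0" and f_bound: "\<And>U. U \<in> X \<Longrightarrow> \<bar>f U\<bar> \<le> C * N U"
begin

lemma X_diff: "U \<in> X \<Longrightarrow> V \<in> X \<Longrightarrow> U - V \<in> X"
  using lin_X[of U V 1 "-1"] by simp

lemma f_diff: "U \<in> X \<Longrightarrow> V \<in> X \<Longrightarrow> f (U - V) = f U - f V"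
  using lin_f[of U V 1 "-1"] by simp

lemma T_X: "t \<ge> 0 \<Longrightarrow> U \<in> X \<Longrightarrow> T t U \<in> X"
  using semigroup by (simp add: C0_semigroup_def)

lemma f_eqI:
  assumes "U \<in> X" "V \<in> X" "N (U - V) = 0"
  shows "f U = f V"
  using f_bound[OF X_diff[OF assms(1,2)]] assms f_diff by simp

lemma f_T_lincomb:
  assumes "t \<ge> 0" "U \<in> X" "V \<in> X"
  shows "f (T t (c *\<^sub>R U + d *\<^sub>R V)) = c * f (T t U) + d * f (T t V)"
proof -
  have "f (T t (c *\<^sub>R U + d *\<^sub>R V)) = f (c *\<^sub>R T t U + d *\<^sub>R T t V)"
    using assms semigroup by (intro f_eqI T_X lin_X) (simp_all add: C0_semigroup_def)
  then show ?thesis using lin_f T_X assms by simp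
qed

lemma f_T_0: "U \<in> X \<Longrightarrow> f (T 0 U) = f U"
  using semigroup by (intro f_eqI T_X) (simp_all add: C0_semigroup_def)

lemma continuous_f_T:
  assumes "U \<in> X"
  shows "continuous_on {0..} (\<lambda>s. f (T s U))"
  unfolding continuous_on_def
proof
  fix s :: real assume s: "s \<in> {0..}"
  have "((\<lambda>r. C * N (T r U - T s U)) \<longlongrightarrow> C * 0) (at s within {0..})"
    using semigroup assms s unfolding C0_semigroup_def by (intro tendsto_mult_left) simp
  then have "((\<lambda>r. C * N (T r U - T s U)) \<longlongrightarrow> 0) (at s within {0..})" by simp
  then have "((\<lambda>r. f (T r U) - f (T s U)) \<longlongrightarrow> 0) (at s within {0..})"
  proof (rule Lim_null_comparison[rotated])
    show "\<forall>\<^sub>F r in at s within {0..}. norm (f (T r U) - f (T s U)) \<le> C * N (T r U - T s U)"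
      unfolding eventually_at_filter
    proof (intro always_eventually allI impI)
      fix r :: real assume "r \<in> {0..}"
      then have "T r U \<in> X" "T s U \<in> X" using s assms T_X by auto
      then show "norm (f (T r U) - f (T s U)) \<le> C * N (T r U - T s U)"
        using f_bound[OF X_diff] f_diff by simp
    qed
  qed
  then show "((\<lambda>s. f (T s U)) \<longlongrightarrow> f (T s U)) (at s within {0..})"
    by (simp add: LIM_zero_iff)
qed

text \<open>The increment of \<open>r \<mapsto> T r P\<close> at \<open>s\<close> is \<open>T s\<close> applied to the increment at \<open>0\<close>. The
  error is controlled by the bound for the single operator \<open>T s\<close>.\<close>

lemma right_deriv_f_T:
  assumes "P \<in> X" "F \<in> X" and gen: "((\<lambda>h. N ((1 / h) *\<^sub>R (T h P - P) - F)) \<longlongrightarrow> 0) (at_right 0)"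
    and s: "s \<ge> 0"
  shows "((\<lambda>r. f (T r P)) has_real_derivative f (T s F)) (at_right s)"
proof -
  have "\<exists>D. \<forall>U\<in>X. N (T s U) \<le> D * N U"
    using semigroup s by (simp add: C0_semigroup_def)
  then obtain D where D: "\<And>U. U \<in> X \<Longrightarrow> N (T s U) \<le> D * N U" by blast
  let ?V = "\<lambda>h. (1 / h) *\<^sub>R (T h P - P)"
  have "((\<lambda>h. (f (T (h + s) P) - f (T s P)) / h - f (T s F)) \<longlongrightarrow> 0) (at_right 0)"
  proof (rule Lim_null_comparison)
    show "((\<lambda>h. C * (D * N (?V h - F))) \<longlongrightarrow> 0) (at_right 0)"
      using tendsto_mult_left[OF tendsto_mult_left[OF gen, of D], of C] by simp
    show "\<forall>\<^sub>F h in at_right 0. norm ((f (T (h + s) P) - f (T s P)) / h - f (T s F)) \<le> C * (D * N (?V h - F))"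
      unfolding eventually_at_filter
    proof (intro always_eventually allI impI)
      fix h :: real assume "h \<in> {0<..}"
      then have h: "h > 0" by simp
      have Th: "T h P \<in> X" using T_X h assms by simp
      have V: "?V h \<in> X" using lin_X[OF Th \<open>P \<in> X\<close>, of "1 / h" "- (1 / h)"] by (simp add: algebra_simps)
      have "f (T (h + s) P) = f (T s (T h P))"
        using semigroup s h \<open>P \<in> X\<close> T_X Th
        by (intro f_eqI) (simp_all add: C0_semigroup_def add.commute[of h s])
      moreover have "f (T s (?V h)) = (f (T s (T h P)) - f (T s P)) / h"
        using f_T_lincomb[OF s Th \<open>P \<in> X\<close>, of "1 / h" "- (1 / h)"]
        by (simp add: algebra_simps diff_divide_distrib)
      moreover have "f (T s (?V h - F)) = f (T s (?V h)) - f (T s F)"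
        using f_T_lincomb[OF s V \<open>F \<in> X\<close>, of 1 "-1"] by simp
      ultimately have "(f (T (h + s) P) - f (T s P)) / h - f (T s F) = f (T s (?V h - F))"
        by simp
      moreover have "\<bar>f (T s (?V h - F))\<bar> \<le> C * N (T s (?V h - F))"
        by (intro f_bound T_X s X_diff V assms)
      moreover have "C * N (T s (?V h - F)) \<le> C * (D * N (?V h - F))"
        by (intro mult_left_mono D X_diff V assms C)
      ultimately show "norm ((f (T (h + s) P) - f (T s P)) / h - f (T s F)) \<le> C * (D * N (?V h - F))"
        by simp
    qed
  qed
  then show ?thesis
    unfolding has_field_derivative_iff filterlim_at_right_to_0[of _ _ s] by (simp add: LIM_zero_iff)
qed

text \<open>The rotating state \<open>cos (\<mu> r) P + sin (\<mu> r) Q\<close> solves the evolution equation up to \<open>RP\<close> and \<open>RQ\<close>,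
  where \<open>RP = \<mu> Q - A P\<close> and \<open>RQ = - \<mu> P - A Q\<close> for the generator \<open>A\<close>. The function \<open>g\<close> in the proof
  observes \<open>T s\<close> applied to the state that has rotated, starting from \<open>Q\<close>, for the remaining time \<open>t - s\<close>;
  its derivative consists of residual terms only (Duhamel).\<close>

lemma quasimode_estimate:
  assumes X: "P \<in> X" "Q \<in> X" "RP \<in> X" "RQ \<in> X"
    and genP: "((\<lambda>h. N ((1 / h) *\<^sub>R (T h P - P) - (\<mu> *\<^sub>R Q - RP))) \<longlongrightarrow> 0) (at_right 0)"
    and genQ: "((\<lambda>h. N ((1 / h) *\<^sub>R (T h Q - Q) - (- \<mu> *\<^sub>R P - RQ))) \<longlongrightarrow> 0) (at_right 0)"
    and KP: "\<And>s. s \<ge> 0 \<Longrightarrow> \<bar>f (T s RP)\<bar> \<le> KP" and KQ: "\<And>s. s \<ge> 0 \<Longrightarrow> \<bar>f (T s RQ)\<bar> \<le> KQ"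
    and t: "t \<ge> 0"
  shows "\<bar>f (T t Q) - (cos (\<mu> * t) * f Q - sin (\<mu> * t) * f P)\<bar> \<le> (KP + KQ) * t"
proof -
  let ?x = "\<lambda>s. f (T s P)" and ?y = "\<lambda>s. f (T s Q)"
  define g where "g s = cos (\<mu> * (t - s)) * ?y s - sin (\<mu> * (t - s)) * ?x s" for s
  have F: "\<mu> *\<^sub>R Q - RP \<in> X" "- \<mu> *\<^sub>R P - RQ \<in> X"
    using lin_X[OF X(2,3), of \<mu> "-1"] lin_X[OF X(1,4), of "- \<mu>" "-1"] by simp_all
  have fP: "f (T s (\<mu> *\<^sub>R Q - RP)) = \<mu> * ?y s - f (T s RP)"
    and fQ: "f (T s (- \<mu> *\<^sub>R P - RQ)) = - \<mu> * ?x s - f (T s RQ)" if "s \<ge> 0" for s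
    using f_T_lincomb[OF that X(2,3), of \<mu> "-1"] f_T_lincomb[OF that X(1,4), of "- \<mu>" "-1"] by simp_all
  have "\<bar>g t - g 0\<bar> \<le> (KP + KQ) * t"
  proof (rule right_derivative_bound[OF t])
    show "continuous_on {0..t} g"
      unfolding g_def by (intro continuous_intros continuous_on_subset[OF continuous_f_T] X) auto
    fix s assume s: "0 \<le> s" "s < t"
    have dx: "(?x has_real_derivative \<mu> * ?y s - f (T s RP)) (at_right s)"
      using right_deriv_f_T[OF X(1) F(1) genP s(1)] fP[OF s(1)] by simp
    have dy: "(?y has_real_derivative - \<mu> * ?x s - f (T s RQ)) (at_right s)"
      using right_deriv_f_T[OF X(2) F(2) genQ s(1)] fQ[OF s(1)] by simp
    show "(g has_real_derivative
        sin (\<mu> * (t - s)) * f (T s RP) - cos (\<mu> * (t - s)) * f (T s RQ)) (at_right s)"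
      unfolding g_def by (auto intro!: derivative_eq_intros dx dy simp: algebra_simps)
    have "\<bar>sin (\<mu> * (t - s)) * f (T s RP)\<bar> \<le> 1 * KP" "\<bar>cos (\<mu> * (t - s)) * f (T s RQ)\<bar> \<le> 1 * KQ"
      unfolding abs_mult using KP[OF s(1)] KQ[OF s(1)] by (intro mult_mono; simp)+
    then show "\<bar>sin (\<mu> * (t - s)) * f (T s RP) - cos (\<mu> * (t - s)) * f (T s RQ)\<bar> \<le> KP + KQ"
      by linarith
  qed
  moreover have "g t = f (T t Q)" "g 0 = cos (\<mu> * t) * f Q - sin (\<mu> * t) * f P"
    unfolding g_def by (simp_all add: f_T_0[OF X(1)] f_T_0[OF X(2)])
  ultimately show ?thesis by (simp only:)
qed

end

section \<open>The Bresse system\<close>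

lemma bresse_space_subset: "bresse_space L \<subseteq> bresse_full_space L"
  by (auto simp: bresse_space_def bresse_full_space_def H1_star_def L2_star_def)

lemma bresse_dom_subset: "bresse_dom L \<subseteq> bresse_full_dom L"
  by (auto simp: bresse_dom_def bresse_full_dom_def H1_star_def)

lemma L2_star_lincomb:
  assumes "f \<in> L2_star L" "g \<in> L2_star L"
  shows "(\<lambda>x. c * f x + d * g x) \<in> L2_star L"
  using assms L2_lincomb[of f L g c d] L2_integrable[of f L] L2_integrable[of g L]
  by (simp add: L2_star_def)

lemma H1_star_lincomb:
  assumes "f \<in> H1_star L" "g \<in> H1_star L"
  shows "(\<lambda>x. c * f x + d * g x) \<in> H1_star L"
  using assms H1_lincomb(1)[of f L g c d] L2_star_lincomb[of f L g c d]
  by (simp add: H1_star_def)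

lemmas state_simps = scaleR_prod_def plus_prod_def minus_prod_def scaleR_fun_def plus_fun_def fun_diff_def

lemma lin_bresse_full_space:
  assumes "L > 0" "U \<in> bresse_full_space L" "V \<in> bresse_full_space L"
  shows "c *\<^sub>R U + d *\<^sub>R V \<in> bresse_full_space L"
  using assms
  by (cases U; cases V)
    (simp add: bresse_full_space_def state_simps H1_0_lincomb H1_lincomb(1) L2_lincomb)

lemma lin_bresse_space:
  assumes "L > 0" "U \<in> bresse_space L" "V \<in> bresse_space L"
  shows "c *\<^sub>R U + d *\<^sub>R V \<in> bresse_space L"
  using assms
  by (cases U; cases V)
    (simp add: bresse_space_def state_simps H1_0_lincomb H1_star_lincomb L2_lincomb L2_star_lincomb)

text \<open>The functional along which standing waves are observed: a cosine coefficient of the velocity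
  \<open>z = \<omega>\<^sub>t\<close>. It involves no weak derivative, and it is controlled by the energy.\<close>

fun cos_coeff :: "real \<Rightarrow> nat \<Rightarrow> state \<Rightarrow> real"
  where "cos_coeff L n (\<phi>, \<psi>, \<omega>, u, v, z) = (\<integral>x. z x * cos (freq L n * x) \<partial>interval_measure L)"

lemma cos_coeff_lincomb:
  assumes "U \<in> bresse_full_space L" "V \<in> bresse_full_space L"
  shows "cos_coeff L n (c *\<^sub>R U + d *\<^sub>R V) = c * cos_coeff L n U + d * cos_coeff L n V"
proof -
  obtain \<phi> \<psi> \<omega> u v z where U: "U = (\<phi>, \<psi>, \<omega>, u, v, z)" by (cases U)
  obtain \<phi>' \<psi>' \<omega>' u' v' z' where V: "V = (\<phi>', \<psi>', \<omega>', u', v', z')" by (cases V)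
  have z: "z \<in> L2 L" "z' \<in> L2 L" using assms by (auto simp: U V bresse_full_space_def)
  have i: "integrable (interval_measure L) (\<lambda>x. z x * cos (freq L n * x))"
    "integrable (interval_measure L) (\<lambda>x. z' x * cos (freq L n * x))"
    by (intro L2_mult_integrable z L2_cos)+
  have "(\<integral>x. (c * z x + d * z' x) * cos (freq L n * x) \<partial>interval_measure L)
      = (\<integral>x. c * (z x * cos (freq L n * x)) + d * (z' x * cos (freq L n * x)) \<partial>interval_measure L)"
    by (simp add: algebra_simps)
  then show ?thesis using i by (simp add: U V state_simps)
qed

lemma cos_coeff_bound:
  assumes "L > 0" "z \<in> L2 L"
  shows "(cos_coeff L n (\<phi>, \<psi>, \<omega>, u, v, z))\<^sup>2 \<le> L / 2 * (L2_norm_on L z)\<^sup>2"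
  using Bessel[OF assms(2), of "{n}" "\<lambda>n x. cos (freq L n * x)" "L / 2"] assms cos_freq_orthogonal[OF assms(1)] L2_cos
  by (simp add: L2_norm_power2)

lemma wderiv_zero:
  assumes "L > 0"
  shows "AE x in interval_measure L. wderiv L (\<lambda>x. 0) x = 0"
  using H1_C1(2)[OF assms, of "\<lambda>x. 0" "\<lambda>x. 0"] by simp

lemma L2_norm_AE_zero: "AE x in interval_measure L. f x = 0 \<Longrightarrow> L2_norm_on L f = 0"
proof -
  assume "AE x in interval_measure L. f x = 0"
  then have "AE x in interval_measure L. (f x)\<^sup>2 = 0" by eventually_elim simp
  from integral_eq_zero_AE[OF this] show ?thesis by (simp add: L2_norm_on_def)
qed

lemma continuous_DERIV:
  "(\<And>x. (f has_real_derivative f' x) (at x)) \<Longrightarrow> continuous_on UNIV f"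
  using DERIV_continuous_on[of UNIV f f'] by auto

text \<open>If some coefficient of \<open>f\<close> is nonzero, the mode \<open>m\<close> belonging to it can be used to cancel all others;
  otherwise \<open>\<gamma> = 0\<close> works.\<close>

lemma orthogonal_correction:
  assumes "L > 0" "f \<in> L2 L"
  obtains \<gamma> m where "\<gamma> \<longlonglongrightarrow> 0"
    "\<And>n. (\<integral>x. f x * (cos (freq L n * x) + \<gamma> n * cos (freq L m * x)) \<partial>interval_measure L) = 0"
proof -
  define c where "c n = (\<integral>x. f x * cos (freq L n * x) \<partial>interval_measure L)" for n
  have i: "integrable (interval_measure L) (\<lambda>x. f x * cos (freq L n * x))" for n
    by (intro L2_mult_integrable assms L2_cos)
  have e: "(\<integral>x. f x * (cos (freq L n * x) + g * cos (freq L m * x)) \<partial>interval_measure L) = c n + g * c m" for n m g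
  proof -
    have "(\<integral>x. f x * (cos (freq L n * x) + g * cos (freq L m * x)) \<partial>interval_measure L)
       = (\<integral>x. f x * cos (freq L n * x) + g * (f x * cos (freq L m * x)) \<partial>interval_measure L)"
      by (simp add: algebra_simps)
    then show ?thesis using i by (simp add: c_def)
  qed
  show ?thesis
  proof (cases "\<forall>n. c n = 0")
    case True
    show ?thesis
    proof (rule that[of "\<lambda>n. 0" 0])
      show "(\<integral>x. f x * (cos (freq L n * x) + 0 * cos (freq L 0 * x)) \<partial>interval_measure L) = 0" for n
        unfolding e using True by simp
    qed simp
  next
    case False
    then obtain m where m: "c m \<noteq> 0" by blast
    show ?thesis
    proof (rule that[of "\<lambda>n. - (c n / c m)" m])
      have "(\<lambda>n. - (c n / c m)) \<longlonglongrightarrow> - (0 / c m)"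
        using Riemann_Lebesgue_cos[OF assms] m unfolding c_def[symmetric] by (intro tendsto_intros)
      then show "(\<lambda>n. - (c n / c m)) \<longlonglongrightarrow> 0" by simp
      show "(\<integral>x. f x * (cos (freq L n * x) + - (c n / c m) * cos (freq L m * x)) \<partial>interval_measure L) = 0" for n
        unfolding e using m by simp
    qed
  qed
qed

locale bresse =
  fixes \<rho>1 \<rho>2 \<kappa> \<kappa>0 b l L :: real and a :: "real \<Rightarrow> real" and C :: real
  assumes pos: "\<rho>1 > 0" "\<rho>2 > 0" "\<kappa> > 0" "\<kappa>0 > 0" "b > 0" "l > 0" "L > 0"
    and a_measurable: "a \<in> borel_measurable (interval_measure L)"
    and a_bound: "AE x in interval_measure L. \<bar>a x\<bar> \<le> C"
begin

abbreviation "energy \<equiv> bresse_energy \<rho>1 \<rho>2 \<kappa> \<kappa>0 b l L"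
abbreviation "enorm \<equiv> bresse_norm \<rho>1 \<rho>2 \<kappa> \<kappa>0 b l L"
abbreviation "op \<equiv> bresse_op \<rho>1 \<rho>2 \<kappa> \<kappa>0 b l L a"

lemma a_L2: "a \<in> L2 L"
  by (rule L2_bounded[OF a_measurable a_bound])

lemma energy_eq_norm:
  assumes "U \<in> bresse_full_space L"
  shows "energy U = 1 / 2 * (enorm U)\<^sup>2"
proof -
  obtain \<phi> \<psi> \<omega> u v z where U: "U = (\<phi>, \<psi>, \<omega>, u, v, z)" by (cases U)
  have m: "\<phi> \<in> H1 L" "\<psi> \<in> H1 L" "\<omega> \<in> H1 L" "u \<in> L2 L" "v \<in> L2 L" "z \<in> L2 L"
    using assms H1_0_H1 by (auto simp: U bresse_full_space_def)
  have s: "shear l L \<phi> \<psi> \<omega> \<in> L2 L" "axial l L \<phi> \<omega> \<in> L2 L"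
    unfolding shear_def axial_def using m H1_L2 wderiv_spec(1)
    by (auto intro!: L2_add L2_diff L2_cmult)
  have q: "integrable (interval_measure L) (\<lambda>x. (f x)\<^sup>2)"
    if "f \<in> {shear l L \<phi> \<psi> \<omega>, axial l L \<phi> \<omega>, wderiv L \<psi>, u, v, z}" for f
    using that m s wderiv_spec(1) by (auto intro: L2_square)
  show ?thesis
    unfolding U bresse_energy.simps bresse_norm.simps L2_norm_power2
    using pos q by (subst real_sqrt_pow2) (auto intro!: add_nonneg_nonneg)
qed

lemma cos_coeff_energy:
  assumes "U \<in> bresse_full_space L"
  shows "\<bar>cos_coeff L n U\<bar> \<le> sqrt (L / \<rho>1 * energy U)"
proof -
  obtain \<phi> \<psi> \<omega> u v z where U: "U = (\<phi>, \<psi>, \<omega>, u, v, z)" by (cases U)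
  have z: "z \<in> L2 L" using assms by (auto simp: U bresse_full_space_def)
  have "\<rho>1 * (L2_norm_on L z)\<^sup>2 \<le> (enorm U)\<^sup>2"
    unfolding U bresse_norm.simps using pos by (subst real_sqrt_pow2) (auto intro!: add_nonneg_nonneg)
  then have "L / \<rho>1 * (\<rho>1 * (L2_norm_on L z)\<^sup>2) \<le> L / \<rho>1 * (2 * energy U)"
    using pos energy_eq_norm[OF assms] by (intro mult_left_mono) auto
  then have "L / 2 * (L2_norm_on L z)\<^sup>2 \<le> L / \<rho>1 * energy U"
    using pos by (simp add: field_simps)
  then have "(cos_coeff L n U)\<^sup>2 \<le> L / \<rho>1 * energy U"
    using cos_coeff_bound[OF pos(7) z, of n \<phi> \<psi> \<omega> u v] U by simp
  then show ?thesis by (simp add: real_le_rsqrt)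
qed

lemma velocity_energy:
  assumes u: "u \<in> L2 L" "AE x in interval_measure L. \<bar>u x\<bar> \<le> c"
    and v: "v \<in> L2 L" "AE x in interval_measure L. \<bar>v x\<bar> \<le> c"
    and z: "z \<in> L2 L" "AE x in interval_measure L. \<bar>z x\<bar> \<le> c"
  shows "energy (\<lambda>x. 0, \<lambda>x. 0, \<lambda>x. 0, u, v, z) \<le> (2 * \<rho>1 + \<rho>2) * L * c\<^sup>2 / 2"
proof -
  let ?O = "\<lambda>x::real. 0::real"
  have lint: "(\<integral>x. 1 \<partial>interval_measure L) = L - 0"
    by (rule integral_FTC[OF pos(7)]) (auto intro!: derivative_eq_intros)
  have m: "(?O, ?O, ?O, u, v, z) \<in> bresse_full_space L"
  proof -
    have "?O \<in> H1_0 L" using sin_H1_0[OF pos(7), of 0 0] by simp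
    then show ?thesis using u v z H1_0_H1 by (simp add: bresse_full_space_def)
  qed
  have s: "L2_norm_on L (shear l L ?O ?O ?O) = 0" "L2_norm_on L (axial l L ?O ?O) = 0" "L2_norm_on L (wderiv L ?O) = 0"
    using wderiv_zero[OF pos(7)] by (auto intro!: L2_norm_AE_zero simp: shear_def axial_def)
  have bd: "(L2_norm_on L f)\<^sup>2 \<le> c\<^sup>2 * L" if "f \<in> L2 L" "AE x in interval_measure L. \<bar>f x\<bar> \<le> c" for f
  proof -
    have "(\<integral>x. (f x)\<^sup>2 \<partial>interval_measure L) \<le> (\<integral>x. c\<^sup>2 * 1 \<partial>interval_measure L)"
    proof (rule integral_mono_AE)
      show "AE x in interval_measure L. (f x)\<^sup>2 \<le> c\<^sup>2 * 1"
        using that(2) by eventually_elim (use abs_le_square_iff in \<open>fastforce simp: abs_le_square_iff[symmetric]\<close>)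
    qed (use that L2_square L2_integrable[OF L2_const] in auto)
    then show ?thesis using lint by (simp add: L2_norm_power2 mult.commute)
  qed
  have "energy (?O, ?O, ?O, u, v, z)
      = 1 / 2 * (\<rho>1 * (L2_norm_on L u)\<^sup>2 + \<rho>2 * (L2_norm_on L v)\<^sup>2 + \<rho>1 * (L2_norm_on L z)\<^sup>2)"
    unfolding energy_eq_norm[OF m] bresse_norm.simps s using pos
    by (subst real_sqrt_pow2) (auto intro!: add_nonneg_nonneg)
  also have "\<dots> \<le> 1 / 2 * (\<rho>1 * (c\<^sup>2 * L) + \<rho>2 * (c\<^sup>2 * L) + \<rho>1 * (c\<^sup>2 * L))"
    using pos u v z by (intro mult_left_mono add_mono bd) auto
  also have "\<dots> = (2 * \<rho>1 + \<rho>2) * L * c\<^sup>2 / 2" by (simp add: algebra_simps)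
  finally show ?thesis .
qed

lemma enorm_residual_zero:
  assumes "AE x in interval_measure L. p x = 0" "AE x in interval_measure L. q x = 0" "AE x in interval_measure L. r x = 0"
  shows "enorm (\<lambda>x. 0, \<lambda>x. 0, \<lambda>x. 0, p, q, r) = 0" "bresse_full_norm L (\<lambda>x. 0, \<lambda>x. 0, \<lambda>x. 0, p, q, r) = 0"
proof -
  let ?O = "\<lambda>x::real. 0::real"
  have s: "L2_norm_on L (shear l L ?O ?O ?O) = 0" "L2_norm_on L (axial l L ?O ?O) = 0" "L2_norm_on L (wderiv L ?O) = 0" "L2_norm_on L ?O = 0"
    using wderiv_zero[OF pos(7)] by (auto intro!: L2_norm_AE_zero simp: shear_def axial_def)
  note t = assms[THEN L2_norm_AE_zero]
  show "enorm (\<lambda>x. 0, \<lambda>x. 0, \<lambda>x. 0, p, q, r) = 0" by (simp add: s t)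
  show "bresse_full_norm L (\<lambda>x. 0, \<lambda>x. 0, \<lambda>x. 0, p, q, r) = 0" by (simp add: s t H1_norm_on_def)
qed

text \<open>On twice differentiable profiles all weak derivatives are classical, up to null sets. The velocities
  are left arbitrary, since the standing waves are used at the two instants when either the
  displacements or the velocities vanish.\<close>

lemma smooth_state:
  assumes d\<phi>: "\<And>x. (\<phi> has_real_derivative \<phi>' x) (at x)" "\<And>x. (\<phi>' has_real_derivative \<phi>'' x) (at x)" "continuous_on UNIV \<phi>''"
    and d\<psi>: "\<And>x. (\<psi> has_real_derivative \<psi>' x) (at x)" "\<And>x. (\<psi>' has_real_derivative \<psi>'' x) (at x)" "continuous_on UNIV \<psi>''"
    and d\<omega>: "\<And>x. (\<omega> has_real_derivative \<omega>' x) (at x)" "\<And>x. (\<omega>' has_real_derivative \<omega>'' x) (at x)" "continuous_on UNIV \<omega>''"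
    and m: "\<phi> \<in> H1_0 L" "\<psi>' \<in> H1_0 L" "\<omega>' \<in> H1_0 L" "\<psi> \<in> H1_star L" "\<omega> \<in> H1_star L"
    and V: "u \<in> H1_0 L" "v \<in> H1_star L" "z \<in> H1_star L"
  shows "(\<phi>, \<psi>, \<omega>, u, v, z) \<in> bresse_dom L" "(\<phi>, \<psi>, \<omega>, u, v, z) \<in> bresse_space L"
    and "AE x in interval_measure L. \<kappa> / \<rho>1 * wderiv L (shear l L \<phi> \<psi> \<omega>) x + \<kappa>0 * l / \<rho>1 * axial l L \<phi> \<omega> x
       = \<kappa> / \<rho>1 * (\<phi>'' x + \<psi>' x + l * \<omega>' x) + \<kappa>0 * l / \<rho>1 * (\<omega>' x - l * \<phi> x)"
    and "AE x in interval_measure L. b / \<rho>2 * wderiv L (wderiv L \<psi>) x - \<kappa> / \<rho>2 * shear l L \<phi> \<psi> \<omega> x - 1 / \<rho>2 * a x * v x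
       = b / \<rho>2 * \<psi>'' x - \<kappa> / \<rho>2 * (\<phi>' x + \<psi> x + l * \<omega> x) - 1 / \<rho>2 * a x * v x"
    and "AE x in interval_measure L. \<kappa>0 / \<rho>1 * wderiv L (axial l L \<phi> \<omega>) x - \<kappa> * l / \<rho>1 * shear l L \<phi> \<psi> \<omega> x
       = \<kappa>0 / \<rho>1 * (\<omega>'' x - l * \<phi>' x) - \<kappa> * l / \<rho>1 * (\<phi>' x + \<psi> x + l * \<omega> x)"
proof -
  let ?M = "interval_measure L"
  note c' = continuous_DERIV[OF d\<phi>(2)] continuous_DERIV[OF d\<psi>(2)] continuous_DERIV[OF d\<omega>(2)]
  note H = H1_C1[OF pos(7)]
  have w\<phi>: "\<phi> \<in> H1 L" "AE x in ?M. wderiv L \<phi> x = \<phi>' x" using H[OF d\<phi>(1) c'(1)] by auto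
  have w\<psi>: "\<psi> \<in> H1 L" "AE x in ?M. wderiv L \<psi> x = \<psi>' x" using H[OF d\<psi>(1) c'(2)] by auto
  have w\<omega>: "\<omega> \<in> H1 L" "AE x in ?M. wderiv L \<omega> x = \<omega>' x" using H[OF d\<omega>(1) c'(3)] by auto
  have m\<phi>: "wderiv L \<phi> \<in> borel_measurable ?M" and m\<psi>: "wderiv L \<psi> \<in> borel_measurable ?M" and m\<omega>: "wderiv L \<omega> \<in> borel_measurable ?M"
    using w\<phi>(1) w\<psi>(1) w\<omega>(1) by (auto intro: L2_measurable wderiv_spec(1))
  have e\<phi>: "AE x in ?M. \<phi>' x = wderiv L \<phi> x" using w\<phi>(2) by eventually_elim simp
  have e\<psi>: "AE x in ?M. \<psi>' x = wderiv L \<psi> x" using w\<psi>(2) by eventually_elim simp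
  have e\<omega>: "AE x in ?M. \<omega>' x = wderiv L \<omega> x" using w\<omega>(2) by eventually_elim simp
  have h\<phi>: "wderiv L \<phi> \<in> H1 L" by (rule H1_cong_AE(1)[OF H(1)[OF d\<phi>(2,3)] m\<phi> e\<phi>])
  have h\<psi>: "wderiv L \<psi> \<in> H1 L" "wderiv L (wderiv L \<psi>) = wderiv L \<psi>'"
    by (rule H1_cong_AE[OF H(1)[OF d\<psi>(2,3)] m\<psi> e\<psi>])+
  have h\<omega>: "wderiv L \<omega> \<in> H1 L" by (rule H1_cong_AE(1)[OF H(1)[OF d\<omega>(2,3)] m\<omega> e\<omega>])
  have z\<psi>: "wderiv L \<psi> \<in> H1_0 L" by (rule H1_0_cong_AE[OF m(2) m\<psi> e\<psi> pos(7)])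
  have z\<omega>: "wderiv L \<omega> \<in> H1_0 L" by (rule H1_0_cong_AE[OF m(3) m\<omega> e\<omega> pos(7)])
  show "(\<phi>, \<psi>, \<omega>, u, v, z) \<in> bresse_dom L"
    using m V w\<phi> w\<psi> w\<omega> h\<phi> h\<psi> h\<omega> z\<psi> z\<omega> by (simp add: bresse_dom_def H2_def)
  show "(\<phi>, \<psi>, \<omega>, u, v, z) \<in> bresse_space L"
    using m V H1_L2[OF H1_0_H1[OF V(1)]] by (simp add: bresse_space_def H1_star_def)
  let ?S = "\<lambda>x. \<phi>' x + \<psi> x + l * \<omega> x" and ?A = "\<lambda>x. \<omega>' x - l * \<phi> x"
  have dS: "(?S has_real_derivative \<phi>'' x + \<psi>' x + l * \<omega>' x) (at x)" for x
    by (auto intro!: derivative_eq_intros d\<phi> d\<psi> d\<omega>)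
  have dA: "(?A has_real_derivative \<omega>'' x - l * \<phi>' x) (at x)" for x
    by (auto intro!: derivative_eq_intros d\<phi> d\<psi> d\<omega>)
  have cS: "continuous_on UNIV (\<lambda>x. \<phi>'' x + \<psi>' x + l * \<omega>' x)" "continuous_on UNIV (\<lambda>x. \<omega>'' x - l * \<phi>' x)"
    by (intro continuous_intros d\<phi> d\<omega> c')+
  have S: "AE x in ?M. ?S x = shear l L \<phi> \<psi> \<omega> x"
    using w\<phi>(2) by eventually_elim (simp add: shear_def)
  have A: "AE x in ?M. ?A x = axial l L \<phi> \<omega> x"
    using w\<omega>(2) by eventually_elim (simp add: axial_def)
  have mS: "shear l L \<phi> \<psi> \<omega> \<in> borel_measurable ?M" "axial l L \<phi> \<omega> \<in> borel_measurable ?M"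
    unfolding shear_def axial_def using w\<phi> w\<psi> w\<omega> H1_L2 wderiv_spec(1)
    by (auto intro!: L2_measurable L2_add L2_diff L2_cmult)
  have wS: "wderiv L (shear l L \<phi> \<psi> \<omega>) = wderiv L ?S"
    by (rule H1_cong_AE(2)[OF H(1)[OF dS cS(1)] mS(1) S])
  have wA: "wderiv L (axial l L \<phi> \<omega>) = wderiv L ?A"
    by (rule H1_cong_AE(2)[OF H(1)[OF dA cS(2)] mS(2) A])
  note wS' = H(2)[OF dS cS(1)] and wA' = H(2)[OF dA cS(2)] and w\<psi>' = H(2)[OF d\<psi>(2,3)]
  show "AE x in ?M. \<kappa> / \<rho>1 * wderiv L (shear l L \<phi> \<psi> \<omega>) x + \<kappa>0 * l / \<rho>1 * axial l L \<phi> \<omega> x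
       = \<kappa> / \<rho>1 * (\<phi>'' x + \<psi>' x + l * \<omega>' x) + \<kappa>0 * l / \<rho>1 * (\<omega>' x - l * \<phi> x)"
    using wS' A unfolding wS by eventually_elim simp
  show "AE x in ?M. b / \<rho>2 * wderiv L (wderiv L \<psi>) x - \<kappa> / \<rho>2 * shear l L \<phi> \<psi> \<omega> x - 1 / \<rho>2 * a x * v x
       = b / \<rho>2 * \<psi>'' x - \<kappa> / \<rho>2 * (\<phi>' x + \<psi> x + l * \<omega> x) - 1 / \<rho>2 * a x * v x"
    using w\<psi>' S unfolding h\<psi>(2) by eventually_elim simp
  show "AE x in ?M. \<kappa>0 / \<rho>1 * wderiv L (axial l L \<phi> \<omega>) x - \<kappa> * l / \<rho>1 * shear l L \<phi> \<psi> \<omega> x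
       = \<kappa>0 / \<rho>1 * (\<omega>'' x - l * \<phi>' x) - \<kappa> * l / \<rho>1 * (\<phi>' x + \<psi> x + l * \<omega> x)"
    using wA' S unfolding wA by eventually_elim simp
qed


text \<open>What the two settings of the semigroup have in common, which is all that the further proof needs. The cosine
  coefficients are bounded by the norm of either space.\<close>

lemma wellposed_cases:
  assumes "generates (bresse_space L) enorm (bresse_dom L) op T
    \<or> generates (bresse_full_space L) (bresse_full_norm L) (bresse_full_dom L) op T"
  obtains X N Dm K where "generates X N Dm op T" "bresse_space L \<subseteq> X" "X \<subseteq> bresse_full_space L"
    "bresse_dom L \<subseteq> Dm" "\<And>n. semigroup_functional X N T (cos_coeff L n) K"
    "\<And>p q r. \<lbrakk>AE x in interval_measure L. p x = 0; AE x in interval_measure L. q x = 0;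
       AE x in interval_measure L. r x = 0\<rbrakk> \<Longrightarrow> N (\<lambda>x. 0, \<lambda>x. 0, \<lambda>x. 0, p, q, r) = 0"
  using assms
proof
  assume g: "generates (bresse_space L) enorm (bresse_dom L) op T"
  show ?thesis
  proof (rule that[OF g order_refl bresse_space_subset order_refl _ enorm_residual_zero(1)])
    fix n
    show "semigroup_functional (bresse_space L) enorm T (cos_coeff L n) (sqrt (L / (2 * \<rho>1)))"
    proof
      show "C0_semigroup (bresse_space L) enorm T" using g by (simp add: generates_def)
      show "0 \<le> sqrt (L / (2 * \<rho>1))" using pos by simp
      fix U V :: state and c d :: real
      assume U: "U \<in> bresse_space L"
      then have U': "U \<in> bresse_full_space L" using bresse_space_subset by blast
      have "enorm U \<ge> 0" using pos by (cases U) (auto intro!: add_nonneg_nonneg)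
      moreover have eq: "L / \<rho>1 * energy U = L / (2 * \<rho>1) * (enorm U)\<^sup>2"
        unfolding energy_eq_norm[OF U'] by simp
      ultimately have "sqrt (L / \<rho>1 * energy U) = sqrt (L / (2 * \<rho>1)) * enorm U"
        unfolding eq real_sqrt_mult by simp
      then show "\<bar>cos_coeff L n U\<bar> \<le> sqrt (L / (2 * \<rho>1)) * enorm U"
        using cos_coeff_energy[OF U', of n] by simp
      assume V: "V \<in> bresse_space L"
      then have V': "V \<in> bresse_full_space L" using bresse_space_subset by blast
      show "c *\<^sub>R U + d *\<^sub>R V \<in> bresse_space L" by (rule lin_bresse_space[OF pos(7) U V])
      show "cos_coeff L n (c *\<^sub>R U + d *\<^sub>R V) = c * cos_coeff L n U + d * cos_coeff L n V"
        by (rule cos_coeff_lincomb[OF U' V'])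
    qed
  qed
next
  assume g: "generates (bresse_full_space L) (bresse_full_norm L) (bresse_full_dom L) op T"
  show ?thesis
  proof (rule that[OF g bresse_space_subset order_refl bresse_dom_subset _ enorm_residual_zero(2)])
    fix n
    show "semigroup_functional (bresse_full_space L) (bresse_full_norm L) T (cos_coeff L n) (sqrt (L / 2))"
    proof
      show "C0_semigroup (bresse_full_space L) (bresse_full_norm L) T" using g by (simp add: generates_def)
      show "0 \<le> sqrt (L / 2)" using pos by simp
      fix U V :: state and c d :: real
      assume U: "U \<in> bresse_full_space L"
      obtain \<phi> \<psi> \<omega> u v z where e: "U = (\<phi>, \<psi>, \<omega>, u, v, z)" by (cases U)
      have z: "z \<in> L2 L" using U by (auto simp: e bresse_full_space_def)
      have "(L2_norm_on L z)\<^sup>2 \<le> (bresse_full_norm L U)\<^sup>2"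
        unfolding e bresse_full_norm.simps by (subst real_sqrt_pow2) (auto intro!: add_nonneg_nonneg)
      then have "L / 2 * (L2_norm_on L z)\<^sup>2 \<le> L / 2 * (bresse_full_norm L U)\<^sup>2"
        using pos by (intro mult_left_mono) auto
      then have "(cos_coeff L n U)\<^sup>2 \<le> L / 2 * (bresse_full_norm L U)\<^sup>2"
        using cos_coeff_bound[OF pos(7) z, of n \<phi> \<psi> \<omega> u v] unfolding e by linarith
      then have "\<bar>cos_coeff L n U\<bar> \<le> sqrt (L / 2 * (bresse_full_norm L U)\<^sup>2)"
        by (rule real_le_rsqrt[of "\<bar>cos_coeff L n U\<bar>", unfolded power2_abs])
      moreover have "bresse_full_norm L U \<ge> 0" by (cases U) (auto intro!: add_nonneg_nonneg)
      ultimately show "\<bar>cos_coeff L n U\<bar> \<le> sqrt (L / 2) * bresse_full_norm L U"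
        unfolding real_sqrt_mult by simp
      assume V: "V \<in> bresse_full_space L"
      show "c *\<^sub>R U + d *\<^sub>R V \<in> bresse_full_space L" by (rule lin_bresse_full_space[OF pos(7) U V])
      show "cos_coeff L n (c *\<^sub>R U + d *\<^sub>R V) = c * cos_coeff L n U + d * cos_coeff L n V"
        by (rule cos_coeff_lincomb[OF U V])
    qed
  qed
qed

section \<open>Standing waves of the Bresse system\<close>

text \<open>The amplitudes of what is left when \<open>\<phi> = A sin (k x)\<close>, \<open>\<psi> = D cos (k x)\<close>, \<open>\<omega> = B cos (k x)\<close>,
  oscillating with frequency \<open>\<mu>\<close>, are inserted into the undamped system. The correction of \<open>\<psi>\<close> by the second
  cosine contributes residuals of the same form, with \<open>A = B = 0\<close>.\<close>

definition residual_\<phi> :: "real \<Rightarrow> real \<Rightarrow> real \<Rightarrow> real \<Rightarrow> real \<Rightarrow> real"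
  where "residual_\<phi> k \<mu> A D B = - \<mu>\<^sup>2 * A + \<kappa> / \<rho>1 * (A * k\<^sup>2 + D * k + l * B * k) + \<kappa>0 * l / \<rho>1 * (B * k + l * A)"

definition residual_\<psi> :: "real \<Rightarrow> real \<Rightarrow> real \<Rightarrow> real \<Rightarrow> real \<Rightarrow> real"
  where "residual_\<psi> k \<mu> A D B = - \<mu>\<^sup>2 * D + b / \<rho>2 * D * k\<^sup>2 + \<kappa> / \<rho>2 * (A * k + D + l * B)"

definition residual_\<omega> :: "real \<Rightarrow> real \<Rightarrow> real \<Rightarrow> real \<Rightarrow> real \<Rightarrow> real"
  where "residual_\<omega> k \<mu> A D B = - \<mu>\<^sup>2 * B + \<kappa>0 / \<rho>1 * (B * k\<^sup>2 + l * A * k) + \<kappa> * l / \<rho>1 * (A * k + D + l * B)"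

lemmas residual_defs = residual_\<phi>_def residual_\<psi>_def residual_\<omega>_def

lemma two_cos_bound: "\<bar>p * cos x + q * cos y\<bar> \<le> \<bar>p\<bar> + \<bar>q\<bar>" "\<bar>p * sin x + q * sin y\<bar> \<le> \<bar>p\<bar> + \<bar>q\<bar>" for p q x y :: real
proof -
  have "\<bar>p * cos x\<bar> \<le> \<bar>p\<bar>" "\<bar>q * cos y\<bar> \<le> \<bar>q\<bar>" "\<bar>p * sin x\<bar> \<le> \<bar>p\<bar>" "\<bar>q * sin y\<bar> \<le> \<bar>q\<bar>"
    unfolding abs_mult by (intro mult_left_le; simp)+
  then show "\<bar>p * cos x + q * cos y\<bar> \<le> \<bar>p\<bar> + \<bar>q\<bar>" "\<bar>p * sin x + q * sin y\<bar> \<le> \<bar>p\<bar> + \<bar>q\<bar>"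
    by linarith+
qed

text \<open>\<open>P\<close> is the standing wave at maximal displacement and \<open>Q\<close> the one at maximal velocity. \<open>S\<close> bounds the residuals,
  including the damping term, and \<open>R\<close> the velocities. The left side is the observed coefficient of the standing
  wave at time \<open>t\<close>. The right side bounds the one of the true solution, which has decayed, plus
  the deviation accumulated up to time \<open>t\<close>; the assumed decay enters for both terms.\<close>

lemma mode_estimate:
  fixes A B D \<gamma> \<mu> S R M \<delta> t :: real and n m :: nat
  defines "k \<equiv> freq L n" and "k' \<equiv> freq L m" and "G \<equiv> (2 * \<rho>1 + \<rho>2) * L / 2"
  assumes gen: "generates (bresse_space L) enorm (bresse_dom L) op T
    \<or> generates (bresse_full_space L) (bresse_full_norm L) (bresse_full_dom L) op T"
    and M: "M \<ge> 1" "\<delta> > 0" and decay: "\<And>U t. U \<in> bresse_space L \<Longrightarrow> t > 0 \<Longrightarrow> energy (T t U) \<le> M * exp (- \<delta> * t) * energy U"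
    and ortho: "(\<integral>x. a x * (cos (k * x) + \<gamma> * cos (k' * x)) \<partial>interval_measure L) = 0"
    and S: "\<bar>residual_\<phi> k \<mu> A D B\<bar> + \<bar>residual_\<phi> k' \<mu> 0 (D * \<gamma>) 0\<bar> \<le> S"
      "\<bar>residual_\<psi> k \<mu> A D B\<bar> + \<bar>residual_\<psi> k' \<mu> 0 (D * \<gamma>) 0\<bar> \<le> S"
      "\<bar>residual_\<omega> k \<mu> A D B\<bar> + \<bar>residual_\<omega> k' \<mu> 0 (D * \<gamma>) 0\<bar> \<le> S"
      "C / \<rho>2 * (\<bar>\<mu> * D\<bar> + \<bar>\<mu> * D * \<gamma>\<bar>) \<le> S"
    and R: "\<bar>\<mu> * A\<bar> \<le> R" "\<bar>\<mu> * D\<bar> + \<bar>\<mu> * D * \<gamma>\<bar> \<le> R" "\<bar>\<mu> * B\<bar> \<le> R"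
    and t: "t > 0"
  shows "\<bar>cos (\<mu> * t)\<bar> * (\<bar>\<mu> * B\<bar> * L / 2)
    \<le> sqrt (L / \<rho>1 * (M * exp (- \<delta> * t) * (G * R\<^sup>2))) + 2 * sqrt (L / \<rho>1 * (M * (G * S\<^sup>2))) * t"
proof -
  let ?M = "interval_measure L" and ?O = "\<lambda>x::real. 0::real"
  define \<phi> where "\<phi> x = A * sin (k * x)" for x
  define \<psi> where "\<psi> x = D * cos (k * x) + D * \<gamma> * cos (k' * x)" for x
  define \<omega> where "\<omega> x = B * cos (k * x)" for x
  define \<phi>' where "\<phi>' x = A * k * cos (k * x)" for x
  define \<phi>'' where "\<phi>'' x = - A * k\<^sup>2 * sin (k * x)" for x
  define \<psi>' where "\<psi>' x = - D * k * sin (k * x) - D * \<gamma> * k' * sin (k' * x)" for x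
  define \<psi>'' where "\<psi>'' x = - D * k\<^sup>2 * cos (k * x) - D * \<gamma> * k'\<^sup>2 * cos (k' * x)" for x
  define \<omega>' where "\<omega>' x = - B * k * sin (k * x)" for x
  define \<omega>'' where "\<omega>'' x = - B * k\<^sup>2 * cos (k * x)" for x
  define r4 where "r4 x = residual_\<phi> k \<mu> A D B * sin (k * x) + residual_\<phi> k' \<mu> 0 (D * \<gamma>) 0 * sin (k' * x)" for x
  define r5 where "r5 x = residual_\<psi> k \<mu> A D B * cos (k * x) + residual_\<psi> k' \<mu> 0 (D * \<gamma>) 0 * cos (k' * x)" for x
  define r6 where "r6 x = residual_\<omega> k \<mu> A D B * cos (k * x) + residual_\<omega> k' \<mu> 0 (D * \<gamma>) 0 * cos (k' * x)" for x
  define r where "r x = - (\<mu> * D / \<rho>2) * (a x * (cos (k * x) + \<gamma> * cos (k' * x)))" for x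
  define u where "u x = - \<mu> * A * sin (k * x)" for x
  define v where "v x = - \<mu> * D * cos (k * x) + (- \<mu> * D * \<gamma>) * cos (k' * x)" for x
  define z where "z x = - \<mu> * B * cos (k * x)" for x
  define P where "P = (\<phi>, \<psi>, \<omega>, ?O, ?O, ?O)"
  define Q where "Q = (?O, ?O, ?O, u, v, z)"
  define RP where "RP = (?O, ?O, ?O, r4, r5, r6)"
  define RQ where "RQ = (?O, ?O, ?O, ?O, r, ?O)"
  have O: "?O \<in> H1_0 L" "?O \<in> H1_star L" "?O \<in> L2 L" "?O \<in> L2_star L"
    using sin_H1_0[OF pos(7), of 0 0] cos_mode_H1_star[OF pos(7), of 0 0 0 0] L2_const[of 0 L]
    by (simp_all add: L2_star_def)
  have sH: "(\<lambda>x. p * sin (k * x)) \<in> H1_0 L" and sH': "(\<lambda>x. p * sin (k * x) + q * sin (k' * x)) \<in> H1_0 L" for p q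
    unfolding k_def k'_def using sin_H1_0[OF pos(7), of p n]
      H1_0_lincomb[OF pos(7) sin_H1_0[OF pos(7), of p n] sin_H1_0[OF pos(7), of q m], of 1 1] by simp_all
  have cH: "(\<lambda>x. p * cos (k * x) + q * cos (k' * x)) \<in> H1_star L" for p q
    unfolding k_def k'_def by (rule cos_mode_H1_star[OF pos(7)])
  have cH': "(\<lambda>x. p * cos (k * x)) \<in> H1_star L" for p using cH[of p 0] by simp
  have mem: "\<phi> \<in> H1_0 L" "\<psi>' \<in> H1_0 L" "\<omega>' \<in> H1_0 L" "\<psi> \<in> H1_star L" "\<omega> \<in> H1_star L"
    "u \<in> H1_0 L" "v \<in> H1_star L" "z \<in> H1_star L" "r4 \<in> H1_0 L" "r5 \<in> H1_star L" "r6 \<in> H1_star L"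
    unfolding \<phi>_def[abs_def] \<psi>'_def[abs_def] \<omega>'_def[abs_def] \<psi>_def[abs_def] \<omega>_def[abs_def]
      u_def[abs_def] v_def[abs_def] z_def[abs_def] r4_def[abs_def] r5_def[abs_def] r6_def[abs_def]
    using sH sH[of "- B * k"] sH[of "- \<mu> * A"] sH'[of "- D * k" "- D * \<gamma> * k'"] sH'
      cH cH[of "- \<mu> * D" "- \<mu> * D * \<gamma>"] cH' cH'[of "- \<mu> * B"] by simp_all
  have memL: "u \<in> L2 L" "v \<in> L2 L" "z \<in> L2 L" "r4 \<in> L2 L" "r5 \<in> L2 L" "r6 \<in> L2 L"
    using mem H1_0_H1 H1_L2 by (auto simp: H1_star_def)
  have d: "(\<phi> has_real_derivative \<phi>' x) (at x)" "(\<phi>' has_real_derivative \<phi>'' x) (at x)"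
    "(\<psi> has_real_derivative \<psi>' x) (at x)" "(\<psi>' has_real_derivative \<psi>'' x) (at x)"
    "(\<omega> has_real_derivative \<omega>' x) (at x)" "(\<omega>' has_real_derivative \<omega>'' x) (at x)" for x
    unfolding \<phi>_def \<phi>'_def \<phi>''_def \<psi>_def \<psi>'_def \<psi>''_def \<omega>_def \<omega>'_def \<omega>''_def
    by (auto intro!: derivative_eq_intros simp: power2_eq_square)
  have c: "continuous_on UNIV \<phi>''" "continuous_on UNIV \<psi>''" "continuous_on UNIV \<omega>''"
    unfolding \<phi>''_def \<psi>''_def \<omega>''_def by (intro continuous_intros)+
  note sP = smooth_state[OF d(1,2) c(1) d(3,4) c(2) d(5,6) c(3) mem(1-5) O(1,2,2)]
  have d0: "(?O has_real_derivative 0) (at x)" for x by simp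
  have c0: "continuous_on UNIV ?O" by simp
  note sQ = smooth_state[OF d0 d0 c0 d0 d0 c0 d0 d0 c0 O(1,1,1,2,2) mem(6-8)]
  have P: "P \<in> bresse_dom L" "P \<in> bresse_space L" unfolding P_def by (rule sP(1), rule sP(2))
  have Q: "Q \<in> bresse_dom L" "Q \<in> bresse_space L" unfolding Q_def by (rule sQ(1), rule sQ(2))
  have RP: "RP \<in> bresse_space L"
    unfolding RP_def bresse_space_def using O mem memL by (simp add: H1_star_def)
  have r_bound: "AE x in ?M. \<bar>r x\<bar> \<le> C / \<rho>2 * (\<bar>\<mu> * D\<bar> + \<bar>\<mu> * D * \<gamma>\<bar>)"
    using a_bound
  proof eventually_elim
    case (elim x)
    have "r x = - (a x / \<rho>2) * (\<mu> * D * cos (k * x) + \<mu> * D * \<gamma> * cos (k' * x))"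
      by (simp add: r_def algebra_simps)
    then have "\<bar>r x\<bar> = \<bar>a x\<bar> / \<rho>2 * \<bar>\<mu> * D * cos (k * x) + \<mu> * D * \<gamma> * cos (k' * x)\<bar>"
      using pos by (simp add: abs_mult)
    also have "\<dots> \<le> C / \<rho>2 * (\<bar>\<mu> * D\<bar> + \<bar>\<mu> * D * \<gamma>\<bar>)"
      using pos elim order.trans[OF abs_ge_zero elim] by (intro mult_mono two_cos_bound divide_right_mono) auto
    finally show ?case .
  qed
  have r_meas: "r \<in> borel_measurable ?M"
    unfolding r_def[abs_def] by (intro borel_measurable_times borel_measurable_const a_measurable measurable_cont continuous_intros)
  have rL: "r \<in> L2 L" by (rule L2_bounded[OF r_meas r_bound])
  have "(\<integral>x. r x \<partial>?M) = 0" unfolding r_def using ortho by simp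
  then have RQ: "RQ \<in> bresse_space L"
    unfolding RQ_def bresse_space_def using O rL by (simp add: L2_star_def)

  from gen show ?thesis
  proof (rule wellposed_cases)
    fix X N Dm K
    assume X: "generates X N Dm op T" "bresse_space L \<subseteq> X" "X \<subseteq> bresse_full_space L" "bresse_dom L \<subseteq> Dm"
      and sf: "\<And>n. semigroup_functional X N T (cos_coeff L n) K"
      and N0: "\<And>p q r. \<lbrakk>AE x in ?M. p x = 0; AE x in ?M. q x = 0; AE x in ?M. r x = 0\<rbrakk> \<Longrightarrow> N (?O, ?O, ?O, p, q, r) = 0"
    interpret semigroup_functional X N T "cos_coeff L n" K by (rule sf)
    have inX: "P \<in> X" "Q \<in> X" "RP \<in> X" "RQ \<in> X" using P Q RP RQ X(2) by auto
    have genI: "((\<lambda>h. N ((1 / h) *\<^sub>R (T h U - U) - F)) \<longlongrightarrow> 0) (at_right 0)"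
      if "U \<in> bresse_dom L" "U \<in> X" "F \<in> X" "N (op U - F) = 0" for U F
      using X(1,4) that unfolding generates_def by auto

    have FP: "\<mu> *\<^sub>R Q - RP \<in> X" using lin_X[OF inX(2,3), of \<mu> "-1"] by simp
    have FQ: "- \<mu> *\<^sub>R P - RQ \<in> X" using lin_X[OF inX(1,4), of "- \<mu>" "-1"] by simp
    have genP: "((\<lambda>h. N ((1 / h) *\<^sub>R (T h P - P) - (\<mu> *\<^sub>R Q - RP))) \<longlongrightarrow> 0) (at_right 0)"
    proof (rule genI[OF P(1) inX(1) FP])
      have e: "op P - (\<mu> *\<^sub>R Q - RP) = (?O, ?O, ?O,
        \<lambda>x. \<kappa> / \<rho>1 * wderiv L (shear l L \<phi> \<psi> \<omega>) x + \<kappa>0 * l / \<rho>1 * axial l L \<phi> \<omega> x - (\<mu> * u x - r4 x),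
        \<lambda>x. b / \<rho>2 * wderiv L (wderiv L \<psi>) x - \<kappa> / \<rho>2 * shear l L \<phi> \<psi> \<omega> x - 1 / \<rho>2 * a x * 0 - (\<mu> * v x - r5 x),
        \<lambda>x. \<kappa>0 / \<rho>1 * wderiv L (axial l L \<phi> \<omega>) x - \<kappa> * l / \<rho>1 * shear l L \<phi> \<psi> \<omega> x - (\<mu> * z x - r6 x))"
        unfolding P_def Q_def RP_def by (simp add: state_simps)
      show "N (op P - (\<mu> *\<^sub>R Q - RP)) = 0"
        unfolding e
      proof (rule N0)
        note alg = algebra_simps power2_eq_square add_divide_distrib diff_divide_distrib
        show "AE x in ?M. \<kappa> / \<rho>1 * wderiv L (shear l L \<phi> \<psi> \<omega>) x + \<kappa>0 * l / \<rho>1 * axial l L \<phi> \<omega> x - (\<mu> * u x - r4 x) = 0"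
          using sP(3) by eventually_elim
            (simp add: residual_defs \<phi>_def \<phi>'_def \<phi>''_def \<psi>_def \<psi>'_def \<psi>''_def \<omega>_def \<omega>'_def \<omega>''_def u_def r4_def alg)
        show "AE x in ?M. b / \<rho>2 * wderiv L (wderiv L \<psi>) x - \<kappa> / \<rho>2 * shear l L \<phi> \<psi> \<omega> x - 1 / \<rho>2 * a x * 0 - (\<mu> * v x - r5 x) = 0"
          using sP(4) by eventually_elim
            (simp add: residual_defs \<phi>_def \<phi>'_def \<phi>''_def \<psi>_def \<psi>'_def \<psi>''_def \<omega>_def \<omega>'_def \<omega>''_def v_def r5_def alg)
        show "AE x in ?M. \<kappa>0 / \<rho>1 * wderiv L (axial l L \<phi> \<omega>) x - \<kappa> * l / \<rho>1 * shear l L \<phi> \<psi> \<omega> x - (\<mu> * z x - r6 x) = 0"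
          using sP(5) by eventually_elim
            (simp add: residual_defs \<phi>_def \<phi>'_def \<phi>''_def \<psi>_def \<psi>'_def \<psi>''_def \<omega>_def \<omega>'_def \<omega>''_def z_def r6_def alg)
      qed
    qed
    have genQ: "((\<lambda>h. N ((1 / h) *\<^sub>R (T h Q - Q) - (- \<mu> *\<^sub>R P - RQ))) \<longlongrightarrow> 0) (at_right 0)"
    proof (rule genI[OF Q(1) inX(2) FQ])
      have e: "op Q - (- \<mu> *\<^sub>R P - RQ) = (?O, ?O, ?O,
        \<lambda>x. \<kappa> / \<rho>1 * wderiv L (shear l L ?O ?O ?O) x + \<kappa>0 * l / \<rho>1 * axial l L ?O ?O x,
        \<lambda>x. b / \<rho>2 * wderiv L (wderiv L ?O) x - \<kappa> / \<rho>2 * shear l L ?O ?O ?O x - 1 / \<rho>2 * a x * v x + r x,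
        \<lambda>x. \<kappa>0 / \<rho>1 * wderiv L (axial l L ?O ?O) x - \<kappa> * l / \<rho>1 * shear l L ?O ?O ?O x)"
        unfolding P_def Q_def RQ_def
        by (simp add: state_simps u_def v_def z_def \<phi>_def \<psi>_def \<omega>_def fun_eq_iff algebra_simps)
      show "N (op Q - (- \<mu> *\<^sub>R P - RQ)) = 0"
        unfolding e
      proof (rule N0)
        show "AE x in ?M. \<kappa> / \<rho>1 * wderiv L (shear l L ?O ?O ?O) x + \<kappa>0 * l / \<rho>1 * axial l L ?O ?O x = 0"
          using sQ(3) by eventually_elim simp
        show "AE x in ?M. b / \<rho>2 * wderiv L (wderiv L ?O) x - \<kappa> / \<rho>2 * shear l L ?O ?O ?O x - 1 / \<rho>2 * a x * v x + r x = 0"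
          using sQ(4) by eventually_elim (simp add: v_def r_def algebra_simps)
        show "AE x in ?M. \<kappa>0 / \<rho>1 * wderiv L (axial l L ?O ?O) x - \<kappa> * l / \<rho>1 * shear l L ?O ?O ?O x = 0"
          using sQ(5) by eventually_elim simp
      qed
    qed

    have energy_nonneg: "0 \<le> energy U" if "U \<in> bresse_full_space L" for U
      unfolding energy_eq_norm[OF that] by simp
    have mono: "sqrt (L / \<rho>1 * x) \<le> sqrt (L / \<rho>1 * y)" if "x \<le> y" for x y
      using that pos by (intro real_sqrt_le_mono mult_left_mono) auto
    \<comment> \<open>at \<open>s = 0\<close> the decay assumption says nothing, but there \<open>M \<ge> 1\<close> gives the same bound\<close>
    have coeff: "\<bar>cos_coeff L n (T s U)\<bar> \<le> sqrt (L / \<rho>1 * (M * e))"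
      if U: "U \<in> bresse_space L" "energy U \<le> e" and s: "s \<ge> 0" for U e s
    proof (cases "s = 0")
      case True
      have Uf: "U \<in> bresse_full_space L" using U bresse_space_subset by blast
      have "1 * energy U \<le> M * e" using M U energy_nonneg[OF Uf] by (intro mult_mono) auto
      then show ?thesis
        using True f_T_0[of U] U X(2) order.trans[OF cos_coeff_energy[OF Uf, of n] mono[of "energy U" "M * e"]] by auto
    next
      case False
      have Uf: "U \<in> bresse_full_space L" using U bresse_space_subset by blast
      have TU: "T s U \<in> bresse_full_space L" using T_X[OF s] U X(2,3) by blast
      have "exp (- \<delta> * s) \<le> 1" using M s by simp
      then have "M * exp (- \<delta> * s) * energy U \<le> M * 1 * e"
        using M U energy_nonneg[OF Uf] by (intro mult_mono) auto
      then have "energy (T s U) \<le> M * e" using decay[OF U(1), of s] False s by simp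
      then show ?thesis using order.trans[OF cos_coeff_energy[OF TU, of n] mono] by blast
    qed
    have bS: "AE x in ?M. \<bar>r4 x\<bar> \<le> S" "AE x in ?M. \<bar>r5 x\<bar> \<le> S" "AE x in ?M. \<bar>r6 x\<bar> \<le> S"
      unfolding r4_def r5_def r6_def
      using S order.trans[OF two_cos_bound(1)] order.trans[OF two_cos_bound(2)] by (auto intro!: AE_I2)
    have bS0: "AE x in ?M. \<bar>?O x\<bar> \<le> S" using S(1) by (intro AE_I2) linarith
    have bS5: "AE x in ?M. \<bar>r x\<bar> \<le> S" using r_bound by eventually_elim (use S(4) in linarith)
    have "energy RP \<le> G * S\<^sup>2"
      using velocity_energy[OF memL(4) bS(1) memL(5) bS(2) memL(6) bS(3)] by (simp add: RP_def G_def algebra_simps)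
    note KP = coeff[OF RP this]
    have "energy RQ \<le> G * S\<^sup>2"
      using velocity_energy[OF O(3) bS0 rL bS5 O(3) bS0] by (simp add: RQ_def G_def algebra_simps)
    note KQ = coeff[OF RQ this]
    have bR: "\<bar>u x\<bar> \<le> R" "\<bar>v x\<bar> \<le> R" "\<bar>z x\<bar> \<le> R" for x
      using R two_cos_bound(2)[of "- \<mu> * A" "k * x" 0 0] two_cos_bound(1)[of "- \<mu> * D" "k * x" "- \<mu> * D * \<gamma>" "k' * x"]
        two_cos_bound(1)[of "- \<mu> * B" "k * x" 0 0]
      by (auto simp: u_def v_def z_def)
    have EQ: "energy Q \<le> G * R\<^sup>2"
      using velocity_energy[OF memL(1) AE_I2[OF bR(1)] memL(2) AE_I2[OF bR(2)] memL(3) AE_I2[OF bR(3)]]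
      by (simp add: Q_def G_def algebra_simps)
    have fP: "cos_coeff L n P = 0" by (simp add: P_def)
    have fQ: "cos_coeff L n Q = - \<mu> * B * (L / 2)"
    proof -
      have "cos_coeff L n Q = (\<integral>x. (- \<mu> * B) * (cos (freq L n * x) * cos (freq L n * x)) \<partial>?M)"
        by (simp add: Q_def z_def k_def mult.assoc)
      also have "\<dots> = - \<mu> * B * (\<integral>x. cos (freq L n * x) * cos (freq L n * x) \<partial>?M)"
        by (rule integral_mult_right_zero)
      finally show ?thesis using cos_freq_orthogonal[OF pos(7), of n n] by simp
    qed
    have TQ: "T t Q \<in> bresse_full_space L" using T_X[of t Q] t inX(2) X(3) by auto
    have "energy (T t Q) \<le> M * exp (- \<delta> * t) * (G * R\<^sup>2)"
      by (rule order.trans[OF decay[OF Q(2) t] mult_left_mono[OF EQ]]) (use M in simp)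
    then have "\<bar>cos_coeff L n (T t Q)\<bar> \<le> sqrt (L / \<rho>1 * (M * exp (- \<delta> * t) * (G * R\<^sup>2)))"
      using order.trans[OF cos_coeff_energy[OF TQ, of n] mono] by blast
    moreover have "\<bar>cos_coeff L n (T t Q) - (cos (\<mu> * t) * cos_coeff L n Q - sin (\<mu> * t) * cos_coeff L n P)\<bar>
        \<le> (sqrt (L / \<rho>1 * (M * (G * S\<^sup>2))) + sqrt (L / \<rho>1 * (M * (G * S\<^sup>2)))) * t"
      using t by (intro quasimode_estimate[OF inX genP genQ KP KQ]) auto
    then have "\<bar>cos_coeff L n (T t Q) - cos (\<mu> * t) * cos_coeff L n Q\<bar> \<le> 2 * sqrt (L / \<rho>1 * (M * (G * S\<^sup>2))) * t"
      unfolding fP by (simp add: algebra_simps)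
    moreover have "\<bar>y\<bar> \<le> p + q" if "\<bar>x\<bar> \<le> p" "\<bar>x - y\<bar> \<le> q" for x y p q :: real
      using that by linarith
    ultimately have "\<bar>cos (\<mu> * t) * cos_coeff L n Q\<bar>
        \<le> sqrt (L / \<rho>1 * (M * exp (- \<delta> * t) * (G * R\<^sup>2))) + 2 * sqrt (L / \<rho>1 * (M * (G * S\<^sup>2))) * t"
      by blast
    moreover have "\<bar>cos (\<mu> * t) * cos_coeff L n Q\<bar> = \<bar>cos (\<mu> * t)\<bar> * (\<bar>\<mu> * B\<bar> * L / 2)"
      using pos(7) by (simp add: fQ abs_mult)
    ultimately show "\<bar>cos (\<mu> * t)\<bar> * (\<bar>\<mu> * B\<bar> * L / 2)
        \<le> sqrt (L / \<rho>1 * (M * exp (- \<delta> * t) * (G * R\<^sup>2))) + 2 * sqrt (L / \<rho>1 * (M * (G * S\<^sup>2))) * t"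
      by (simp only:)
  qed
qed

text \<open>The time \<open>\<tau>\<close> is chosen first, such that the decay leaves less than an eighth of the observed
  coefficient; then \<open>n\<close> is taken so large that the deviation up to time \<open>\<tau> + 1\<close> is as small. The comparison is made at
  a multiple of the period \<open>2 \<pi> / \<mu> n\<close> between \<open>\<tau>\<close> and \<open>\<tau> + 1\<close>, where the standing wave is back at its initial state.\<close>

lemma modes_prevent_decay:
  fixes A B D \<mu> :: "nat \<Rightarrow> real"
  assumes gen: "generates (bresse_space L) enorm (bresse_dom L) op T
    \<or> generates (bresse_full_space L) (bresse_full_norm L) (bresse_full_dom L) op T"
    and \<mu>: "filterlim \<mu> at_top sequentially"
    and A: "(\<lambda>n. \<mu> n * A n) \<longlonglongrightarrow> \<alpha>" and B: "(\<lambda>n. \<mu> n * B n) \<longlonglongrightarrow> \<beta>" "\<beta> \<noteq> 0"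
    and D: "(\<lambda>n. (\<mu> n)\<^sup>2 * D n) \<longlonglongrightarrow> d"
    and res: "(\<lambda>n. residual_\<phi> (freq L n) (\<mu> n) (A n) (D n) (B n)) \<longlonglongrightarrow> 0"
      "(\<lambda>n. residual_\<psi> (freq L n) (\<mu> n) (A n) (D n) (B n)) \<longlonglongrightarrow> 0"
      "(\<lambda>n. residual_\<omega> (freq L n) (\<mu> n) (A n) (D n) (B n)) \<longlonglongrightarrow> 0"
  shows "\<not> (\<exists>M\<ge>1. \<exists>\<delta>>0. \<forall>U\<in>bresse_space L. \<forall>t>0. energy (T t U) \<le> M * exp (- \<delta> * t) * energy U)"
proof
  assume "\<exists>M\<ge>1. \<exists>\<delta>>0. \<forall>U\<in>bresse_space L. \<forall>t>0. energy (T t U) \<le> M * exp (- \<delta> * t) * energy U"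
  then obtain M \<delta> where M: "M \<ge> 1" "\<delta> > 0"
    and dec: "\<forall>U\<in>bresse_space L. \<forall>t>0. energy (T t U) \<le> M * exp (- \<delta> * t) * energy U"
    by (elim exE conjE) (rule that)
  note decay = dec[rule_format]
  obtain \<gamma> m where \<gamma>: "\<gamma> \<longlonglongrightarrow> 0"
    and ortho: "\<And>n. (\<integral>x. a x * (cos (freq L n * x) + \<gamma> n * cos (freq L m * x)) \<partial>interval_measure L) = 0"
    by (rule orthogonal_correction[OF pos(7) a_L2]) (blast intro: that)
  define G where "G = (2 * \<rho>1 + \<rho>2) * L / 2"
  have G: "G > 0" using pos by (simp add: G_def add_pos_pos)
  let ?k = "freq L m"
  have i\<mu>: "(\<lambda>n. inverse (\<mu> n)) \<longlonglongrightarrow> 0"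
    by (rule tendsto_inverse_0_at_top[OF \<mu>])
  have ev\<mu>: "\<forall>\<^sub>F n in sequentially. \<mu> n \<noteq> 0"
    using eventually_compose_filterlim[OF eventually_gt_at_top[of 0] \<mu>] by eventually_elim simp
  \<comment> \<open>the damping term vanishes in the limit\<close>
  have \<mu>D: "(\<lambda>n. \<mu> n * D n) \<longlonglongrightarrow> 0"
  proof (rule Lim_transform_eventually)
    show "(\<lambda>n. inverse (\<mu> n) * ((\<mu> n)\<^sup>2 * D n)) \<longlonglongrightarrow> 0" using tendsto_mult[OF i\<mu> D] by simp
    show "\<forall>\<^sub>F n in sequentially. inverse (\<mu> n) * ((\<mu> n)\<^sup>2 * D n) = \<mu> n * D n"
      using ev\<mu> by eventually_elim (simp add: power2_eq_square)
  qed
  have D0: "D \<longlonglongrightarrow> 0"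
  proof (rule Lim_transform_eventually)
    show "(\<lambda>n. inverse (\<mu> n) * (\<mu> n * D n)) \<longlonglongrightarrow> 0" using tendsto_mult[OF i\<mu> \<mu>D] by simp
    show "\<forall>\<^sub>F n in sequentially. inverse (\<mu> n) * (\<mu> n * D n) = D n"
      using ev\<mu> by eventually_elim simp
  qed
  have corr: "(\<lambda>n. residual_\<phi> ?k (\<mu> n) 0 (D n * \<gamma> n) 0) \<longlonglongrightarrow> 0"
    "(\<lambda>n. residual_\<psi> ?k (\<mu> n) 0 (D n * \<gamma> n) 0) \<longlonglongrightarrow> 0"
    "(\<lambda>n. residual_\<omega> ?k (\<mu> n) 0 (D n * \<gamma> n) 0) \<longlonglongrightarrow> 0"
  proof -
    have "(\<lambda>n. \<kappa> / \<rho>1 * ?k * (D n * \<gamma> n)) \<longlonglongrightarrow> \<kappa> / \<rho>1 * ?k * (0 * 0)"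
      by (intro tendsto_intros D0 \<gamma>)
    then show "(\<lambda>n. residual_\<phi> ?k (\<mu> n) 0 (D n * \<gamma> n) 0) \<longlonglongrightarrow> 0"
      by (simp add: residual_\<phi>_def mult_ac)
    have "(\<lambda>n. - ((\<mu> n)\<^sup>2 * D n) * \<gamma> n + (b / \<rho>2 * ?k\<^sup>2 + \<kappa> / \<rho>2) * (D n * \<gamma> n)) \<longlonglongrightarrow> - d * 0 + (b / \<rho>2 * ?k\<^sup>2 + \<kappa> / \<rho>2) * (0 * 0)"
      by (intro tendsto_intros D D0 \<gamma>)
    then show "(\<lambda>n. residual_\<psi> ?k (\<mu> n) 0 (D n * \<gamma> n) 0) \<longlonglongrightarrow> 0"
      by (simp add: residual_\<psi>_def algebra_simps)
    have "(\<lambda>n. \<kappa> * l / \<rho>1 * (D n * \<gamma> n)) \<longlonglongrightarrow> \<kappa> * l / \<rho>1 * (0 * 0)"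
      by (intro tendsto_intros D0 \<gamma>)
    then show "(\<lambda>n. residual_\<omega> ?k (\<mu> n) 0 (D n * \<gamma> n) 0) \<longlonglongrightarrow> 0"
      by (simp add: residual_\<omega>_def mult_ac)
  qed
  define s where "s n = (\<bar>residual_\<phi> (freq L n) (\<mu> n) (A n) (D n) (B n)\<bar> + \<bar>residual_\<phi> ?k (\<mu> n) 0 (D n * \<gamma> n) 0\<bar>)
     + (\<bar>residual_\<psi> (freq L n) (\<mu> n) (A n) (D n) (B n)\<bar> + \<bar>residual_\<psi> ?k (\<mu> n) 0 (D n * \<gamma> n) 0\<bar>)
     + (\<bar>residual_\<omega> (freq L n) (\<mu> n) (A n) (D n) (B n)\<bar> + \<bar>residual_\<omega> ?k (\<mu> n) 0 (D n * \<gamma> n) 0\<bar>)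
     + \<bar>C\<bar> / \<rho>2 * (\<bar>\<mu> n * D n\<bar> + \<bar>\<mu> n * D n * \<gamma> n\<bar>)" for n
  have "s \<longlonglongrightarrow> (\<bar>0\<bar> + \<bar>0\<bar>) + (\<bar>0\<bar> + \<bar>0\<bar>) + (\<bar>0\<bar> + \<bar>0\<bar>) + \<bar>C\<bar> / \<rho>2 * (\<bar>0\<bar> + \<bar>0 * 0\<bar>)"
    unfolding s_def[abs_def] by (intro tendsto_intros res corr \<mu>D \<gamma>)
  then have s: "s \<longlonglongrightarrow> 0" by simp
  define R where "R = \<bar>\<alpha>\<bar> + 2 * \<bar>\<beta>\<bar> + 1"
  have R\<beta>: "R \<ge> 1" by (simp add: R_def)
  \<comment> \<open>what the decay leaves of the observed coefficient at time \<open>\<tau>\<close>\<close>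
  define E where "E \<tau> = sqrt (L / \<rho>1 * (M * exp (- \<delta> * \<tau>) * (G * R\<^sup>2)))" for \<tau>
  have "((\<lambda>\<tau>. exp (- \<delta> * \<tau>)) \<longlongrightarrow> 0) at_top"
  proof (rule filterlim_compose[OF exp_at_bot])
    show "filterlim (\<lambda>\<tau>. - \<delta> * \<tau>) at_bot at_top"
      using M by (intro filterlim_tendsto_neg_mult_at_bot[OF tendsto_const] filterlim_ident) auto
  qed
  then have "(E \<longlongrightarrow> sqrt (L / \<rho>1 * (M * 0 * (G * R\<^sup>2)))) at_top"
    unfolding E_def[abs_def] by (intro tendsto_intros)
  then have "(E \<longlongrightarrow> 0) at_top" by simp
  moreover have "\<bar>\<beta>\<bar> * L / 16 > 0" using B pos by simp
  ultimately have "\<forall>\<^sub>F \<tau> in at_top. E \<tau> < \<bar>\<beta>\<bar> * L / 16" by (rule order_tendstoD)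
  with eventually_gt_at_top[of 0] have "\<forall>\<^sub>F \<tau> in at_top. 0 < \<tau> \<and> E \<tau> < \<bar>\<beta>\<bar> * L / 16"
    by eventually_elim simp
  then obtain \<tau> where \<tau>: "\<tau> > 0" "E \<tau> < \<bar>\<beta>\<bar> * L / 16"
    using eventually_happens'[OF trivial_limit_at_top_linorder, of "\<lambda>\<tau>. 0 < \<tau> \<and> E \<tau> < \<bar>\<beta>\<bar> * L / 16"] by auto
  have "(\<lambda>n. 2 * sqrt (L / \<rho>1 * (M * (G * (s n)\<^sup>2))) * (\<tau> + 1)) \<longlonglongrightarrow> 2 * sqrt (L / \<rho>1 * (M * (G * 0\<^sup>2))) * (\<tau> + 1)"
    by (intro tendsto_intros s)
  then have lim: "(\<lambda>n. 2 * sqrt (L / \<rho>1 * (M * (G * (s n)\<^sup>2))) * (\<tau> + 1)) \<longlonglongrightarrow> 0" by simp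
  have lB: "(\<lambda>n. \<bar>\<mu> n * B n\<bar>) \<longlonglongrightarrow> \<bar>\<beta>\<bar>" and lA: "(\<lambda>n. \<bar>\<mu> n * A n\<bar>) \<longlonglongrightarrow> \<bar>\<alpha>\<bar>"
    using A B by (auto intro: tendsto_rabs)
  have lD: "(\<lambda>n. \<bar>\<mu> n * D n\<bar> + \<bar>\<mu> n * D n * \<gamma> n\<bar>) \<longlonglongrightarrow> \<bar>0\<bar> + \<bar>0 * 0\<bar>"
    by (intro tendsto_intros \<mu>D \<gamma>)
  have "\<forall>\<^sub>F n in sequentially. 2 * sqrt (L / \<rho>1 * (M * (G * (s n)\<^sup>2))) * (\<tau> + 1) < \<bar>\<beta>\<bar> * L / 16
      \<and> \<bar>\<beta>\<bar> / 2 < \<bar>\<mu> n * B n\<bar> \<and> \<bar>\<mu> n * B n\<bar> < R \<and> \<bar>\<mu> n * A n\<bar> < R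
      \<and> \<bar>\<mu> n * D n\<bar> + \<bar>\<mu> n * D n * \<gamma> n\<bar> < R \<and> \<mu> n > 2 * pi"
    using \<open>\<bar>\<beta>\<bar> * L / 16 > 0\<close> B R\<beta>
    by (intro eventually_conj order_tendstoD(2)[OF lim] order_tendstoD(1)[OF lB] order_tendstoD(2)[OF lB]
        order_tendstoD(2)[OF lA] order_tendstoD(2)[OF lD] eventually_compose_filterlim[OF eventually_gt_at_top \<mu>])
      (auto simp: R_def)
  from eventually_happens'[OF sequentially_bot this]
  obtain n where n: "2 * sqrt (L / \<rho>1 * (M * (G * (s n)\<^sup>2))) * (\<tau> + 1) < \<bar>\<beta>\<bar> * L / 16"
    "\<bar>\<beta>\<bar> / 2 < \<bar>\<mu> n * B n\<bar>" "\<bar>\<mu> n * B n\<bar> < R" "\<bar>\<mu> n * A n\<bar> < R"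
    "\<bar>\<mu> n * D n\<bar> + \<bar>\<mu> n * D n * \<gamma> n\<bar> < R" "\<mu> n > 2 * pi"
    by (elim exE conjE) (rule that)
  have \<mu>0: "\<mu> n > 0" using n(6) pi_gt_zero by linarith
  \<comment> \<open>the number of periods to reach \<open>\<tau>\<close>\<close>
  define j where "j = \<lceil>\<tau> * \<mu> n / (2 * pi)\<rceil>"
  define t where "t = 2 * pi * of_int j / \<mu> n"
  have jl: "\<tau> * \<mu> n / (2 * pi) \<le> of_int j" and ju: "of_int j \<le> \<tau> * \<mu> n / (2 * pi) + 1"
    unfolding j_def by linarith+
  have t\<tau>: "\<tau> \<le> t" using jl \<mu>0 by (simp add: t_def field_simps)
  have "t \<le> \<tau> + 2 * pi / \<mu> n" using ju \<mu>0 by (simp add: t_def field_simps)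
  moreover have "2 * pi / \<mu> n \<le> 1" using n(6) \<mu>0 by simp
  ultimately have tu: "t \<le> \<tau> + 1" by linarith
  have t0: "t > 0" using \<tau> t\<tau> by linarith
  have "cos (\<mu> n * t) = 1" using \<mu>0 cos_int_2pin[of j] by (simp add: t_def)
  have sC: "C / \<rho>2 * x \<le> \<bar>C\<bar> / \<rho>2 * x" "0 \<le> \<bar>C\<bar> / \<rho>2 * x" if "x \<ge> 0" for x
    using pos that divide_right_mono[OF abs_ge_self, of \<rho>2 C] by (simp_all add: mult_right_mono del: times_divide_eq_left)
  have summand: "x1 \<le> x1 + x2 + x3 + x4" "x2 \<le> x1 + x2 + x3 + x4" "x3 \<le> x1 + x2 + x3 + x4" "x4 \<le> x1 + x2 + x3 + x4"
    if "0 \<le> x1" "0 \<le> x2" "0 \<le> x3" "0 \<le> x4" for x1 x2 x3 x4 :: real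
    using that by linarith+
  have sb: "\<bar>residual_\<phi> (freq L n) (\<mu> n) (A n) (D n) (B n)\<bar> + \<bar>residual_\<phi> ?k (\<mu> n) 0 (D n * \<gamma> n) 0\<bar> \<le> s n"
    "\<bar>residual_\<psi> (freq L n) (\<mu> n) (A n) (D n) (B n)\<bar> + \<bar>residual_\<psi> ?k (\<mu> n) 0 (D n * \<gamma> n) 0\<bar> \<le> s n"
    "\<bar>residual_\<omega> (freq L n) (\<mu> n) (A n) (D n) (B n)\<bar> + \<bar>residual_\<omega> ?k (\<mu> n) 0 (D n * \<gamma> n) 0\<bar> \<le> s n"
    "C / \<rho>2 * (\<bar>\<mu> n * D n\<bar> + \<bar>\<mu> n * D n * \<gamma> n\<bar>) \<le> s n"
    unfolding s_def by (rule summand, (intro add_nonneg_nonneg abs_ge_zero sC(2))+)+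
      (rule order.trans[OF sC(1) summand(4)], (intro add_nonneg_nonneg abs_ge_zero sC(2))+)
  have "\<bar>cos (\<mu> n * t)\<bar> * (\<bar>\<mu> n * B n\<bar> * L / 2)
      \<le> sqrt (L / \<rho>1 * (M * exp (- \<delta> * t) * (G * R\<^sup>2))) + 2 * sqrt (L / \<rho>1 * (M * (G * (s n)\<^sup>2))) * t"
    unfolding G_def
    by (rule mode_estimate[OF gen M decay ortho sb less_imp_le[OF n(4)] less_imp_le[OF n(5)] less_imp_le[OF n(3)] t0])
  also have "\<dots> \<le> E \<tau> + 2 * sqrt (L / \<rho>1 * (M * (G * (s n)\<^sup>2))) * (\<tau> + 1)"
  proof (intro add_mono mult_left_mono)
    have "exp (- \<delta> * t) \<le> exp (- \<delta> * \<tau>)" using t\<tau> M by simp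
    then show "sqrt (L / \<rho>1 * (M * exp (- \<delta> * t) * (G * R\<^sup>2))) \<le> E \<tau>"
      unfolding E_def using pos M G
      by (intro real_sqrt_le_mono mult_left_mono mult_right_mono) auto
  qed (use tu pos M G in auto)
  also have "\<dots> < \<bar>\<beta>\<bar> * L / 16 + \<bar>\<beta>\<bar> * L / 16" using \<tau> n(1) by linarith
  finally have "\<bar>\<mu> n * B n\<bar> * L / 2 < \<bar>\<beta>\<bar> * L / 8" using \<open>cos (\<mu> n * t) = 1\<close> by (simp add: mult.commute)
  moreover have "\<bar>\<beta>\<bar> / 2 * L / 2 \<le> \<bar>\<mu> n * B n\<bar> * L / 2"
    using n(2) pos(7) by (intro divide_right_mono mult_right_mono) auto
  moreover have "0 < \<bar>\<beta>\<bar> * L" using B pos by simp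
  ultimately show False by linarith
qed

lemma freq_at_top: "filterlim (freq L) at_top sequentially"
proof -
  have "filterlim (\<lambda>n. pi / L * real (Suc n)) at_top sequentially"
    using pos by (intro filterlim_tendsto_pos_mult_at_top[OF tendsto_const]
        filterlim_compose[OF filterlim_real_sequentially filterlim_Suc]) auto
  then show ?thesis by (simp add: freq_def[abs_def] mult_ac)
qed

lemma inverse_freq: "(\<lambda>n. inverse (freq L n)) \<longlonglongrightarrow> 0"
  by (rule tendsto_inverse_0_at_top[OF freq_at_top])

text \<open>Only \<open>\<phi>\<close> has to follow the wave \<open>\<omega>\<close>; the force on \<open>\<psi>\<close> is of order \<open>1 / k\<close> and may be left as a residual.\<close>

lemma no_decay_distinct_wave_speeds:
  assumes gen: "generates (bresse_space L) enorm (bresse_dom L) op T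
    \<or> generates (bresse_full_space L) (bresse_full_norm L) (bresse_full_dom L) op T"
    and ne: "\<kappa> \<noteq> \<kappa>0"
  shows "\<not> (\<exists>M\<ge>1. \<exists>\<delta>>0. \<forall>U\<in>bresse_space L. \<forall>t>0. energy (T t U) \<le> M * exp (- \<delta> * t) * energy U)"
proof -
  let ?k = "freq L"
  define c where "c = sqrt (\<kappa>0 / \<rho>1)"
  have c: "c > 0" "c\<^sup>2 = \<kappa>0 / \<rho>1" using pos by (auto simp: c_def)
  \<comment> \<open>\<open>A = q / k\<^sup>2\<close> is the response of \<open>\<phi>\<close> to the force exerted by \<open>\<omega> = cos (k x) / k\<close>\<close>
  define q where "q = - ((\<kappa> + \<kappa>0) * l / (\<kappa> - \<kappa>0))"
  have q: "(\<kappa> - \<kappa>0) * q = - ((\<kappa> + \<kappa>0) * l)" using ne by (simp add: q_def)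
  have k: "?k n > 0" for n by (rule freq_pos[OF pos(7)])
  have kk: "?k n * inverse (?k n) = 1" for n using k[of n] by simp
  show ?thesis
  proof (rule modes_prevent_decay[OF gen])
    show "filterlim (\<lambda>n. c * ?k n) at_top sequentially"
      by (rule filterlim_tendsto_pos_mult_at_top[OF tendsto_const c(1) freq_at_top])
    have "(\<lambda>n. c * q * inverse (?k n)) \<longlonglongrightarrow> c * q * 0" by (intro tendsto_intros inverse_freq)
    moreover have e: "c * ?k n * (q * (inverse (?k n))\<^sup>2) = c * q * inverse (?k n)" for n
      using kk[of n] by (simp add: power2_eq_square)
    ultimately show "(\<lambda>n. c * ?k n * (q * (inverse (?k n))\<^sup>2)) \<longlonglongrightarrow> 0" unfolding e by simp
    have e: "c * ?k n * inverse (?k n) = c" for n using kk[of n] by (simp add: mult.assoc)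
    show "(\<lambda>n. c * ?k n * inverse (?k n)) \<longlonglongrightarrow> c" unfolding e by simp
    show "c \<noteq> 0" using c by simp
    show "(\<lambda>n. (c * ?k n)\<^sup>2 * 0) \<longlonglongrightarrow> 0" by simp
    have e: "residual_\<phi> (?k n) (c * ?k n) (q * (inverse (?k n))\<^sup>2) 0 (inverse (?k n)) = \<kappa>0 * l\<^sup>2 / \<rho>1 * q * (inverse (?k n))\<^sup>2" for n
    proof -
      have "residual_\<phi> (?k n) (c * ?k n) (q * (inverse (?k n))\<^sup>2) 0 (inverse (?k n))
        = ((\<kappa> - \<kappa>0) * q + (\<kappa> + \<kappa>0) * l) / \<rho>1 + \<kappa>0 * l\<^sup>2 / \<rho>1 * q * (inverse (?k n))\<^sup>2"
        using k[of n] pos(1) by (simp add: residual_\<phi>_def power_mult_distrib c) (simp add: field_simps power2_eq_square)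
      then show ?thesis by (simp add: q)
    qed
    moreover have "(\<lambda>n. \<kappa>0 * l\<^sup>2 / \<rho>1 * q * (inverse (?k n))\<^sup>2) \<longlonglongrightarrow> \<kappa>0 * l\<^sup>2 / \<rho>1 * q * 0\<^sup>2"
      by (intro tendsto_intros inverse_freq)
    ultimately show "(\<lambda>n. residual_\<phi> (?k n) (c * ?k n) (q * (inverse (?k n))\<^sup>2) 0 (inverse (?k n))) \<longlonglongrightarrow> 0" unfolding e by simp
    have e: "residual_\<psi> (?k n) (c * ?k n) (q * (inverse (?k n))\<^sup>2) 0 (inverse (?k n)) = \<kappa> / \<rho>2 * (q + l) * inverse (?k n)" for n
      using k[of n] pos(2) by (simp add: residual_\<psi>_def field_simps power2_eq_square)
    moreover have "(\<lambda>n. \<kappa> / \<rho>2 * (q + l) * inverse (?k n)) \<longlonglongrightarrow> \<kappa> / \<rho>2 * (q + l) * 0"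
      by (intro tendsto_intros inverse_freq)
    ultimately show "(\<lambda>n. residual_\<psi> (?k n) (c * ?k n) (q * (inverse (?k n))\<^sup>2) 0 (inverse (?k n))) \<longlonglongrightarrow> 0" unfolding e by simp
    have e: "residual_\<omega> (?k n) (c * ?k n) (q * (inverse (?k n))\<^sup>2) 0 (inverse (?k n))
        = (\<kappa>0 * l * q + \<kappa> * l * (q + l)) / \<rho>1 * inverse (?k n)" for n
      using k[of n] pos(1) by (simp add: residual_\<omega>_def power_mult_distrib c) (simp add: field_simps power2_eq_square)
    moreover have "(\<lambda>n. (\<kappa>0 * l * q + \<kappa> * l * (q + l)) / \<rho>1 * inverse (?k n)) \<longlonglongrightarrow> (\<kappa>0 * l * q + \<kappa> * l * (q + l)) / \<rho>1 * 0"
      by (intro tendsto_intros inverse_freq)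
    ultimately show "(\<lambda>n. residual_\<omega> (?k n) (c * ?k n) (q * (inverse (?k n))\<^sup>2) 0 (inverse (?k n))) \<longlonglongrightarrow> 0" unfolding e by simp
  qed
qed

text \<open>With \<open>A = - B\<close> the couplings between \<open>\<phi>\<close> and \<open>\<omega>\<close> act alike on both and only shift the frequency from
  \<open>k\<close> to \<open>k - l\<close> in units of the wave speed \<open>c\<close>.\<close>

lemma no_decay_equal_wave_speeds:
  assumes gen: "generates (bresse_space L) enorm (bresse_dom L) op T
    \<or> generates (bresse_full_space L) (bresse_full_norm L) (bresse_full_dom L) op T"
    and eq: "\<kappa>0 = \<kappa>" and ne: "\<rho>1 / \<rho>2 \<noteq> \<kappa> / b"
  shows "\<not> (\<exists>M\<ge>1. \<exists>\<delta>>0. \<forall>U\<in>bresse_space L. \<forall>t>0. energy (T t U) \<le> M * exp (- \<delta> * t) * energy U)"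
proof -
  let ?k = "freq L"
  define c where "c = sqrt (\<kappa> / \<rho>1)"
  have c: "c > 0" "c\<^sup>2 = \<kappa> / \<rho>1" using pos by (auto simp: c_def)
  define p where "p = b / \<rho>2 - \<kappa> / \<rho>1"
  have p: "p \<noteq> 0" using ne pos by (auto simp: p_def field_simps)
  \<comment> \<open>\<open>D = q / k\<^sup>2\<close> is the response of \<open>\<psi>\<close> to the force exerted by \<open>\<phi> = - sin (k x) / k\<close>\<close>
  define q where "q = \<kappa> / \<rho>2 / p"
  have qp: "q * (b / \<rho>2 - \<kappa> / \<rho>1) = \<kappa> / \<rho>2" using p by (simp add: q_def p_def[symmetric])
  have k: "?k n > 0" for n by (rule freq_pos[OF pos(7)])
  define j where "j n = inverse (?k n)" for n
  have j: "j \<longlonglongrightarrow> 0" unfolding j_def[abs_def] by (rule inverse_freq)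
  have kj: "?k n = inverse (j n)" "j n \<noteq> 0" for n using k[of n] by (simp_all add: j_def)
  show ?thesis
  proof (rule modes_prevent_decay[OF gen])
    have "filterlim (\<lambda>n. - l + ?k n) at_top sequentially"
      by (rule filterlim_tendsto_add_at_top[OF tendsto_const freq_at_top])
    then have "filterlim (\<lambda>n. c * (- l + ?k n)) at_top sequentially"
      by (rule filterlim_tendsto_pos_mult_at_top[OF tendsto_const c(1)])
    then show "filterlim (\<lambda>n. c * (?k n - l)) at_top sequentially" by simp
    have "(\<lambda>n. - (c * (1 - l * j n))) \<longlonglongrightarrow> - (c * (1 - l * 0))" by (intro tendsto_intros j)
    moreover have e: "c * (?k n - l) * (- j n) = - (c * (1 - l * j n))" for n
      using kj(2)[of n] unfolding kj(1) by (simp add: field_simps)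
    ultimately show "(\<lambda>n. c * (?k n - l) * (- j n)) \<longlonglongrightarrow> - c" unfolding e by simp
    have "(\<lambda>n. c * (1 - l * j n)) \<longlonglongrightarrow> c * (1 - l * 0)" by (intro tendsto_intros j)
    moreover have e: "c * (?k n - l) * j n = c * (1 - l * j n)" for n
      using kj(2)[of n] unfolding kj(1) by (simp add: field_simps)
    ultimately show "(\<lambda>n. c * (?k n - l) * j n) \<longlonglongrightarrow> c" unfolding e by simp
    show "c \<noteq> 0" using c by simp
    have "(\<lambda>n. c\<^sup>2 * q * (1 - l * j n)\<^sup>2) \<longlonglongrightarrow> c\<^sup>2 * q * (1 - l * 0)\<^sup>2" by (intro tendsto_intros j)
    moreover have e: "(c * (?k n - l))\<^sup>2 * (q * (j n)\<^sup>2) = c\<^sup>2 * q * (1 - l * j n)\<^sup>2" for n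
      using kj(2)[of n] unfolding kj(1) by (simp add: field_simps power2_eq_square)
    ultimately show "(\<lambda>n. (c * (?k n - l))\<^sup>2 * (q * (j n)\<^sup>2)) \<longlonglongrightarrow> c\<^sup>2 * q" unfolding e by simp
    have e: "residual_\<phi> (?k n) (c * (?k n - l)) (- j n) (q * (j n)\<^sup>2) (j n) = \<kappa> / \<rho>1 * q * j n" for n
      using kj(2)[of n] pos(1) unfolding residual_\<phi>_def unfolding kj(1) eq power_mult_distrib c(2)
      by (simp add: field_simps power2_eq_square)
    moreover have "(\<lambda>n. \<kappa> / \<rho>1 * q * j n) \<longlonglongrightarrow> \<kappa> / \<rho>1 * q * 0" by (intro tendsto_intros j)
    ultimately show "(\<lambda>n. residual_\<phi> (?k n) (c * (?k n - l)) (- j n) (q * (j n)\<^sup>2) (j n)) \<longlonglongrightarrow> 0" unfolding e by simp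
    have e: "residual_\<psi> (?k n) (c * (?k n - l)) (- j n) (q * (j n)\<^sup>2) (j n)
        = q * \<kappa> / \<rho>1 * (2 * l * j n - l\<^sup>2 * (j n)\<^sup>2) + \<kappa> / \<rho>2 * (l * j n + q * (j n)\<^sup>2)" for n
    proof -
      have "residual_\<psi> (?k n) (c * (?k n - l)) (- j n) (q * (j n)\<^sup>2) (j n)
        = (q * (b / \<rho>2 - \<kappa> / \<rho>1) - \<kappa> / \<rho>2)
          + (q * \<kappa> / \<rho>1 * (2 * l * j n - l\<^sup>2 * (j n)\<^sup>2) + \<kappa> / \<rho>2 * (l * j n + q * (j n)\<^sup>2))"
        using kj(2)[of n] pos(1,2) unfolding kj(1)
        by (simp add: residual_\<psi>_def power_mult_distrib c) (simp add: field_simps power2_eq_square)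
      then show ?thesis by (simp add: qp)
    qed
    moreover have "(\<lambda>n. q * \<kappa> / \<rho>1 * (2 * l * j n - l\<^sup>2 * (j n)\<^sup>2) + \<kappa> / \<rho>2 * (l * j n + q * (j n)\<^sup>2))
        \<longlonglongrightarrow> q * \<kappa> / \<rho>1 * (2 * l * 0 - l\<^sup>2 * 0\<^sup>2) + \<kappa> / \<rho>2 * (l * 0 + q * 0\<^sup>2)"
      by (intro tendsto_intros j)
    ultimately show "(\<lambda>n. residual_\<psi> (?k n) (c * (?k n - l)) (- j n) (q * (j n)\<^sup>2) (j n)) \<longlonglongrightarrow> 0" unfolding e by simp
    have e: "residual_\<omega> (?k n) (c * (?k n - l)) (- j n) (q * (j n)\<^sup>2) (j n) = \<kappa> * l / \<rho>1 * q * (j n)\<^sup>2" for n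
      using kj(2)[of n] pos(1) unfolding residual_\<omega>_def unfolding kj(1) eq power_mult_distrib c(2)
      by (simp add: field_simps power2_eq_square)
    moreover have "(\<lambda>n. \<kappa> * l / \<rho>1 * q * (j n)\<^sup>2) \<longlonglongrightarrow> \<kappa> * l / \<rho>1 * q * 0\<^sup>2" by (intro tendsto_intros j)
    ultimately show "(\<lambda>n. residual_\<omega> (?k n) (c * (?k n - l)) (- j n) (q * (j n)\<^sup>2) (j n)) \<longlonglongrightarrow> 0" unfolding e by simp
  qed
qed

end

theorem theorem2p2:
  fixes \<rho>1 \<rho>2 \<kappa> \<kappa>0 b l L \<alpha> \<beta> a0 :: real
    and a :: "real \<Rightarrow> real"
    and T :: "real \<Rightarrow> state \<Rightarrow> state"
  assumes "\<rho>1 > 0" "\<rho>2 > 0" "\<kappa> > 0" "\<kappa>0 > 0" "b > 0" "l > 0" "L > 0"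
    and "\<And>n::int. L \<noteq> of_int n * pi / l"
    and "a \<in> borel_measurable (lebesgue_on {0..L})"
    and "\<exists>C. AE x in lebesgue_on {0..L}. 0 \<le> a x \<and> a x \<le> C"
    and "0 \<le> \<alpha>" "\<alpha> < \<beta>" "\<beta> \<le> L" "a0 > 0"
    and "AE x in lebesgue_on {\<alpha><..<\<beta>}. a0 \<le> a x"
    and semigroup:
      "generates (bresse_space L) (bresse_norm \<rho>1 \<rho>2 \<kappa> \<kappa>0 b l L)
         (bresse_dom L) (bresse_op \<rho>1 \<rho>2 \<kappa> \<kappa>0 b l L a) T
       \<or> generates (bresse_full_space L) (bresse_full_norm L)
         (bresse_full_dom L) (bresse_op \<rho>1 \<rho>2 \<kappa> \<kappa>0 b l L a) T"
    and "\<kappa> \<noteq> \<kappa>0 \<or> \<rho>1 / \<rho>2 \<noteq> \<kappa> / b"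
  shows "\<not> (\<exists>M\<ge>1. \<exists>\<delta>>0. \<forall>U0\<in>bresse_space L. \<forall>t>0.
            bresse_energy \<rho>1 \<rho>2 \<kappa> \<kappa>0 b l L (T t U0)
              \<le> M * exp (- \<delta> * t) * bresse_energy \<rho>1 \<rho>2 \<kappa> \<kappa>0 b l L U0)"
proof -
  obtain C where C: "AE x in lebesgue_on {0..L}. 0 \<le> a x \<and> a x \<le> C"
    using assms(10) by blast
  interpret bresse \<rho>1 \<rho>2 \<kappa> \<kappa>0 b l L a C
  proof
    show "a \<in> borel_measurable (interval_measure L)"
      by (rule measurable_restrict_mono[OF assms(9)]) auto
    have "AE x in lebesgue. x \<in> {0..L} \<longrightarrow> 0 \<le> a x \<and> a x \<le> C"
      using C by (subst (asm) AE_restrict_space_iff) auto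
    then have "AE x in lebesgue. x \<in> {0<..<L} \<longrightarrow> \<bar>a x\<bar> \<le> C" by eventually_elim auto
    then show "AE x in interval_measure L. \<bar>a x\<bar> \<le> C"
      by (subst AE_restrict_space_iff) auto
  qed (use assms in auto)
  show ?thesis
  proof (cases "\<kappa> = \<kappa>0")
    case True
    then show ?thesis using no_decay_equal_wave_speeds[OF semigroup] assms(17) by simp
  next
    case False
    then show ?thesis by (rule no_decay_distinct_wave_speeds[OF semigroup])
  qed
qed

end
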